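(* Let $p\ge1$ and let $\mu,\nu$ be probability measures on $\mathbb R^d$ with $\mu\le_{cvx}\nu$ and $\nu$ compactly supported. For $N\ge1$ let $\Gamma_{2,N}$ be a quadratic optimal $N$-quantizer of $\mu$ with Borel nearest neighbour projection $\mathrm{Proj}_{\Gamma_{2,N}}$ and $\hat\mu^N=\mu\circ\mathrm{Proj}_{\Gamma_{2,N}}^{-1}$. For $K\ge d+1$ let $(\Gamma^{del}_{p,K},\mathrm{Proj}^{del}_{\Gamma^{del}_{p,K}})$ be an $L^p$-optimal dual $K$-quantization of $\nu$ and $\check\nu^K$ the law of $\mathrm{Proj}^{del}_{\Gamma^{del}_{p,K}}(Y,U)$ with $Y\sim\nu$ independent of $U\sim\mathcal U[0,1]$. For $y\in\mathbb R^d$ let $q_y$ be the law of $\mathrm{Proj}^{del}_{\Gamma^{del}_{p,K}}(y,U)$ if $y\in\mathrm{conv}(\Gamma^{del}_{p,K})$ and $q_y=\delta_y$ otherwise. For $\pi\in\mathcal M(\mu,\nu)$ define $$\bar\pi^{N,K}(d\hat x,d\check y)=\int_{(x,y)\in\mathbb R^d\times\mathbb R^d}\delta_{\mathrm{Proj}_{\Gamma_{2,N}}(x)}(d\hat x)\,\pi(dx,dy)\,q_y(d\check y).$$ Then $\bar\pi^{N,K}\in\mathcal M(\hat\mu^N,\check\nu^K)$ and $$W_p^p(\bar\pi^{N,K},\pi)\le\begin{cases}e_{2,N}^p(\mu)+d_{p,K}^p(\nu)&\text{if }p\le2,\\ C N^{-p/d}+2^{\frac{p-2}{2}}d_{p,K}^p(\nu)&\text{if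 }2<p<2+d,\end{cases}$$ for some constant $C<\infty$ not depending on $N,K$. Moreover, when $p\ge2$, $W_2^2(\bar\pi^{N,K},\pi)\le e_{2,N}^2(\mu)+d_{p,K}^2(\nu)$. Finally, for every $p\ge1$ and $K$, $\limsup_{N\to\infty}AW_p(\bar\pi^{N,K},\pi)\le d_{p,K}(\nu)$.
   Context: $\le_{cvx}$: convex order ($\int\varphi d\mu\le\int\varphi d\nu$ for all convex $\varphi$). Every coupling $\pi$ of $\mu,\nu$ disintegrates as $\pi(dx,dy)=\mu(dx)\pi_x(dy)$; $\mathcal M(\mu,\nu)$ is the set of couplings with $\int y\,\pi_x(dy)=x$ for $\mu$-a.e. $x$ (martingale couplings), and $M_p(\mu,\nu)=\inf_{\pi\in\mathcal M(\mu,\nu)}(\int|x-y|^p d\pi)^{1/p}$. $W_p$ is the $p$-Wasserstein distance (on $\mathbb R^d\times\mathbb R^d$ with the Euclidean norm on $\mathbb R^{2d}$ for couplings). Adapted Wasserstein distance between $\pi=\mu(dx)\pi_x(dy)$ and $\tilde\pi=\tilde\mu(d\tilde x)\tilde\pi_{\tilde x}(d\tilde y)$: $AW_p(\pi,\tilde\pi)=\inf_m\left(\int(|x-\tilde x|^p+W_p^p(\pi_x,\tilde\pi_{\tilde x}))m(dx,d\tilde x)\right)^{1/p}$, infimum over couplings $m$ of $\mu,\tilde\mu$. Primal: $e_{2,N}(\mu)^2=\inf_{|\Gamma|\le N}\int\mathrm{dist}(x,\Gamma)^2\mu(dx)$; a quadratic optimal $N$-quantizer attains it; a Borel nearest neighbour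 projection is a Borel map $\mathrm{Proj}_\Gamma:\mathbb R^d\to\Gamma$ with $|x-\mathrm{Proj}_\Gamma(x)|=\mathrm{dist}(x,\Gamma)$. Dual: for a finite $\Gamma$, a splitting operator is a measurable map $\mathrm{Proj}^{del}_\Gamma:\mathrm{conv}(\Gamma)\times[0,1]\to\Gamma$ with $\int_0^1\mathrm{Proj}^{del}_\Gamma(y,u)du=y$ for all $y\in\mathrm{conv}(\Gamma)$. The dual quantization error is $d_{p,K}(\nu)=\inf\{M_p(\nu,\eta):\nu\le_{cvx}\eta,\ \eta\text{ supported on at most }K\text{ points}\}$. An $L^p$-optimal dual $K$-quantization of $\nu$ is a set $\Gamma$ of at most $K$ points with $\mathrm{supp}(\nu)\subset\mathrm{conv}(\Gamma)$ together with a splitting operator such that $d_{p,K}(\nu)=\left(\mathbb E|Y-\mathrm{Proj}^{del}_\Gamma(Y,U)|^p\right)^{1/p}$ for $Y\sim\nu$ independent of $U\sim\mathcal U[0,1]$ (such exists for $K\ge d+1$). *)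

theory Defs
  imports "HOL-Probability.Probability"
begin

definition borel_prob :: "'a::topological_space measure \<Rightarrow> bool" where
  "borel_prob M \<longleftrightarrow> prob_space M \<and> sets M = sets borel"

definition support_meas :: "'a::metric_space measure \<Rightarrow> 'a set" where
  "support_meas M = {x. \<forall>e>0. emeasure M (ball x e) > 0}"

definition cvx_le :: "'a::euclidean_space measure \<Rightarrow> 'a measure \<Rightarrow> bool" where
  "cvx_le \<mu> \<nu> \<longleftrightarrow> integrable \<mu> (\<lambda>x. norm x) \<and> integrable \<nu> (\<lambda>x. norm x) \<and>
     (\<forall>\<phi>::'a \<Rightarrow> real. convex_on UNIV \<phi> \<longrightarrow> integrable \<nu> \<phi> \<longrightarrow>
        integrable \<mu> \<phi> \<and> (\<integral>x. \<phi> x \<partial>\<mu>) \<le> (\<integral>x. \<phi> x \<partial>\<nu>))"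

definition unifU :: "real measure" where
  "unifU = uniform_measure lborel {0..1}"

definition couplings :: "'a::topological_space measure \<Rightarrow> 'b::topological_space measure \<Rightarrow> ('a \<times> 'b) measure set" where
  "couplings \<mu> \<nu> = {\<gamma>. sets \<gamma> = sets borel \<and> distr \<gamma> borel fst = \<mu> \<and> distr \<gamma> borel snd = \<nu>}"

definition prob_kernel :: "('a::topological_space \<Rightarrow> 'b::topological_space measure) \<Rightarrow> bool" where
  "prob_kernel \<kappa> \<longleftrightarrow> \<kappa> \<in> borel \<rightarrow>\<^sub>M prob_algebra borel"

definition disint :: "'a::topological_space measure \<Rightarrow> ('a \<Rightarrow> 'b::topological_space measure) \<Rightarrow> ('a \<times> 'b) measure" where
  "disint \<mu> \<kappa> = bind \<mu> (\<lambda>x. distr (\<kappa> x) borel (\<lambda>y. (x, y)))"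

definition martingale_couplings :: "'a::euclidean_space measure \<Rightarrow> 'a measure \<Rightarrow> ('a \<times> 'a) measure set" where
  "martingale_couplings \<mu> \<nu> = {\<pi>. \<pi> \<in> couplings \<mu> \<nu> \<and>
     (\<exists>\<kappa>. prob_kernel \<kappa> \<and> \<pi> = disint \<mu> \<kappa> \<and>
        (AE x in \<mu>. integrable (\<kappa> x) (\<lambda>y. y) \<and> (\<integral>y. y \<partial>(\<kappa> x)) = x))}"

definition Wp :: "real \<Rightarrow> 'a::euclidean_space measure \<Rightarrow> 'a measure \<Rightarrow> real" where
  "Wp p \<mu> \<nu> = (enn2real (INF \<gamma>\<in>couplings \<mu> \<nu>.
       \<integral>\<^sup>+ z. ennreal (dist (fst z) (snd z) powr p) \<partial>\<gamma>)) powr (1 / p)"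

definition Mp :: "real \<Rightarrow> 'a::euclidean_space measure \<Rightarrow> 'a measure \<Rightarrow> real" where
  "Mp p \<mu> \<nu> = (enn2real (INF \<gamma>\<in>martingale_couplings \<mu> \<nu>.
       \<integral>\<^sup>+ z. ennreal (norm (fst z - snd z) powr p) \<partial>\<gamma>)) powr (1 / p)"

text \<open>Adapted Wasserstein distance between couplings \<open>\<pi> = \<mu>(dx)\<pi>_x(dy)\<close> and
  \<open>\<pi>' = \<mu>'(dx')\<pi>'_x'(dy')\<close>; the infimum also ranges over the (a.e. unique) versions
  of the disintegration kernels.\<close>
definition AWp :: "real \<Rightarrow> ('a::euclidean_space \<times> 'a) measure \<Rightarrow> ('a \<times> 'a) measure \<Rightarrow> real" where
  "AWp p \<pi> \<pi>' = (enn2real (INF t\<in>{(m, \<kappa>, \<kappa>').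
        m \<in> couplings (distr \<pi> borel fst) (distr \<pi>' borel fst) \<and>
        prob_kernel \<kappa> \<and> \<pi> = disint (distr \<pi> borel fst) \<kappa> \<and>
        prob_kernel \<kappa>' \<and> \<pi>' = disint (distr \<pi>' borel fst) \<kappa>'}.
      (case t of (m, \<kappa>, \<kappa>') \<Rightarrow>
        \<integral>\<^sup>+ z. ennreal (dist (fst z) (snd z) powr p + Wp p (\<kappa> (fst z)) (\<kappa>' (snd z)) powr p) \<partial>m)))
     powr (1 / p)"

definition quant_sets :: "nat \<Rightarrow> 'a set set" where
  "quant_sets N = {\<Gamma>. finite \<Gamma> \<and> \<Gamma> \<noteq> {} \<and> card \<Gamma> \<le> N}"

definition e2N :: "'a::euclidean_space measure \<Rightarrow> nat \<Rightarrow> real" where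
  "e2N \<mu> N = sqrt (enn2real (INF \<Gamma>\<in>quant_sets N. \<integral>\<^sup>+ x. ennreal (infdist x \<Gamma> ^ 2) \<partial>\<mu>))"

definition quad_opt_quantizer :: "'a::euclidean_space measure \<Rightarrow> nat \<Rightarrow> 'a set \<Rightarrow> bool" where
  "quad_opt_quantizer \<mu> N \<Gamma> \<longleftrightarrow> \<Gamma> \<in> quant_sets N \<and>
     (\<integral>\<^sup>+ x. ennreal (infdist x \<Gamma> ^ 2) \<partial>\<mu>) =
       (INF \<Gamma>'\<in>quant_sets N. \<integral>\<^sup>+ x. ennreal (infdist x \<Gamma>' ^ 2) \<partial>\<mu>)"

definition borel_nn_proj :: "'a::euclidean_space set \<Rightarrow> ('a \<Rightarrow> 'a) \<Rightarrow> bool" where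
  "borel_nn_proj \<Gamma> pr \<longleftrightarrow> pr \<in> borel_measurable borel \<and>
     (\<forall>x. pr x \<in> \<Gamma> \<and> dist x (pr x) = infdist x \<Gamma>)"

text \<open>Splitting operator; defined on all of \<open>R^d \<times> R\<close>, only its values on
  \<open>conv \<Gamma> \<times> [0,1]\<close> matter.\<close>
definition splitting_op :: "'a::euclidean_space set \<Rightarrow> ('a \<times> real \<Rightarrow> 'a) \<Rightarrow> bool" where
  "splitting_op \<Gamma> S \<longleftrightarrow> S \<in> borel_measurable (borel \<Otimes>\<^sub>M borel) \<and>
     (\<forall>y\<in>convex hull \<Gamma>. \<forall>u\<in>{0..1}. S (y, u) \<in> \<Gamma>) \<and>
     (\<forall>y\<in>convex hull \<Gamma>. (\<integral>u. S (y, u) \<partial>unifU) = y)"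

definition dpK :: "real \<Rightarrow> nat \<Rightarrow> 'a::euclidean_space measure \<Rightarrow> real" where
  "dpK p K \<nu> = Inf {Mp p \<nu> \<eta> | \<eta>. borel_prob \<eta> \<and> cvx_le \<nu> \<eta> \<and>
      (\<exists>F. finite F \<and> card F \<le> K \<and> emeasure \<eta> (space \<eta> - F) = 0)}"

definition dual_opt_quant :: "real \<Rightarrow> nat \<Rightarrow> 'a::euclidean_space measure \<Rightarrow> 'a set \<Rightarrow> ('a \<times> real \<Rightarrow> 'a) \<Rightarrow> bool" where
  "dual_opt_quant p K \<nu> \<Gamma> S \<longleftrightarrow> finite \<Gamma> \<and> card \<Gamma> \<le> K \<and>
     support_meas \<nu> \<subseteq> convex hull \<Gamma> \<and> splitting_op \<Gamma> S \<and>
     dpK p K \<nu> = (enn2real (\<integral>\<^sup>+ z. ennreal (norm (fst z - S z) powr p) \<partial>(\<nu> \<Otimes>\<^sub>M unifU))) powr (1 / p)"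

definition nu_check :: "'a::euclidean_space measure \<Rightarrow> ('a \<times> real \<Rightarrow> 'a) \<Rightarrow> 'a measure" where
  "nu_check \<nu> S = distr (\<nu> \<Otimes>\<^sub>M unifU) borel S"

definition qker :: "'a::euclidean_space set \<Rightarrow> ('a \<times> real \<Rightarrow> 'a) \<Rightarrow> 'a \<Rightarrow> 'a measure" where
  "qker \<Gamma> S y = (if y \<in> convex hull \<Gamma> then distr unifU borel (\<lambda>u. S (y, u)) else return borel y)"

definition pibar :: "('a::euclidean_space \<times> 'a) measure \<Rightarrow> ('a \<Rightarrow> 'a) \<Rightarrow> 'a set \<Rightarrow> ('a \<times> real \<Rightarrow> 'a) \<Rightarrow> ('a \<times> 'a) measure" where
  "pibar \<pi> pr \<Gamma> S = bind \<pi> (\<lambda>z. distr (qker \<Gamma> S (snd z)) borel (\<lambda>y'. (pr (fst z), y')))"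

end

theory Submission
  imports Defs
begin

text \<open>
  Optimality of the quadratic quantizer forces every point to be the barycentre of its cell, so that
  conditioning on the cell of \<open>X\<close> keeps \<open>\<pi>\<close> a martingale coupling; splitting \<open>Y\<close> with a mean-preserving kernel does
  so as well. The Wasserstein bounds come from the joint law of \<open>(Proj X, Proj\<^sup>d\<^sup>e\<^sup>l (Y, U))\<close> and \<open>(X, Y)\<close>.

  For \<open>p > 2\<close> one needs the rate \<open>N\<^sup>-\<^sup>1\<^sup>/\<^sup>d\<close> for moments of order up to \<open>d + 2\<close> of the quadratically optimal
  quantizer. Replacing a codebook point \<open>a\<close> by an arbitrary \<open>y\<close> cannot lower the distortion, so the gain of adding
  \<open>y\<close> is at most the loss of deleting \<open>a\<close>. Averaging the gain over \<open>y\<close> with respect to Lebesgue measure controls the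
  moment of order \<open>d + 2\<close>; a volume argument yields an \<open>a\<close> whose deletion is cheap.

  For the adapted distance, couple \<open>X\<close> with its projection. The kernel of the quantized coupling and the image of
  \<open>\<pi>\<^sub>x\<close> under splitting live on the same finite set, and the weights of the former are cell averages of
  those of the latter, which converge in \<open>L\<^sup>1(\<mu>)\<close>. Hence only the splitting cost \<open>d\<^bsub>p,K\<^esub>(\<nu>)\<close> survives.
\<close>

text \<open>Everything takes place in one ball: the convex order passes the bounded support of
  \<open>\<nu>\<close> on to \<open>\<mu>\<close>. The codebook is not assumed bounded, since
  codepoints with null cells may lie anywhere; these are split off before the volume argument. As
  \<open>\<mu>\<close> is arbitrary, with atoms or without, no density is available, and Lebesgue
  measure enters only to average over the inserted point. The order \<open>d + 2\<close> arises
  there: a gain of size \<open>dist^2\<close> is available on a ball whose volume is of order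
  \<open>dist^d\<close>. The factor \<open>2^((p-2)/2)\<close> is the price of separating the two
  errors inside the Euclidean norm of the product space for exponents above 2.

  In the adapted part the obstacle is that \<open>\<kappa> x\<close> depends only measurably on
  \<open>x\<close>, so nothing is known about kernels at nearby points. Splitting turns the kernel
  into finitely many real functions, each of which can be approximated in \<open>L1\<close> by
  Lipschitz functions. This approximation has no rate, hence the statement is a limsup in
  \<open>N\<close> for fixed \<open>K\<close>.\<close>

section \<open>Comparison of moments, and the support of a law\<close>

lemma powr_le_tangent:
  fixes u \<theta> :: real
  assumes "0 \<le> u" "0 < \<theta>" "\<theta> \<le> 1"
  shows "u powr \<theta> \<le> 1 + \<theta> * (u - 1)"
proof (cases "u = 0")
  case False
  then show ?thesis
    using Youngs_inequality_0[of \<theta> "1 - \<theta>" u 1] assms by (simp add: algebra_simps)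
qed (use assms in auto)

lemma (in prob_space) lyapunov_inequality:
  fixes f :: "'a \<Rightarrow> real"
  assumes st: "0 < s" "s \<le> t" and f0: "\<And>x. 0 \<le> f x"
    and ints: "integrable M (\<lambda>x. f x powr s)" and intt: "integrable M (\<lambda>x. f x powr t)"
  shows "(\<integral>x. f x powr s \<partial>M) \<le> (\<integral>x. f x powr t \<partial>M) powr (s / t)"
proof -
  define A where "A = (\<integral>x. f x powr t \<partial>M)"
  have A0: "0 \<le> A" unfolding A_def by simp
  show ?thesis
  proof (cases "A = 0")
    case True
    then have "AE x in M. f x powr t = 0"
      using intt unfolding A_def by (subst (asm) integral_nonneg_eq_0_iff_AE) auto
    then have "AE x in M. f x powr s = 0" by eventually_elim auto
    then have "(\<integral>x. f x powr s \<partial>M) = 0"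
      by (rule integral_eq_zero_AE)
    then show ?thesis by simp
  next
    case False
    with A0 have Apos: "0 < A" by simp
    have pt: "f x powr s \<le> A powr (s / t) * (1 + s / t * (f x powr t / A - 1))" for x
    proof -
      have "f x powr s = A powr (s / t) * (f x powr t / A) powr (s / t)"
        using st f0[of x] Apos by (simp add: powr_divide powr_powr)
      also have "\<dots> \<le> A powr (s / t) * (1 + s / t * (f x powr t / A - 1))"
        using st f0[of x] Apos by (intro mult_left_mono powr_le_tangent) auto
      finally show ?thesis .
    qed
    have "(\<integral>x. f x powr s \<partial>M) \<le> (\<integral>x. A powr (s / t) * (1 + s / t * (f x powr t / A - 1)) \<partial>M)"
      using ints intt pt by (intro integral_mono) auto
    also have "\<dots> = A powr (s / t) * (1 + s / t * (A / A - 1))"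
      using intt by (simp add: A_def prob_space)
    also have "\<dots> = A powr (s / t)" using Apos by simp
    finally show ?thesis unfolding A_def .
  qed
qed

text \<open>The complement of the support is a union of null balls, uncountably many in general;
  Lindelof leaves a countable subfamily.\<close>

lemma AE_support_meas:
  fixes M :: "'a::euclidean_space measure"
  assumes sets: "sets M = sets borel"
  shows "AE x in M. x \<in> support_meas M"
proof -
  define F where "F = {ball x e | x e. emeasure M (ball x e) = 0}"
  obtain F' where F': "F' \<subseteq> F" "countable F'" "\<Union>F' = \<Union>F"
    using Lindelof[of F] unfolding F_def by auto
  have "\<Union>F' \<in> null_sets M"
  proof (rule null_sets_UN'[of F' "\<lambda>x. x", simplified])
    show "countable F'" by fact
    show "S \<in> null_sets M" if "S \<in> F'" for S
      using that F'(1) sets unfolding F_def by (auto intro!: null_setsI)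
  qed
  moreover have "- support_meas M \<subseteq> \<Union>F'"
  proof
    fix x assume "x \<in> - support_meas M"
    then obtain e where e: "e > 0" "emeasure M (ball x e) = 0"
      by (auto simp: support_meas_def not_less)
    then have "ball x e \<in> F" unfolding F_def by blast
    then show "x \<in> \<Union>F'" using e(1) unfolding F'(3) by (intro UnionI[of "ball x e"]) auto
  qed
  ultimately show ?thesis
    by (intro AE_I'[of "\<Union>F'"]) auto
qed

lemma infdist_insert:
  "A \<noteq> {} \<Longrightarrow> infdist x (insert y A) = min (dist x y) (infdist x A)"
  using infdist_Un_min[of "{y}" A x] by simp

section \<open>Laws carried by a ball and their quadratic distortion\<close>

locale bounded_law = prob_space \<mu> for \<mu> :: "'a::euclidean_space measure" +
  fixes R :: real
  assumes sets_law [measurable_cong]: "sets \<mu> = sets borel"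
    and R_pos: "0 < R"
    and AE_norm_le: "AE x in \<mu>. norm x \<le> R"
begin

lemma space_law [simp]: "space \<mu> = UNIV"
  using sets_eq_imp_space_eq[OF sets_law] by simp

lemma integrable_bounded_on_cball:
  fixes f :: "'a \<Rightarrow> 'b::{banach, second_countable_topology}"
  assumes "f \<in> borel_measurable borel" "\<And>x. norm x \<le> R \<Longrightarrow> norm (f x) \<le> B"
  shows "integrable \<mu> f"
  using assms AE_norm_le by (intro integrable_const_bound[where B = B]) auto

lemma infdist_le_on_cball:
  assumes "g \<in> G" "norm x \<le> R"
  shows "infdist x G \<le> R + norm g"
  using infdist_le[OF assms(1), of x] norm_triangle_ineq4[of x g] assms(2) by (simp add: dist_norm)

lemma borel_measurable_infdist [measurable]: "(\<lambda>x. infdist x G) \<in> borel_measurable borel"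
  by (intro borel_measurable_continuous_onI continuous_intros)

lemma integrable_infdist_powr:
  assumes "G \<noteq> {}" "0 \<le> s"
  shows "integrable \<mu> (\<lambda>x. infdist x G powr s)"
proof -
  obtain g where g: "g \<in> G" using assms by auto
  show ?thesis
  proof (rule integrable_bounded_on_cball)
    fix x :: 'a assume "norm x \<le> R"
    then show "norm (infdist x G powr s) \<le> (R + norm g) powr s"
      using infdist_le_on_cball[OF g] assms by (auto intro!: powr_mono2 infdist_nonneg)
  qed simp
qed

lemma integrable_infdist_power:
  assumes "G \<noteq> {}"
  shows "integrable \<mu> (\<lambda>x. infdist x G ^ k)"
proof -
  obtain g where g: "g \<in> G" using assms by auto
  show ?thesis
  proof (rule integrable_bounded_on_cball)
    fix x :: 'a assume "norm x \<le> R"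
    then show "norm (infdist x G ^ k) \<le> (R + norm g) ^ k"
      using infdist_le_on_cball[OF g] assms by (auto simp: norm_power infdist_nonneg intro!: power_mono)
  qed simp
qed

definition distortion :: "'a set \<Rightarrow> real" where
  "distortion G = (\<integral>x. (infdist x G)\<^sup>2 \<partial>\<mu>)"

lemma nn_integral_infdist:
  assumes "G \<noteq> {}"
  shows "(\<integral>\<^sup>+x. ennreal ((infdist x G)\<^sup>2) \<partial>\<mu>) = ennreal (distortion G)"
  unfolding distortion_def
  by (rule nn_integral_eq_integral) (use integrable_infdist_power[OF assms] in auto)

lemma distortion_nonneg: "0 \<le> distortion G"
  unfolding distortion_def by simp

end

section \<open>Centroid property of optimal codebooks\<close>

locale optimal_quantizer = bounded_law +
  fixes N :: nat and \<Gamma> :: "'a set" and pr :: "'a \<Rightarrow> 'a"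
  assumes N_pos: "1 \<le> N"
    and optimal: "quad_opt_quantizer \<mu> N \<Gamma>"
    and nearest: "borel_nn_proj \<Gamma> pr"
begin

lemma finite_codebook: "finite \<Gamma>" and codebook_nonempty: "\<Gamma> \<noteq> {}" and card_codebook: "card \<Gamma> \<le> N"
  using optimal by (auto simp: quad_opt_quantizer_def quant_sets_def)

lemma pr_measurable [measurable]: "pr \<in> borel \<rightarrow>\<^sub>M borel"
  and pr_in: "pr x \<in> \<Gamma>" and infdist_pr: "infdist x \<Gamma> = dist x (pr x)"
  using nearest by (auto simp: borel_nn_proj_def)

lemma distortion_minimal:
  assumes "finite G" "G \<noteq> {}" "card G \<le> N"
  shows "distortion \<Gamma> \<le> distortion G"
proof -
  have G: "G \<in> quant_sets N" using assms by (auto simp: quant_sets_def)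
  have "ennreal (distortion \<Gamma>) = (INF \<Gamma>'\<in>quant_sets N. \<integral>\<^sup>+x. ennreal ((infdist x \<Gamma>')\<^sup>2) \<partial>\<mu>)"
    using optimal codebook_nonempty by (simp add: quad_opt_quantizer_def flip: nn_integral_infdist)
  also have "\<dots> \<le> (\<integral>\<^sup>+x. ennreal ((infdist x G)\<^sup>2) \<partial>\<mu>)"
    by (rule INF_lower[OF G])
  also have "\<dots> = ennreal (distortion G)"
    using assms by (simp add: nn_integral_infdist)
  finally show ?thesis by (simp add: distortion_nonneg)
qed

lemma e2N_eq: "e2N \<mu> N = sqrt (distortion \<Gamma>)"
proof -
  have "ennreal (distortion \<Gamma>) = (INF \<Gamma>'\<in>quant_sets N. \<integral>\<^sup>+x. ennreal ((infdist x \<Gamma>')\<^sup>2) \<partial>\<mu>)"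
    using optimal codebook_nonempty by (simp add: quad_opt_quantizer_def flip: nn_integral_infdist)
  then show ?thesis
    unfolding e2N_def by (simp add: distortion_nonneg flip: \<open>ennreal (distortion \<Gamma>) = _\<close>)
qed

lemma integrable_cell:
  fixes f :: "'a \<Rightarrow> 'a \<Rightarrow> 'b::{banach, second_countable_topology}"
  assumes "f a \<in> borel_measurable borel" "\<And>x. norm x \<le> R \<Longrightarrow> norm (f a x) \<le> B" "0 \<le> B"
  shows "integrable \<mu> (\<lambda>x. indicat_real {x. pr x = a} x *\<^sub>R f a x)"
  using assms by (intro integrable_bounded_on_cball[where B = B]) (auto split: split_indicator)

definition cell_mass :: "'a \<Rightarrow> real" where "cell_mass a = measure \<mu> {x. pr x = a}"

lemma cell_sets [measurable]: "{x. pr x = a} \<in> sets borel"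
  by measurable

lemma sum_cell_mass: "(\<Sum>a\<in>\<Gamma>. cell_mass a) = 1"
proof -
  have "(\<Sum>a\<in>\<Gamma>. cell_mass a) = measure \<mu> (\<Union>a\<in>\<Gamma>. {x. pr x = a})"
    unfolding cell_mass_def
    by (rule finite_measure_finite_Union[symmetric])
       (use finite_codebook in \<open>auto simp: disjoint_family_on_def sets_law\<close>)
  also have "(\<Union>a\<in>\<Gamma>. {x. pr x = a}) = space \<mu>" using pr_in by auto
  finally show ?thesis using prob_space by simp
qed

text \<open>Moving a point of the codebook to the barycentre of its cell lowers the distortion by the
  cell mass times the squared displacement.\<close>
lemma stationary:
  assumes a: "a \<in> \<Gamma>"
  shows "(\<integral>x. indicat_real {x. pr x = a} x *\<^sub>R (x - a) \<partial>\<mu>) = 0"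
proof -
  define A where "A = {x. pr x = a}"
  define m where "m = measure \<mu> A"
  define v where "v = (\<integral>x. indicat_real A x *\<^sub>R (x - a) \<partial>\<mu>)"
  define w where "w = v /\<^sub>R m"
  have A[measurable]: "A \<in> sets borel" by (simp add: A_def)
  show ?thesis
  proof (cases "m = 0")
    case True
    then have "AE x in \<mu>. x \<notin> A"
      by (simp add: m_def emeasure_eq_measure AE_iff_measurable[of A] sets_law)
    then have "AE x in \<mu>. indicat_real A x *\<^sub>R (x - a) = 0" by eventually_elim auto
    then show ?thesis unfolding A_def by (rule integral_eq_zero_AE)
  next
    case False
    then have m: "0 < m" unfolding m_def by (simp add: measure_nonneg less_le)
    let ?G = "insert (a + w) (\<Gamma> - {a})"
    have card: "card ?G \<le> N"
      using card_codebook a finite_codebook card_gt_0_iff[of \<Gamma>]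
      by (auto simp: card_insert_if card_Diff_singleton_if)
    have int1: "integrable \<mu> (\<lambda>x. indicat_real A x *\<^sub>R (x - a))"
      unfolding A_def
      by (rule integrable_cell[where f = "\<lambda>a x. x - a" and B = "R + norm a"])
         (use R_pos in \<open>auto intro: order_trans[OF norm_triangle_ineq4] add_nonneg_nonneg\<close>)
    have intA: "integrable \<mu> (indicat_real A)"
      by (intro integrable_bounded_on_cball[where B = 1]) (auto split: split_indicator)
    have pt: "(infdist x ?G)\<^sup>2 \<le> (infdist x \<Gamma>)\<^sup>2 - 2 * ((indicat_real A x *\<^sub>R (x - a)) \<bullet> w) + indicat_real A x * (norm w)\<^sup>2" for x
    proof (cases "x \<in> A")
      case True
      have "infdist x ?G \<le> norm ((x - a) - w)"
        using infdist_le[of "a + w" ?G x] by (simp add: dist_norm algebra_simps)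
      then have "(infdist x ?G)\<^sup>2 \<le> (norm ((x - a) - w))\<^sup>2"
        by (intro power_mono) (auto simp: infdist_nonneg)
      also have "\<dots> = (norm (x - a))\<^sup>2 - 2 * ((x - a) \<bullet> w) + (norm w)\<^sup>2"
        by (simp add: power2_norm_eq_inner inner_diff inner_commute)
      also have "norm (x - a) = infdist x \<Gamma>"
        using True by (simp add: infdist_pr A_def dist_norm)
      finally show ?thesis using True by simp
    next
      case False
      then have "pr x \<in> ?G" using pr_in by (auto simp: A_def)
      then have "infdist x ?G \<le> infdist x \<Gamma>" using infdist_le infdist_pr by metis
      then show ?thesis using False by (simp add: infdist_nonneg power_mono)
    qed
    have "distortion \<Gamma> \<le> distortion ?G"
      using finite_codebook card by (intro distortion_minimal) auto
    also have "\<dots> \<le> (\<integral>x. (infdist x \<Gamma>)\<^sup>2 - 2 * ((indicat_real A x *\<^sub>R (x - a)) \<bullet> w) + indicat_real A x * (norm w)\<^sup>2 \<partial>\<mu>)"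
      unfolding distortion_def
      using codebook_nonempty int1 intA pt
      by (intro integral_mono integrable_infdist_power Bochner_Integration.integrable_add
          Bochner_Integration.integrable_diff integrable_mult_right integrable_mult_left integrable_inner_left) auto
    also have "\<dots> = distortion \<Gamma> - 2 * (v \<bullet> w) + m * (norm w)\<^sup>2"
      using codebook_nonempty int1 intA integrable_infdist_power[of \<Gamma> 2] integrable_inner_left[OF int1, of w]
      by (simp add: distortion_def v_def m_def integral_inner_left[OF int1, symmetric])
    also have "v \<bullet> w = m * (norm w)\<^sup>2"
      using m by (simp add: w_def power2_norm_eq_inner power2_eq_square dot_square_norm)
    finally have "m * (norm w)\<^sup>2 \<le> 0" by simp
    then have "w = 0" using m by (simp add: mult_le_0_iff)
    then show ?thesis using m by (simp add: w_def v_def A_def)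
  qed
qed

lemma integrable_indicator_cell: "integrable \<mu> (indicat_real {x. pr x = a})"
  by (intro integrable_bounded_on_cball[where B = 1]) (auto split: split_indicator)

lemma integrable_indicator_cell_scaleR: "integrable \<mu> (\<lambda>x. indicat_real {x. pr x = a} x *\<^sub>R x)"
  by (rule integrable_cell[where f = "\<lambda>a x. x" and B = R]) (use R_pos in auto)

lemma barycentre:
  assumes "a \<in> \<Gamma>"
  shows "(\<integral>x. indicat_real {x. pr x = a} x *\<^sub>R x \<partial>\<mu>) = cell_mass a *\<^sub>R a"
proof -
  let ?I = "indicat_real {x. pr x = a}"
  have "(\<integral>x. ?I x *\<^sub>R x \<partial>\<mu>) - cell_mass a *\<^sub>R a = (\<integral>x. ?I x *\<^sub>R x - ?I x *\<^sub>R a \<partial>\<mu>)"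
    using integrable_indicator_cell integrable_indicator_cell_scaleR by (simp add: cell_mass_def)
  also have "\<dots> = 0"
    using stationary[OF assms] by (simp add: scaleR_diff_right)
  finally show ?thesis by simp
qed

text \<open>The barycentre of a part of the ball stays in the ball. Positive mass matters: on a null
  cell the equation in \<open>barycentre\<close> reads \<open>0 = 0\<close> and does not locate the
  codepoint.\<close>

lemma codebook_in_cball:
  assumes "a \<in> \<Gamma>" "0 < cell_mass a"
  shows "norm a \<le> R"
proof -
  let ?I = "indicat_real {x. pr x = a}"
  have "cell_mass a * norm a = norm (\<integral>x. ?I x *\<^sub>R x \<partial>\<mu>)"
    using assms by (simp add: barycentre)
  also have "\<dots> \<le> (\<integral>x. norm (?I x *\<^sub>R x) \<partial>\<mu>)" by (rule integral_norm_bound)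
  also have "\<dots> \<le> (\<integral>x. ?I x * R \<partial>\<mu>)"
  proof (rule integral_mono_AE)
    show "AE x in \<mu>. norm (?I x *\<^sub>R x) \<le> ?I x * R"
      using AE_norm_le by eventually_elim (auto split: split_indicator)
  qed (use integrable_indicator_cell integrable_norm[OF integrable_indicator_cell_scaleR] in auto)
  also have "\<dots> = cell_mass a * R" by (simp add: cell_mass_def)
  finally show ?thesis using assms(2) by simp
qed

text \<open>The masses sum to 1, so some cell is charged and its codepoint lies in the ball. The
  bound is the same for every \<open>N\<close>, which keeps the later constants uniform.\<close>

lemma AE_infdist_le: "AE x in \<mu>. infdist x \<Gamma> \<le> 2 * R"
proof -
  obtain a where a: "a \<in> \<Gamma>" "0 < cell_mass a"
    using sum_cell_mass sum_nonpos[of \<Gamma> cell_mass] by force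
  show ?thesis
    using AE_norm_le
  proof eventually_elim
    case (elim x)
    show ?case using infdist_le_on_cball[OF a(1) elim] codebook_in_cball[OF a] by simp
  qed
qed

end

section \<open>Rate of convergence of optimal quantizers\<close>

context bounded_law
begin

text \<open>Adding a point \<open>y\<close> gains at least \<open>3/4 d\<^sup>2\<close> at every \<open>x\<close> with \<open>|x - y| < d/2\<close>, where
  \<open>d\<close> is the distance of \<open>x\<close> to the codebook. Averaging over \<open>y\<close> with respect to Lebesgue measure turns this
  into a bound for the moment of order \<open>DIM + 2\<close>, whatever the law \<open>\<mu>\<close> is.\<close>
lemma moment_le_insertion_gain:
  assumes G: "G \<noteq> {}" and d: "AE x in \<mu>. infdist x G \<le> 2 * R"
    and gain: "\<And>y. distortion G - distortion (insert y G) \<le> \<Delta>"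
  shows "(\<integral>x. infdist x G ^ (DIM('a) + 2) \<partial>\<mu>) \<le> 4 / 3 * (4 * R) ^ DIM('a) * \<Delta>"
proof -
  let ?n = "DIM('a)"
  define d where "d x = infdist x G" for x
  have [measurable]: "d \<in> borel_measurable borel" unfolding d_def by measurable
  have d0: "0 \<le> d x" for x by (simp add: d_def infdist_nonneg)
  define h where "h x y = (if dist x y < d x / 2 then (d x)\<^sup>2 else 0)" for x y
  have h_meas[measurable]: "case_prod h \<in> borel_measurable (borel \<Otimes>\<^sub>M borel)"
    unfolding h_def by measurable
  have h0: "0 \<le> h x y" for x y by (simp add: h_def)
  have int_d2: "integrable \<mu> (\<lambda>x. (d x)\<^sup>2)"
    unfolding d_def by (rule integrable_infdist_power[OF G])
  \<comment> \<open>Inserting a point that is already present gains nothing.\<close>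
  have \<Delta>0: "0 \<le> \<Delta>"
  proof -
    obtain g where "g \<in> G" using G by auto
    then show ?thesis using gain[of g] by (simp add: insert_absorb)
  qed
  have int_h: "integrable \<mu> (\<lambda>x. h x y)" for y
    by (rule Bochner_Integration.integrable_bound[OF int_d2]) (auto simp: h_def)
  have slice: "(\<integral>\<^sup>+x. ennreal (h x y) \<partial>\<mu>) \<le> ennreal (4 / 3 * \<Delta>)" for y
  proof -
    have pt: "3 / 4 * h x y \<le> (d x)\<^sup>2 - (infdist x (insert y G))\<^sup>2" for x
    proof (cases "dist x y < d x / 2")
      case True
      have "infdist x (insert y G) \<le> dist x y" by (rule infdist_le) simp
      then have "infdist x (insert y G) \<le> d x / 2" using True by linarith
      then have "(infdist x (insert y G))\<^sup>2 \<le> (d x / 2)\<^sup>2"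
        by (intro power_mono) (auto simp: infdist_nonneg)
      then show ?thesis using True by (simp add: h_def power_divide)
    next
      case False
      have "infdist x (insert y G) \<le> d x"
        unfolding d_def by (rule infdist_mono) (use G in auto)
      then show ?thesis using False by (simp add: h_def infdist_nonneg power_mono)
    qed
    have "3 / 4 * (\<integral>x. h x y \<partial>\<mu>) = (\<integral>x. 3 / 4 * h x y \<partial>\<mu>)" by simp
    also have "\<dots> \<le> (\<integral>x. (d x)\<^sup>2 - (infdist x (insert y G))\<^sup>2 \<partial>\<mu>)"
      using int_h int_d2 pt integrable_infdist_power[of "insert y G" 2] by (intro integral_mono) auto
    also have "\<dots> = distortion G - distortion (insert y G)"
      using int_d2 integrable_infdist_power[of "insert y G" 2] by (simp add: distortion_def d_def)
    also have "\<dots> \<le> \<Delta>" by (rule gain)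
    finally have "(\<integral>x. h x y \<partial>\<mu>) \<le> 4 / 3 * \<Delta>" by simp
    moreover have "(\<integral>\<^sup>+x. ennreal (h x y) \<partial>\<mu>) = ennreal (\<integral>x. h x y \<partial>\<mu>)"
      by (rule nn_integral_eq_integral) (use int_h h0 in auto)
    ultimately show ?thesis by (simp add: ennreal_leI)
  qed
  \<comment> \<open>If \<open>|x| \<le> R\<close> and \<open>d x \<le> 2 * R\<close>, the ball of
    radius \<open>d x / 2\<close> about \<open>x\<close> lies in this one, so the average over
    \<open>y\<close> runs over a set of finite volume. The unit ball volumes cancel in the end and
    leave \<open>(2 * R)^n * 2^n = (4 * R)^n\<close>.\<close>
  let ?B = "ball 0 (2 * R) :: 'a set"
  let ?v = "unit_ball_vol (real ?n)"
  have [measurable]: "?B \<in> sets borel" by simp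
  interpret L: pair_sigma_finite \<mu> "lborel :: 'a measure" ..
  have vol: "ennreal (?v / 2 ^ ?n * d x ^ (?n + 2)) \<le> (\<integral>\<^sup>+y. ennreal (h x y) * indicator ?B y \<partial>lborel)"
    if x: "norm x \<le> R" "d x \<le> 2 * R" for x
  proof -
    have "?v / 2 ^ ?n * d x ^ (?n + 2) = (d x)\<^sup>2 * (?v * (d x / 2) ^ ?n)"
      unfolding power_add power_divide by simp
    then have "ennreal (?v / 2 ^ ?n * d x ^ (?n + 2)) = ennreal ((d x)\<^sup>2) * emeasure lborel (ball x (d x / 2))"
      using d0[of x] by (simp add: emeasure_ball ennreal_mult del: power_divide)
    also have "\<dots> = (\<integral>\<^sup>+y. ennreal ((d x)\<^sup>2) * indicator (ball x (d x / 2)) y \<partial>lborel)"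
      by (simp add: nn_integral_cmult_indicator)
    also have "\<dots> \<le> (\<integral>\<^sup>+y. ennreal (h x y) * indicator ?B y \<partial>lborel)"
    proof (rule nn_integral_mono)
      fix y
      show "ennreal ((d x)\<^sup>2) * indicator (ball x (d x / 2)) y \<le> ennreal (h x y) * indicator ?B y"
      proof (cases "y \<in> ball x (d x / 2)")
        case True
        then have "norm y < 2 * R"
          using x norm_triangle_ineq2[of y x] by (simp add: dist_norm norm_minus_commute)
        then show ?thesis using True by (simp add: h_def)
      qed simp
    qed
    finally show ?thesis .
  qed
  have "ennreal (?v / 2 ^ ?n * (\<integral>x. d x ^ (?n + 2) \<partial>\<mu>)) = (\<integral>\<^sup>+x. ennreal (?v / 2 ^ ?n * d x ^ (?n + 2)) \<partial>\<mu>)"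
    using integrable_infdist_power[OF G, of "?n + 2"] d0
    by (subst nn_integral_eq_integral) (auto simp: d_def)
  also have "\<dots> \<le> (\<integral>\<^sup>+x. \<integral>\<^sup>+y. ennreal (h x y) * indicator ?B y \<partial>lborel \<partial>\<mu>)"
  proof (rule nn_integral_mono_AE)
    show "AE x in \<mu>. ennreal (?v / 2 ^ ?n * d x ^ (?n + 2)) \<le> (\<integral>\<^sup>+y. ennreal (h x y) * indicator ?B y \<partial>lborel)"
      using AE_norm_le d unfolding d_def[symmetric] by eventually_elim (rule vol)
  qed
  also have "\<dots> = (\<integral>\<^sup>+y. \<integral>\<^sup>+x. ennreal (h x y) * indicator ?B y \<partial>\<mu> \<partial>lborel)"
    by (rule L.Fubini'[symmetric]) measurable
  also have "\<dots> = (\<integral>\<^sup>+y. (\<integral>\<^sup>+x. ennreal (h x y) \<partial>\<mu>) * indicator ?B y \<partial>lborel)"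
    by (intro nn_integral_cong nn_integral_multc) auto
  also have "\<dots> \<le> (\<integral>\<^sup>+y. ennreal (4 / 3 * \<Delta>) * indicator ?B y \<partial>lborel)"
    by (intro nn_integral_mono mult_right_mono slice) auto
  also have "\<dots> = ennreal (4 / 3 * \<Delta>) * emeasure lborel ?B"
    by (simp add: nn_integral_cmult_indicator)
  also have "\<dots> = ennreal (4 / 3 * \<Delta> * (?v * (2 * R) ^ ?n))"
    using R_pos \<Delta>0 by (simp add: emeasure_ball flip: ennreal_mult)
  finally have "?v / 2 ^ ?n * (\<integral>x. d x ^ (?n + 2) \<partial>\<mu>) \<le> 4 / 3 * \<Delta> * (?v * (2 * R) ^ ?n)"
    using \<Delta>0 R_pos by (subst (asm) ennreal_le_iff) auto
  then have "(\<integral>x. d x ^ (?n + 2) \<partial>\<mu>) \<le> 4 / 3 * \<Delta> * (2 * R) ^ ?n * 2 ^ ?n"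
    using unit_ball_vol_pos[of "real ?n"] by (simp add: field_simps)
  also have "\<dots> = 4 / 3 * \<Delta> * ((2 * R) ^ ?n * 2 ^ ?n)" by simp
  also have "(2 * R) ^ ?n * 2 ^ ?n = (4 * R) ^ ?n"
    unfolding power_mult_distrib[symmetric] by (simp add: mult.commute)
  finally show ?thesis
    unfolding d_def by (simp only: mult_ac)
qed

end

text \<open>Balls of radius \<open>\<delta>/2\<close>, \<open>\<delta>\<close> the distance to the nearest other point, are disjoint.\<close>
lemma sum_nearest_neighbour_dist_power:
  fixes G :: "'a::euclidean_space set"
  assumes fin: "finite G" and card: "2 \<le> card G" and sub: "\<And>a. a \<in> G \<Longrightarrow> norm a \<le> R" and R: "0 < R"
  shows "(\<Sum>a\<in>G. infdist a (G - {a}) ^ DIM('a)) \<le> (4 * R) ^ DIM('a)"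
proof -
  let ?n = "DIM('a)"
  let ?v = "unit_ball_vol (real ?n)"
  define \<delta> where "\<delta> a = infdist a (G - {a})" for a
  have \<delta>0: "0 \<le> \<delta> a" for a by (simp add: \<delta>_def infdist_nonneg)
  have \<delta>_le: "\<delta> a \<le> dist a b" if "b \<in> G" "a \<noteq> b" for a b
    unfolding \<delta>_def using that by (intro infdist_le) auto
  have \<delta>R: "\<delta> a \<le> 2 * R" if a: "a \<in> G" for a
  proof -
    have "card (G - {a}) \<noteq> 0" using card a fin by simp
    then have "G - {a} \<noteq> {}" by force
    then obtain b where b: "b \<in> G" "b \<noteq> a" by blast
    show ?thesis
      using \<delta>_le[of b a] b sub[OF a] sub[OF b(1)] norm_triangle_ineq4[of a b] by (simp add: dist_norm)
  qed
  have disj: "disjoint_family_on (\<lambda>a. ball a (\<delta> a / 2)) G"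
  proof (unfold disjoint_family_on_def, intro ballI impI)
    fix a b assume ab: "a \<in> G" "b \<in> G" "a \<noteq> b"
    then have "\<delta> a / 2 + \<delta> b / 2 \<le> dist a b"
      using \<delta>_le[of b a] \<delta>_le[of a b] by (simp add: dist_commute)
    then show "ball a (\<delta> a / 2) \<inter> ball b (\<delta> b / 2) = {}"
      by (rule disjoint_ballI)
  qed
  \<comment> \<open>Two points of the ball are at most \<open>2 * R\<close> apart, so every half
    radius is at most \<open>R\<close>.\<close>
  have sub2: "(\<Union>a\<in>G. ball a (\<delta> a / 2)) \<subseteq> ball 0 (2 * R)"
  proof safe
    fix a y assume a: "a \<in> G" and y: "y \<in> ball a (\<delta> a / 2)"
    then have "norm (y - a) < R" using \<delta>R[OF a] by (simp add: dist_norm norm_minus_commute)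
    then show "y \<in> ball 0 (2 * R)" using sub[OF a] norm_triangle_ineq2[of y a] by simp
  qed
  have "ennreal (\<Sum>a\<in>G. ?v * (\<delta> a / 2) ^ ?n) = (\<Sum>a\<in>G. emeasure lborel (ball a (\<delta> a / 2)))"
    using \<delta>0 by (simp add: emeasure_ball sum_ennreal)
  also have "\<dots> = emeasure lborel (\<Union>a\<in>G. ball a (\<delta> a / 2))"
    by (rule sum_emeasure) (use fin disj in auto)
  also have "\<dots> \<le> emeasure lborel (ball (0::'a) (2 * R))"
    by (rule emeasure_mono[OF sub2]) simp
  also have "\<dots> = ennreal (?v * (2 * R) ^ ?n)" using R by (simp add: emeasure_ball)
  finally have "(\<Sum>a\<in>G. ?v * (\<delta> a / 2) ^ ?n) \<le> ?v * (2 * R) ^ ?n"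
    using R by (subst (asm) ennreal_le_iff) auto
  then have "?v * ((\<Sum>a\<in>G. \<delta> a ^ ?n) / 2 ^ ?n) \<le> ?v * (2 * R) ^ ?n"
    by (simp add: sum_distrib_left sum_divide_distrib power_divide)
  then have "(\<Sum>a\<in>G. \<delta> a ^ ?n) / 2 ^ ?n \<le> (2 * R) ^ ?n"
    by (rule mult_left_le_imp_le) (simp add: unit_ball_vol_pos)
  then have "(\<Sum>a\<in>G. \<delta> a ^ ?n) \<le> (2 * R) ^ ?n * 2 ^ ?n" by (simp add: field_simps)
  also have "\<dots> = (4 * R) ^ ?n" unfolding power_mult_distrib[symmetric] by (simp add: mult.commute)
  finally show ?thesis unfolding \<delta>_def .
qed

lemma powr_neg_inverse_power:
  assumes "0 < x" "0 < n"
  shows "(x powr (- 1 / real n)) ^ n = 1 / x"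
proof -
  have "(x powr (- 1 / real n)) ^ n = (x powr (- 1 / real n)) powr real n"
    using assms by (subst powr_realpow) auto
  also have "\<dots> = 1 / x" using assms by (simp only: powr_powr) (simp add: powr_minus_divide)
  finally show ?thesis .
qed

context optimal_quantizer
begin

text \<open>Diminishing returns. Swapping \<open>a\<close> for \<open>y\<close> does not raise the
  cardinality, so optimality bounds the gain of \<open>y\<close> over \<open>\<Gamma> - {a}\<close>
  by the deletion loss. Over the larger set \<open>\<Gamma>\<close> the gain is no bigger, since
  pointwise \<open>min u t + s \<le> min u s + t\<close> whenever \<open>s \<le> t\<close>.\<close>

lemma insertion_gain_le_deletion_loss:
  assumes a: "a \<in> \<Gamma>" and "2 \<le> card \<Gamma>"
  shows "distortion \<Gamma> - distortion (insert y \<Gamma>) \<le> distortion (\<Gamma> - {a}) - distortion \<Gamma>"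
proof -
  let ?D = "\<Gamma> - {a}"
  have ne: "?D \<noteq> {}"
    using assms card_mono[of "{a}" \<Gamma>] by auto
  have "card (insert y ?D) \<le> N"
    using card_codebook assms finite_codebook by (auto simp: card_insert_if card_Diff_singleton_if)
  then have "distortion \<Gamma> \<le> distortion (insert y ?D)"
    using finite_codebook by (intro distortion_minimal) auto
  moreover have "distortion (insert y ?D) + distortion \<Gamma> \<le> distortion (insert y \<Gamma>) + distortion ?D"
  proof -
    have pt: "(infdist x (insert y ?D))\<^sup>2 + (infdist x \<Gamma>)\<^sup>2 \<le> (infdist x (insert y \<Gamma>))\<^sup>2 + (infdist x ?D)\<^sup>2" for x
    proof -
      have "infdist x \<Gamma> \<le> infdist x ?D" by (rule infdist_mono) (use ne in auto)
      then have "(infdist x \<Gamma>)\<^sup>2 \<le> (infdist x ?D)\<^sup>2" by (simp add: infdist_nonneg power_mono)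
      moreover have "(min s t)\<^sup>2 = min (s\<^sup>2) (t\<^sup>2)" if "0 \<le> s" "0 \<le> t" for s t :: real
        using that by (auto simp: min_def power_mono)
      ultimately show ?thesis
        using ne codebook_nonempty by (simp add: infdist_insert infdist_nonneg min_def)
    qed
    have "distortion (insert y ?D) + distortion \<Gamma> = (\<integral>x. (infdist x (insert y ?D))\<^sup>2 + (infdist x \<Gamma>)\<^sup>2 \<partial>\<mu>)"
      unfolding distortion_def using codebook_nonempty
      by (intro Bochner_Integration.integral_add[symmetric] integrable_infdist_power) auto
    also have "\<dots> \<le> (\<integral>x. (infdist x (insert y \<Gamma>))\<^sup>2 + (infdist x ?D)\<^sup>2 \<partial>\<mu>)"
      using codebook_nonempty ne pt
      by (intro integral_mono Bochner_Integration.integrable_add integrable_infdist_power) auto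
    also have "\<dots> = distortion (insert y \<Gamma>) + distortion ?D"
      unfolding distortion_def using ne
      by (intro Bochner_Integration.integral_add integrable_infdist_power) auto
    finally show ?thesis .
  qed
  ultimately show ?thesis by linarith
qed

definition inertia :: "'a \<Rightarrow> real" where
  "inertia a = (\<integral>x. indicat_real {x. pr x = a} x * (norm (x - a))\<^sup>2 \<partial>\<mu>)"

lemma integrable_inertia: "integrable \<mu> (\<lambda>x. indicat_real {x. pr x = a} x * (norm (x - a))\<^sup>2)"
proof (rule integrable_cell[where f = "\<lambda>a x. (norm (x - a))\<^sup>2" and B = "(R + norm a)\<^sup>2", unfolded real_scaleR_def])
  fix x :: 'a assume "norm x \<le> R"
  then have "norm (x - a) \<le> R + norm a" using norm_triangle_ineq4[of x a] by simp
  then show "norm ((norm (x - a))\<^sup>2) \<le> (R + norm a)\<^sup>2" by (simp add: power_mono)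
qed auto

lemma inertia_nonneg: "0 \<le> inertia a"
  unfolding inertia_def by simp

lemma sum_inertia: "(\<Sum>a\<in>\<Gamma>. inertia a) = distortion \<Gamma>"
proof -
  have "(\<Sum>a\<in>\<Gamma>. inertia a) = (\<integral>x. (\<Sum>a\<in>\<Gamma>. indicat_real {x. pr x = a} x * (norm (x - a))\<^sup>2) \<partial>\<mu>)"
    unfolding inertia_def by (rule Bochner_Integration.integral_sum[symmetric]) (rule integrable_inertia)
  also have "(\<lambda>x. \<Sum>a\<in>\<Gamma>. indicat_real {x. pr x = a} x * (norm (x - a))\<^sup>2) = (\<lambda>x. (infdist x \<Gamma>)\<^sup>2)"
  proof
    fix x
    have "(\<Sum>a\<in>\<Gamma>. indicat_real {x. pr x = a} x * (norm (x - a))\<^sup>2)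
        = (\<Sum>a\<in>\<Gamma>. if a = pr x then (norm (x - pr x))\<^sup>2 else 0)"
      by (intro sum.cong) auto
    also have "\<dots> = (infdist x \<Gamma>)\<^sup>2"
      using finite_codebook pr_in by (simp add: infdist_pr dist_norm)
    finally show "(\<Sum>a\<in>\<Gamma>. indicat_real {x. pr x = a} x * (norm (x - a))\<^sup>2) = (infdist x \<Gamma>)\<^sup>2" .
  qed
  finally show ?thesis unfolding distortion_def .
qed

text \<open>Only the cell of \<open>a\<close> is affected. There the triangle inequality through
  \<open>a\<close> and \<open>(s + t)^2 \<le> 2 * s^2 + 2 * t^2\<close> bound the new squared
  distance; subtracting the old \<open>|x - a|^2\<close> leaves the inertia once.\<close>

lemma deletion_loss_le:
  assumes a: "a \<in> \<Gamma>" and ne: "\<Gamma> - {a} \<noteq> {}"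
  shows "distortion (\<Gamma> - {a}) - distortion \<Gamma> \<le> inertia a + 2 * (infdist a (\<Gamma> - {a}))\<^sup>2 * cell_mass a"
proof -
  let ?D = "\<Gamma> - {a}"
  let ?I = "indicat_real {x. pr x = a}"
  let ?\<delta> = "infdist a ?D"
  have I: "integrable \<mu> ?I" by (rule integrable_indicator_cell)
  have pt: "(infdist x ?D)\<^sup>2 - (infdist x \<Gamma>)\<^sup>2 \<le> ?I x * (norm (x - a))\<^sup>2 + 2 * ?\<delta>\<^sup>2 * ?I x" for x
  proof (cases "pr x = a")
    case True
    have "infdist x ?D \<le> ?\<delta> + norm (x - a)" using infdist_triangle[of x ?D a] by (simp add: dist_norm)
    then have "(infdist x ?D)\<^sup>2 \<le> (?\<delta> + norm (x - a))\<^sup>2" by (intro power_mono infdist_nonneg)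
    also have "\<dots> \<le> 2 * ?\<delta>\<^sup>2 + 2 * (norm (x - a))\<^sup>2"
      using sum_squares_bound[of ?\<delta> "norm (x - a)"] by (simp add: power2_sum)
    finally show ?thesis using True by (simp add: infdist_pr dist_norm)
  next
    case False
    then have "infdist x ?D \<le> infdist x \<Gamma>"
      using pr_in[of x] infdist_le[of "pr x" ?D x] by (simp add: infdist_pr)
    then show ?thesis using False by (simp add: infdist_nonneg power_mono)
  qed
  have "distortion ?D - distortion \<Gamma> = (\<integral>x. (infdist x ?D)\<^sup>2 - (infdist x \<Gamma>)\<^sup>2 \<partial>\<mu>)"
    unfolding distortion_def using codebook_nonempty ne
    by (intro Bochner_Integration.integral_diff[symmetric] integrable_infdist_power) auto
  also have "\<dots> \<le> (\<integral>x. ?I x * (norm (x - a))\<^sup>2 + 2 * ?\<delta>\<^sup>2 * ?I x \<partial>\<mu>)"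
    using codebook_nonempty ne I integrable_inertia pt
    by (intro integral_mono Bochner_Integration.integrable_add Bochner_Integration.integrable_diff integrable_infdist_power) auto
  also have "\<dots> = inertia a + 2 * ?\<delta>\<^sup>2 * cell_mass a"
    using I integrable_inertia by (simp add: inertia_def cell_mass_def)
  finally show ?thesis .
qed

text \<open>Pigeonhole for three budgets at once: inertia, mass and packing volume each have a total
  that is bounded independently of the number of cells, so some codepoint is cheap in all three. The
  extra factor \<open>q^2\<close> beyond \<open>q^n = 1 / N\<close> comes from the squared distance
  to the neighbour.\<close>

lemma insertion_gain_le:
  assumes N2: "2 \<le> N"
  shows "distortion \<Gamma> - distortion (insert y \<Gamma>)
    \<le> 3 * distortion \<Gamma> / N + 864 * R\<^sup>2 * (real N powr (- 1 / DIM('a))) ^ (DIM('a) + 2)"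
    (is "_ \<le> ?rhs")
proof -
  let ?n = "DIM('a)"
  define q where "q = real N powr (- 1 / ?n)"
  have qn: "q ^ ?n = 1 / N"
    unfolding q_def using N_pos by (intro powr_neg_inverse_power) auto
  have q0: "0 < q" using N_pos by (simp add: q_def)
  have rhs0: "0 \<le> ?rhs"
    by (intro add_nonneg_nonneg mult_nonneg_nonneg divide_nonneg_nonneg) (auto simp: distortion_nonneg)
  show ?thesis
  proof (cases "card \<Gamma> < N")
    case True
    then have "distortion \<Gamma> \<le> distortion (insert y \<Gamma>)"
      using finite_codebook by (intro distortion_minimal) (auto simp: card_insert_if)
    then show ?thesis using rhs0 by linarith
  next
    case False
    then have cardN: "card \<Gamma> = N" using card_codebook by simp
    have ne: "\<Gamma> - {a} \<noteq> {}" if "a \<in> \<Gamma>" for a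
    proof
      assume "\<Gamma> - {a} = {}"
      then have "\<Gamma> = {a}" using that by auto
      then show False using cardN N2 by simp
    qed
    show ?thesis
    proof (cases "\<exists>a\<in>\<Gamma>. cell_mass a = 0")
      \<comment> \<open>A point with a null cell can be deleted for free. It need not lie in the
        ball, so this case has to be settled before the packing bound is applied.\<close>
      case True
      then obtain a where a: "a \<in> \<Gamma>" "cell_mass a = 0" by auto
      have "AE x in \<mu>. pr x \<noteq> a"
        using a(2) by (subst AE_iff_measurable[of "{x. pr x = a}"]) (auto simp: sets_law cell_mass_def emeasure_eq_measure)
      then have "AE x in \<mu>. indicat_real {x. pr x = a} x * (norm (x - a))\<^sup>2 = 0"
        by eventually_elim simp
      then have "inertia a = 0" unfolding inertia_def by (rule integral_eq_zero_AE)
      then show ?thesis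
        using insertion_gain_le_deletion_loss[OF a(1), of y] deletion_loss_le[OF a(1) ne[OF a(1)]] a(2) cardN N2 rhs0
        by simp
    next
      case False
      then have pos: "0 < cell_mass a" if "a \<in> \<Gamma>" for a
        using that measure_nonneg[of \<mu>] by (auto simp: cell_mass_def less_le)
      define \<delta> where "\<delta> a = infdist a (\<Gamma> - {a})" for a
      have \<delta>0: "0 \<le> \<delta> a" for a by (simp add: \<delta>_def infdist_nonneg)
      \<comment> \<open>Each summand is normalised to have total at most 1, so one of the
        \<open>N\<close> values of \<open>F\<close> is at most \<open>3 / N\<close>. For zero
        distortion the first quotient is 0 by convention; the bound on the inertia then follows
        because all inertias vanish.\<close>
      define F where "F a = inertia a / distortion \<Gamma> + cell_mass a + \<delta> a ^ ?n / (4 * R) ^ ?n" for a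
      have "(\<Sum>a\<in>\<Gamma>. F a) = distortion \<Gamma> / distortion \<Gamma> + 1 + (\<Sum>a\<in>\<Gamma>. \<delta> a ^ ?n) / (4 * R) ^ ?n"
        unfolding F_def by (simp add: sum.distrib sum_cell_mass flip: sum_divide_distrib sum_inertia)
      also have "\<dots> \<le> 1 + 1 + 1"
        using sum_nearest_neighbour_dist_power[of \<Gamma> R] finite_codebook cardN N2 codebook_in_cball pos R_pos
        by (intro add_mono) (auto simp: \<delta>_def divide_le_eq)
      finally have "(\<Sum>a\<in>\<Gamma>. F a) \<le> (\<Sum>a\<in>\<Gamma>. 3 / real N)" using N_pos by (simp add: cardN)
      then obtain a where a: "a \<in> \<Gamma>" "F a \<le> 3 / N"
        using sum_strict_mono[OF finite_codebook codebook_nonempty, of "\<lambda>_. 3 / real N" F]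
        by (meson linorder_not_le)
      have parts: "0 \<le> inertia a / distortion \<Gamma>" "0 \<le> \<delta> a ^ ?n / (4 * R) ^ ?n" "0 < cell_mass a"
        using inertia_nonneg distortion_nonneg \<delta>0 R_pos pos[OF a(1)] by auto
      have "inertia a \<le> distortion \<Gamma> * (3 / N)"
      proof (cases "distortion \<Gamma> = 0")
        case True
        then show ?thesis
          using sum_nonneg_eq_0_iff[OF finite_codebook, of inertia] inertia_nonneg a(1) by (simp add: sum_inertia)
      next
        case False
        then have "0 < distortion \<Gamma>" using distortion_nonneg[of \<Gamma>] by linarith
        moreover have "inertia a / distortion \<Gamma> \<le> 3 / N" using a(2) parts unfolding F_def by linarith
        ultimately show ?thesis by (simp add: field_simps)
      qed
      moreover have m: "cell_mass a \<le> 3 * q ^ ?n" using a(2) parts unfolding F_def qn by simp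
      moreover have "\<delta> a \<le> 12 * R * q"
      proof -
        have "\<delta> a ^ ?n / (4 * R) ^ ?n \<le> 3 * q ^ ?n" using a(2) parts unfolding F_def qn by simp
        then have "\<delta> a ^ ?n \<le> 3 * (4 * R * q) ^ ?n"
          using R_pos by (simp add: field_simps power_mult_distrib)
        \<comment> \<open>\<open>3 \<le> 3^n\<close> absorbs the constant into the base and avoids
          an \<open>n\<close>-th root of 3.\<close>
        also have "\<dots> \<le> 3 ^ ?n * (4 * R * q) ^ ?n"
          using R_pos q0 self_le_power[of "3::real" ?n] by (intro mult_right_mono) auto
        also have "\<dots> = (12 * R * q) ^ ?n" unfolding power_mult_distrib[symmetric] by (simp add: power_mult_distrib)
        finally show ?thesis using R_pos q0 \<delta>0[of a] by (subst (asm) power_mono_iff) auto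
      qed
      then have "2 * (\<delta> a)\<^sup>2 * cell_mass a \<le> 2 * (12 * R * q)\<^sup>2 * (3 * q ^ ?n)"
        using m \<delta>0[of a] parts by (intro mult_mono power_mono) auto
      moreover have "distortion \<Gamma> - distortion (insert y \<Gamma>) \<le> inertia a + 2 * (\<delta> a)\<^sup>2 * cell_mass a"
        using insertion_gain_le_deletion_loss[OF a(1), of y] deletion_loss_le[OF a(1) ne[OF a(1)]] cardN N2
        unfolding \<delta>_def by simp
      \<comment> \<open>Origin of the constant: \<open>864 = 2 * 12^2 * 3\<close>.\<close>
      moreover have "2 * (12 * R * q)\<^sup>2 * (3 * q ^ ?n) = 864 * R\<^sup>2 * q ^ (?n + 2)"
        unfolding power_mult_distrib power_add by simp
      moreover have "distortion \<Gamma> * (3 / N) = 3 * distortion \<Gamma> / N" by simp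
      ultimately show ?thesis
        unfolding q_def[symmetric] by linarith
    qed
  qed
qed

end

text \<open>The bound on the gain involves the distortion itself, which is controlled by the moment of
  order \<open>DIM + 2\<close>; the resulting inequality is self-improving.\<close>
lemma self_improving_bound:
  fixes L q A B :: real
  assumes "0 \<le> L" "0 < q" "0 \<le> A" "0 \<le> B" and le: "L ^ (n + 2) \<le> A * q ^ n * L\<^sup>2 + B * q ^ (n + 2)" and n: "0 < n"
  shows "L \<le> (A + B + 1) * q"
proof (rule ccontr)
  \<comment> \<open>The summand 1 provides the contradiction. If \<open>G * q < L\<close>, then
    \<open>G * q^k \<le> L^k\<close> for positive \<open>k\<close> because
    \<open>G \<le> G^k\<close>; so \<open>G\<close> times the hypothesis gives
    \<open>G * L^(n+2) \<le> (G - 1) * L^(n+2)\<close>.\<close>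
  define G where "G = A + B + 1"
  have G1: "1 \<le> G" using assms by (simp add: G_def)
  assume "\<not> L \<le> (A + B + 1) * q"
  then have Gq: "G * q < L" by (simp add: G_def)
  have L0: "0 < L" using Gq G1 assms by (smt (verit) mult_pos_pos)
  have *: "G * q ^ k \<le> L ^ k" if "0 < k" for k
  proof -
    have "G * q ^ k \<le> G ^ k * q ^ k" using G1 that assms self_le_power[of G k] by (intro mult_right_mono) auto
    also have "\<dots> = (G * q) ^ k" by (simp add: power_mult_distrib)
    also have "\<dots> \<le> L ^ k" using Gq G1 assms by (intro power_mono) auto
    finally show ?thesis .
  qed
  have "G * L ^ (n + 2) \<le> A * L\<^sup>2 * (G * q ^ n) + B * (G * q ^ (n + 2))"
    using mult_left_mono[OF le, of G] G1 by (simp add: algebra_simps)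
  also have "\<dots> \<le> A * L\<^sup>2 * L ^ n + B * L ^ (n + 2)"
    using assms n by (intro add_mono mult_left_mono *) auto
  also have "\<dots> = (G - 1) * L ^ (n + 2)" unfolding G_def power_add by (simp add: distrib_right)
  finally have "L ^ (n + 2) \<le> 0" by (simp add: algebra_simps)
  then show False using zero_less_power[OF L0, of "n + 2"] by linarith
qed

text \<open>Only the top order \<open>d + 2\<close> is estimated; lower orders follow by Lyapunov,
  so one \<open>C\<close> serves all \<open>s\<close>. If \<open>L\<close> is the norm of order
  \<open>d + 2\<close> of the distance to the codebook, the distortion is at most
  \<open>L^2\<close>, which closes the estimate on itself.\<close>

lemma (in bounded_law) distortion_mismatch:
  obtains C where "0 \<le> C"
    "\<And>N \<Gamma> pr s. \<lbrakk>1 \<le> N; quad_opt_quantizer \<mu> N \<Gamma>; borel_nn_proj \<Gamma> pr; 0 < s; s \<le> real DIM('a) + 2\<rbrakk> \<Longrightarrow>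
      (\<integral>x. infdist x \<Gamma> powr s \<partial>\<mu>) \<le> (C * real N powr (- 1 / DIM('a))) powr s"
proof -
  let ?n = "DIM('a)"
  define c where "c = 4 / 3 * (4 * R) ^ ?n"
  \<comment> \<open>The first three terms are \<open>A + B + 1\<close> of
    \<open>self_improving_bound\<close> with \<open>A = 3 * c\<close> and
    \<open>B = c * (864 * R^2)\<close>. The term \<open>2 * R\<close> serves \<open>N = 1\<close>,
    where no codepoint can be spared and \<open>q = 1\<close>.\<close>
  define C where "C = 3 * c + c * (864 * R\<^sup>2) + 1 + 2 * R"
  have c0: "0 \<le> c" using R_pos by (simp add: c_def)
  have main: "(\<integral>x. infdist x \<Gamma> powr s \<partial>\<mu>) \<le> (C * real N powr (- 1 / ?n)) powr s"
    if "1 \<le> N" "quad_opt_quantizer \<mu> N \<Gamma>" "borel_nn_proj \<Gamma> pr" "0 < s" "s \<le> real ?n + 2" for N \<Gamma> pr s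
  proof -
    interpret optimal_quantizer \<mu> R N \<Gamma> pr by unfold_locales fact+
    define q where "q = real N powr (- 1 / ?n)"
    define t where "t = real (?n + 2)"
    have qn: "q ^ ?n = 1 / N"
      unfolding q_def using N_pos by (intro powr_neg_inverse_power) auto
    have q0: "0 < q" using N_pos by (simp add: q_def)
    have t0: "0 < t" by (simp add: t_def)
    define M where "M = (\<integral>x. infdist x \<Gamma> powr t \<partial>\<mu>)"
    have M0: "0 \<le> M" by (simp add: M_def)
    have lyap: "(\<integral>x. infdist x \<Gamma> powr r \<partial>\<mu>) \<le> M powr (r / t)" if "0 < r" "r \<le> t" for r
      unfolding M_def using that codebook_nonempty
      by (intro lyapunov_inequality integrable_infdist_powr infdist_nonneg) auto
    have powr_eq: "infdist x \<Gamma> powr real k = infdist x \<Gamma> ^ k" if "0 < k" for x k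
      using that by (intro powr_realpow' infdist_nonneg) auto
    have Meq: "M = (\<integral>x. infdist x \<Gamma> ^ (?n + 2) \<partial>\<mu>)"
      unfolding M_def t_def by (subst powr_eq) auto
    define L where "L = M powr (1 / t)"
    have L0: "0 \<le> L" by (simp add: L_def)
    have LM: "L powr r = M powr (r / t)" for r using M0 by (simp add: L_def powr_powr)
    have Ln: "L ^ (?n + 2) = M"
    proof -
      have "L powr t = M" using LM[of t] t0 M0 by simp
      then show ?thesis unfolding t_def using L0 by (subst (asm) powr_realpow') auto
    qed
    have L_le: "L \<le> C * q"
    proof (cases "N = 1")
      case True
      then have "q = 1" by (simp add: q_def)
      have "M \<le> (\<integral>x. (2 * R) ^ (?n + 2) \<partial>\<mu>)"
        unfolding Meq
      proof (rule integral_mono_AE)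
        show "AE x in \<mu>. infdist x \<Gamma> ^ (?n + 2) \<le> (2 * R) ^ (?n + 2)"
          using AE_infdist_le by eventually_elim (intro power_mono infdist_nonneg)
      qed (rule integrable_infdist_power[OF codebook_nonempty], simp)
      also have "\<dots> = (2 * R) ^ (?n + 2)" using prob_space by simp
      finally have "L ^ (?n + 2) \<le> (2 * R) ^ (?n + 2)" by (simp only: Ln)
      then have "L \<le> 2 * R" using R_pos L0 by (subst (asm) power_mono_iff) auto
      also have "\<dots> \<le> C * q" using c0 R_pos by (simp add: C_def \<open>q = 1\<close>)
      finally show ?thesis .
    next
      case False
      then have N2: "2 \<le> N" using N_pos by simp
      have "distortion \<Gamma> = (\<integral>x. infdist x \<Gamma> powr real 2 \<partial>\<mu>)"
        unfolding distortion_def by (subst powr_eq) auto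
      also have "\<dots> \<le> L powr 2" unfolding LM using lyap[of 2] by (simp add: t_def)
      finally have D: "distortion \<Gamma> \<le> L\<^sup>2" using L0 by simp
      have "M \<le> c * (3 * distortion \<Gamma> / N + 864 * R\<^sup>2 * q ^ (?n + 2))"
        unfolding Meq c_def q_def
        by (rule moment_le_insertion_gain[OF codebook_nonempty AE_infdist_le insertion_gain_le[OF N2]])
      also have "\<dots> \<le> c * (3 * L\<^sup>2 / N + 864 * R\<^sup>2 * q ^ (?n + 2))"
        using D c0 by (intro mult_left_mono add_mono divide_right_mono) auto
      also have "\<dots> = (3 * c) * q ^ ?n * L\<^sup>2 + (c * (864 * R\<^sup>2)) * q ^ (?n + 2)"
        by (simp add: qn algebra_simps)
      finally have "L ^ (?n + 2) \<le> (3 * c) * q ^ ?n * L\<^sup>2 + (c * (864 * R\<^sup>2)) * q ^ (?n + 2)"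
        by (simp only: Ln)
      then have "L \<le> (3 * c + c * (864 * R\<^sup>2) + 1) * q"
        using L0 q0 c0 by (intro self_improving_bound[where n = "?n"]) auto
      also have "\<dots> \<le> C * q" using q0 R_pos by (intro mult_right_mono) (auto simp: C_def)
      finally show ?thesis .
    qed
    have "(\<integral>x. infdist x \<Gamma> powr s \<partial>\<mu>) \<le> L powr s"
      unfolding LM using that by (intro lyap) (auto simp: t_def)
    also have "\<dots> \<le> (C * q) powr s" using L0 L_le that by (intro powr_mono2) auto
    finally show ?thesis by (simp add: q_def)
  qed
  have "0 \<le> C" using c0 R_pos by (simp add: C_def)
  then show thesis using that main by blast
qed

section \<open>Disintegration\<close>

lemma measurable_fst_borel [measurable]: "(fst :: 'a::euclidean_space \<times> 'b::euclidean_space \<Rightarrow> 'a) \<in> borel \<rightarrow>\<^sub>M borel"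
  and measurable_snd_borel [measurable]: "(snd :: 'a \<times> 'b \<Rightarrow> 'b) \<in> borel \<rightarrow>\<^sub>M borel"
  by (intro borel_measurable_continuous_onI continuous_intros)+

lemma prob_kernelD:
  assumes "prob_kernel \<kappa>"
  shows prob_kernel_measurable: "\<kappa> \<in> borel \<rightarrow>\<^sub>M subprob_algebra borel"
    and prob_space_kernel: "prob_space (\<kappa> x)" and sets_kernel: "sets (\<kappa> x) = sets borel"
  using assms measurable_space[of \<kappa> borel "prob_algebra borel" x]
  by (auto simp: prob_kernel_def measurable_prob_algebraD space_prob_algebra)

lemma measurable_Pair_distr_kernel:
  fixes \<kappa> :: "'a::euclidean_space \<Rightarrow> 'b::euclidean_space measure"
  assumes "prob_kernel \<kappa>"
  shows "(\<lambda>x. distr (\<kappa> x) borel (\<lambda>y. (x, y))) \<in> borel \<rightarrow>\<^sub>M subprob_algebra borel"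
  by (rule measurable_distr2[OF _ prob_kernel_measurable[OF assms]]) (simp add: borel_prod)

lemma nn_integral_disint:
  fixes \<kappa> :: "'a::euclidean_space \<Rightarrow> 'b::euclidean_space measure"
  assumes \<kappa>: "prob_kernel \<kappa>" and \<mu>[measurable_cong]: "sets \<mu> = sets borel"
    and f[measurable]: "f \<in> borel_measurable borel"
  shows "(\<integral>\<^sup>+z. f z \<partial>disint \<mu> \<kappa>) = (\<integral>\<^sup>+x. \<integral>\<^sup>+y. f (x, y) \<partial>\<kappa> x \<partial>\<mu>)"
proof -
  have "(\<integral>\<^sup>+z. f z \<partial>disint \<mu> \<kappa>) = (\<integral>\<^sup>+x. \<integral>\<^sup>+z. f z \<partial>distr (\<kappa> x) borel (\<lambda>y. (x, y)) \<partial>\<mu>)"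
    unfolding disint_def
    by (rule nn_integral_bind[where B = borel])
       (use measurable_Pair_distr_kernel[OF \<kappa>] in \<open>simp_all add: measurable_cong_sets[OF \<mu>]\<close>)
  also have "\<dots> = (\<integral>\<^sup>+x. \<integral>\<^sup>+y. f (x, y) \<partial>\<kappa> x \<partial>\<mu>)"
    by (intro nn_integral_cong nn_integral_distr)
       (auto simp: measurable_cong_sets[OF sets_kernel[OF \<kappa>]])
  finally show ?thesis .
qed

lemma sets_disint:
  fixes \<kappa> :: "'a::euclidean_space \<Rightarrow> 'b::euclidean_space measure"
  assumes "sets \<mu> = sets borel"
  shows "sets (disint \<mu> \<kappa>) = sets borel"
  unfolding disint_def
  by (rule sets_bind) (use sets_eq_imp_space_eq[OF assms] in auto)

lemma AE_disint:
  fixes \<kappa> :: "'a::euclidean_space \<Rightarrow> 'b::euclidean_space measure"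
  assumes \<kappa>: "prob_kernel \<kappa>" and \<mu>: "sets \<mu> = sets borel"
    and P: "Measurable.pred borel P" and ae: "AE z in disint \<mu> \<kappa>. P z"
  shows "AE x in \<mu>. AE y in \<kappa> x. P (x, y)"
proof -
  have "AE x in \<mu>. AE z in distr (\<kappa> x) borel (\<lambda>y. (x, y)). P z"
    using ae unfolding disint_def
    by (subst (asm) AE_bind[where B = borel])
       (use measurable_Pair_distr_kernel[OF \<kappa>] P in \<open>simp_all add: measurable_cong_sets[OF \<mu>]\<close>)
  then show ?thesis
  proof eventually_elim
    case (elim x)
    have "(\<lambda>y. (x, y)) \<in> \<kappa> x \<rightarrow>\<^sub>M borel"
      by (simp add: measurable_cong_sets[OF sets_kernel[OF \<kappa>]])
    from AE_distrD[OF this elim] show ?case .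
  qed
qed

lemma integral_disint_bounded:
  fixes \<kappa> :: "'a::euclidean_space \<Rightarrow> 'b::euclidean_space measure" and f :: "'a \<times> 'b \<Rightarrow> real"
  assumes \<kappa>: "prob_kernel \<kappa>" and \<mu>: "sets \<mu> = sets borel" "prob_space \<mu>"
    and f[measurable]: "f \<in> borel_measurable borel" and bnd: "\<And>z. \<bar>f z\<bar> \<le> B"
  shows "(\<integral>z. f z \<partial>disint \<mu> \<kappa>) = (\<integral>x. \<integral>y. f (x, y) \<partial>\<kappa> x \<partial>\<mu>)"
proof -
  interpret prob_space \<mu> by fact
  have "(\<integral>z. f z \<partial>disint \<mu> \<kappa>) = (\<integral>x. \<integral>z. f z \<partial>distr (\<kappa> x) borel (\<lambda>y. (x, y)) \<partial>\<mu>)"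
    unfolding disint_def
  proof (rule integral_bind[where K = borel and B' = 1 and B = B])
    show "(\<lambda>x. distr (\<kappa> x) borel (\<lambda>y. (x, y))) \<in> \<mu> \<rightarrow>\<^sub>M subprob_algebra borel"
      using measurable_Pair_distr_kernel[OF \<kappa>] by (simp add: measurable_cong_sets[OF \<mu>(1)])
    show "AE x in \<mu>. emeasure (distr (\<kappa> x) borel (\<lambda>y. (x, y))) (space (distr (\<kappa> x) borel (\<lambda>y. (x, y)))) \<le> ennreal 1"
    proof (rule AE_I2)
      fix x
      have "prob_space (distr (\<kappa> x) borel (\<lambda>y. (x, y)))"
        by (rule prob_space.prob_space_distr[OF prob_space_kernel[OF \<kappa>]])
           (simp add: measurable_cong_sets[OF sets_kernel[OF \<kappa>]])
      then show "emeasure (distr (\<kappa> x) borel (\<lambda>y. (x, y))) (space (distr (\<kappa> x) borel (\<lambda>y. (x, y)))) \<le> ennreal 1"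
        by (simp only: prob_space.emeasure_space_1) simp
    qed
  qed (use bnd in \<open>auto intro: finite_measure_axioms\<close>)
  also have "\<dots> = (\<integral>x. \<integral>y. f (x, y) \<partial>\<kappa> x \<partial>\<mu>)"
    by (intro Bochner_Integration.integral_cong refl integral_distr)
       (auto simp: measurable_cong_sets[OF sets_kernel[OF \<kappa>]])
  finally show ?thesis .
qed

text \<open>The martingale property tested on an event of the first coordinate, to be used on the
  cells of the quantizer.\<close>

lemma integral_disint_martingale:
  fixes \<mu> :: "'a::euclidean_space measure"
  assumes \<mu>: "sets \<mu> = sets borel" "prob_space \<mu>" and \<kappa>: "prob_kernel \<kappa>"
    and mart: "AE x in \<mu>. integrable (\<kappa> x) (\<lambda>y. y) \<and> (\<integral>y. y \<partial>\<kappa> x) = x"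
    and prob: "prob_space (disint \<mu> \<kappa>)"
    and bnd: "AE z in disint \<mu> \<kappa>. norm (snd z) \<le> R" and bnd\<mu>: "AE x in \<mu>. norm x \<le> R"
    and R0: "0 \<le> R" and A[measurable]: "A \<in> sets borel"
  shows "(\<integral>z. indicat_real A (fst z) *\<^sub>R snd z \<partial>disint \<mu> \<kappa>) = (\<integral>x. indicat_real A x *\<^sub>R x \<partial>\<mu>)"
proof (rule euclidean_eqI)
  fix b :: 'a assume b: "b \<in> Basis"
  interpret M: prob_space \<mu> by fact
  interpret P: prob_space "disint \<mu> \<kappa>" by fact
  note sd = sets_disint[OF \<mu>(1), of \<kappa>]
  note [measurable_cong] = \<mu>(1) sd
  \<comment> \<open>\<open>integral_disint_bounded\<close> wants a bound valid everywhere, while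
    \<open>snd\<close> is bounded almost everywhere only. Clamping the coordinate to
    \<open>[- R, R]\<close> supplies the bound and changes nothing up to null sets.\<close>
  define t where "t y = max (- R) (min R (y \<bullet> b))" for y
  have [measurable]: "t \<in> borel_measurable borel" unfolding t_def by measurable
  have t_eq: "t y = y \<bullet> b" if "norm y \<le> R" for y
    using Basis_le_norm[OF b, of y] that by (auto simp: t_def)
  have I1: "integrable (disint \<mu> \<kappa>) (\<lambda>z. indicat_real A (fst z) *\<^sub>R snd z)"
  proof (rule P.integrable_const_bound[where B = R])
    show "AE z in disint \<mu> \<kappa>. norm (indicat_real A (fst z) *\<^sub>R snd z) \<le> R"
      using bnd by eventually_elim (auto simp: R0 split: split_indicator)
  qed measurable
  have I2: "integrable \<mu> (\<lambda>x. indicat_real A x *\<^sub>R x)"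
  proof (rule M.integrable_const_bound[where B = R])
    show "AE x in \<mu>. norm (indicat_real A x *\<^sub>R x) \<le> R"
      using bnd\<mu> by eventually_elim (auto simp: R0 split: split_indicator)
  qed measurable
  have "(\<integral>z. indicat_real A (fst z) *\<^sub>R snd z \<partial>disint \<mu> \<kappa>) \<bullet> b = (\<integral>z. (indicat_real A (fst z) *\<^sub>R snd z) \<bullet> b \<partial>disint \<mu> \<kappa>)"
    by (rule integral_inner_left[OF I1, symmetric])
  also have "\<dots> = (\<integral>z. indicat_real A (fst z) * t (snd z) \<partial>disint \<mu> \<kappa>)"
  proof (rule integral_cong_AE)
    show "AE z in disint \<mu> \<kappa>. (indicat_real A (fst z) *\<^sub>R snd z) \<bullet> b = indicat_real A (fst z) * t (snd z)"
      using bnd by eventually_elim (simp add: t_eq)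
  qed measurable
  also have "\<dots> = (\<integral>x. \<integral>y. indicat_real A x * t y \<partial>\<kappa> x \<partial>\<mu>)"
    by (subst integral_disint_bounded[OF \<kappa> \<mu>, where B = "\<bar>R\<bar>"]) (auto simp: t_def indicator_def)
  also have "\<dots> = (\<integral>x. (indicat_real A x *\<^sub>R x) \<bullet> b \<partial>\<mu>)"
  proof (rule integral_cong_AE)
    have [measurable]: "(\<lambda>x. \<integral>y. t y \<partial>\<kappa> x) \<in> borel_measurable borel"
      by (rule measurable_compose[OF prob_kernel_measurable[OF \<kappa>] integral_measurable_subprob_algebra]) measurable
    show "(\<lambda>x. \<integral>y. indicat_real A x * t y \<partial>\<kappa> x) \<in> borel_measurable \<mu>"
      unfolding integral_mult_right_zero by measurable
    have "AE x in \<mu>. AE y in \<kappa> x. norm y \<le> R"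
      using AE_disint[OF \<kappa> \<mu>(1) _ bnd] by simp
    then show "AE x in \<mu>. (\<integral>y. indicat_real A x * t y \<partial>\<kappa> x) = (indicat_real A x *\<^sub>R x) \<bullet> b"
      using mart
    proof eventually_elim
      case (elim x)
      have [measurable_cong]: "sets (\<kappa> x) = sets borel" by (rule sets_kernel[OF \<kappa>])
      have "(\<integral>y. t y \<partial>\<kappa> x) = (\<integral>y. y \<bullet> b \<partial>\<kappa> x)"
      proof (rule integral_cong_AE)
        show "AE y in \<kappa> x. t y = y \<bullet> b" using elim(1) by eventually_elim (rule t_eq)
      qed measurable
      also have "\<dots> = x \<bullet> b" using elim(2) integral_inner_left[of b "\<kappa> x" "\<lambda>y. y"] by simp
      finally show ?case by simp
    qed
  qed measurable
  also have "\<dots> = (\<integral>x. indicat_real A x *\<^sub>R x \<partial>\<mu>) \<bullet> b"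
    by (rule integral_inner_left[OF I2])
  finally show "(\<integral>z. indicat_real A (fst z) *\<^sub>R snd z \<partial>disint \<mu> \<kappa>) \<bullet> b = (\<integral>x. indicat_real A x *\<^sub>R x \<partial>\<mu>) \<bullet> b" .
qed

section \<open>Conditioning on the atoms of a finitely supported first marginal\<close>

text \<open>Elementary conditional law of the second coordinate. On null atoms the value is a fixed
  Dirac mass, so that it is a probability for every \<open>a\<close> and constant off a finite set,
  hence measurable.\<close>

definition cell_kernel :: "('a::euclidean_space \<times> 'b::euclidean_space) measure \<Rightarrow> 'a \<Rightarrow> 'b measure" where
  "cell_kernel P a = (if emeasure P ({a} \<times> UNIV) = 0 then return borel 0
     else distr (uniform_measure P ({a} \<times> UNIV)) borel snd)"

locale finite_first_marginal = prob_space P for P :: "('a::euclidean_space \<times> 'b::euclidean_space) measure" +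
  fixes G :: "'a set"
  assumes sets_P [measurable_cong]: "sets P = sets borel" and finite_G: "finite G"
    and AE_G: "AE z in P. fst z \<in> G"
begin

lemma singleton_times_sets [measurable]: "{a :: 'a} \<times> (UNIV :: 'b set) \<in> sets borel"
  by (intro borel_closed closed_Times closed_singleton closed_UNIV)

lemma nn_integral_cell_kernel:
  assumes "emeasure P ({a} \<times> UNIV) \<noteq> 0" and [measurable]: "f \<in> borel_measurable borel"
  shows "(\<integral>\<^sup>+y. f y \<partial>cell_kernel P a) = (\<integral>\<^sup>+z. f (snd z) * indicator ({a} \<times> UNIV) z \<partial>P) / emeasure P ({a} \<times> UNIV)"
  using assms(1) unfolding cell_kernel_def
  by (simp add: nn_integral_distr nn_integral_uniform_measure)

lemma prob_space_cell_kernel: "prob_space (cell_kernel P a)"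
proof (cases "emeasure P ({a} \<times> UNIV) = 0")
  case False
  then have "prob_space (uniform_measure P ({a} \<times> UNIV))"
    by (intro prob_space_uniform_measure) (auto simp: emeasure_eq_measure)
  then show ?thesis using False
    by (auto simp: cell_kernel_def intro!: prob_space.prob_space_distr)
qed (simp add: cell_kernel_def prob_space_return)

lemma sets_cell_kernel: "sets (cell_kernel P a) = sets borel"
  by (simp add: cell_kernel_def)

lemma emeasure_outside: "a \<notin> G \<Longrightarrow> emeasure P ({a} \<times> UNIV) = 0"
proof -
  assume a: "a \<notin> G"
  have "AE z in P. z \<notin> {a} \<times> UNIV" using AE_G a by (auto elim!: eventually_mono)
  then show ?thesis by (subst (asm) AE_iff_measurable[of "{a} \<times> UNIV"]) (auto simp: sets_P sets_eq_imp_space_eq[OF sets_P])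
qed

lemma prob_kernel_cell_kernel: "prob_kernel (cell_kernel P)"
  unfolding prob_kernel_def
proof (rule measurable_discrete_difference[where X = G])
  show "(\<lambda>_. return borel 0) \<in> borel \<rightarrow>\<^sub>M prob_algebra borel"
    by (simp add: space_prob_algebra prob_space_return)
  show "cell_kernel P x \<in> space (prob_algebra borel)" for x
    by (simp add: space_prob_algebra prob_space_cell_kernel sets_cell_kernel)
qed (auto simp: cell_kernel_def emeasure_outside intro: countable_finite finite_G)

text \<open>The formula of total probability. Almost everywhere \<open>fst z\<close> is one of
  finitely many atoms, so a function of \<open>fst z\<close> is a finite combination of indicators
  of slices; on a charged slice the normalisation cancels, and null slices contribute
  nothing.\<close>

lemma disint_cell_kernel: "P = disint (distr P borel fst) (cell_kernel P)"
proof (rule measure_eqI)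
  let ?K = "cell_kernel P"
  show "sets P = sets (disint (distr P borel fst) ?K)"
    by (simp add: sets_disint sets_P)
  fix A assume "A \<in> sets P"
  then have A[measurable]: "A \<in> sets borel" by (simp add: sets_P)
  define h where "h x = (\<integral>\<^sup>+y. indicator A (x, y) \<partial>?K x)" for x
  have h_meas[measurable]: "h \<in> borel_measurable borel"
    unfolding h_def
    by (rule nn_integral_measurable_subprob_algebra2[OF _ prob_kernel_measurable[OF prob_kernel_cell_kernel]])
       (simp add: borel_prod)
  have sum1: "AE z in P. F (fst z) = (\<Sum>a\<in>G. F a * indicator ({a} \<times> UNIV) z)" for F :: "'a \<Rightarrow> ennreal"
    using AE_G
  proof eventually_elim
    case (elim z)
    have "(\<Sum>a\<in>G. F a * indicator ({a} \<times> UNIV) z) = (\<Sum>a\<in>G. if a = fst z then F (fst z) else 0)"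
      by (intro sum.cong) (auto simp: indicator_def mem_Times_iff)
    then show ?case using elim finite_G by simp
  qed
  have cell: "h a * emeasure P ({a} \<times> UNIV) = (\<integral>\<^sup>+z. indicator A z * indicator ({a} \<times> UNIV) z \<partial>P)" for a
  proof (cases "emeasure P ({a} \<times> UNIV) = 0")
    case True
    then have "AE z in P. z \<notin> {a} \<times> UNIV"
      by (subst AE_iff_measurable[of "{a} \<times> UNIV"]) (auto simp: sets_P sets_eq_imp_space_eq[OF sets_P])
    then have "AE z in P. indicator A z * indicator ({a} \<times> UNIV) z = (0::ennreal)" by eventually_elim simp
    then have "(\<integral>\<^sup>+z. indicator A z * indicator ({a} \<times> UNIV) z \<partial>P) = 0"
      by (subst nn_integral_0_iff_AE) auto
    then show ?thesis using True by simp
  next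
    case False
    have "h a = (\<integral>\<^sup>+z. indicator A (a, snd z) * indicator ({a} \<times> UNIV) z \<partial>P) / emeasure P ({a} \<times> UNIV)"
      unfolding h_def by (rule nn_integral_cell_kernel[OF False]) measurable
    \<comment> \<open>On the slice, \<open>(a, snd z)\<close> is \<open>z\<close> itself.\<close>
    also have "(\<integral>\<^sup>+z. indicator A (a, snd z) * indicator ({a} \<times> UNIV) z \<partial>P) = (\<integral>\<^sup>+z. indicator A z * indicator ({a} \<times> UNIV) z \<partial>P)"
      by (intro nn_integral_cong) (auto split: split_indicator)
    finally show ?thesis using False
      by (simp add: ennreal_divide_times ennreal_divide_self emeasure_eq_measure)
  qed
  have "emeasure (disint (distr P borel fst) ?K) A = (\<integral>\<^sup>+z. indicator A z \<partial>disint (distr P borel fst) ?K)"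
    by (simp add: sets_disint)
  also have "\<dots> = (\<integral>\<^sup>+x. h x \<partial>distr P borel fst)"
    unfolding h_def by (rule nn_integral_disint[OF prob_kernel_cell_kernel]) auto
  also have "\<dots> = (\<integral>\<^sup>+z. h (fst z) \<partial>P)" by (rule nn_integral_distr) measurable
  also have "\<dots> = (\<integral>\<^sup>+z. (\<Sum>a\<in>G. h a * indicator ({a} \<times> UNIV) z) \<partial>P)"
    by (rule nn_integral_cong_AE[OF sum1])
  also have "\<dots> = (\<Sum>a\<in>G. h a * emeasure P ({a} \<times> UNIV))"
    by (subst nn_integral_sum) (auto simp: nn_integral_cmult_indicator sets_P)
  also have "\<dots> = (\<integral>\<^sup>+z. (\<Sum>a\<in>G. indicator A z * indicator ({a} \<times> UNIV) z) \<partial>P)"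
    unfolding cell by (subst nn_integral_sum) auto
  also have "\<dots> = (\<integral>\<^sup>+z. indicator A z \<partial>P)"
  proof (rule nn_integral_cong_AE)
    show "AE z in P. (\<Sum>a\<in>G. indicator A z * indicator ({a} \<times> UNIV) z) = (indicator A z :: ennreal)"
      using sum1[of "\<lambda>_. 1"] by eventually_elim (simp flip: sum_distrib_left)
  qed
  also have "\<dots> = emeasure P A" by (simp add: sets_P)
  finally show "emeasure P A = emeasure (disint (distr P borel fst) ?K) A" ..
qed

lemma integral_cell_kernel:
  fixes f :: "'b \<Rightarrow> 'c::{banach, second_countable_topology}"
  assumes pos: "emeasure P ({a} \<times> UNIV) \<noteq> 0" and [measurable]: "f \<in> borel_measurable borel"
  shows "(\<integral>y. f y \<partial>cell_kernel P a) = (\<integral>z. indicat_real ({a} \<times> UNIV) z *\<^sub>R f (snd z) \<partial>P) /\<^sub>R measure P ({a} \<times> UNIV)"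
proof -
  have m: "0 < measure P ({a} \<times> UNIV)" using pos by (simp add: emeasure_eq_measure less_le)
  have u: "uniform_measure P ({a} \<times> UNIV) = density P (\<lambda>z. ennreal (indicat_real ({a} \<times> UNIV) z / measure P ({a} \<times> UNIV)))"
    unfolding uniform_measure_def using m
    by (intro density_cong) (auto simp: emeasure_eq_measure indicator_def divide_ennreal_def inverse_ennreal inverse_eq_divide)
  have "(\<integral>y. f y \<partial>cell_kernel P a) = (\<integral>z. f (snd z) \<partial>uniform_measure P ({a} \<times> UNIV))"
    using pos by (simp add: cell_kernel_def integral_distr)
  also have "\<dots> = (\<integral>z. (indicat_real ({a} \<times> UNIV) z / measure P ({a} \<times> UNIV)) *\<^sub>R f (snd z) \<partial>P)"
    unfolding u by (subst integral_density) auto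
  also have "\<dots> = (\<integral>z. inverse (measure P ({a} \<times> UNIV)) *\<^sub>R (indicat_real ({a} \<times> UNIV) z *\<^sub>R f (snd z)) \<partial>P)"
    by (simp add: divide_inverse mult.commute)
  finally show ?thesis unfolding integral_scaleR_right .
qed

end

lemma prob_space_unifU: "prob_space unifU" and sets_unifU [measurable_cong]: "sets unifU = sets borel"
  and AE_unifU: "AE u in unifU. u \<in> {0..1}"
  unfolding unifU_def by (auto intro!: prob_space_uniform_measure AE_uniform_measureI)

section \<open>Modifying a coupling on a finite set\<close>

lemma Wp_powr_le:
  assumes "0 < p" "\<gamma> \<in> couplings \<mu> \<nu>" "0 \<le> c"
    and "(\<integral>\<^sup>+z. ennreal (dist (fst z) (snd z) powr p) \<partial>\<gamma>) \<le> ennreal c"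
  shows "Wp p \<mu> \<nu> powr p \<le> c"
proof -
  let ?I = "INF \<gamma>\<in>couplings \<mu> \<nu>. \<integral>\<^sup>+z. ennreal (dist (fst z) (snd z) powr p) \<partial>\<gamma>"
  have "?I \<le> ennreal c" by (rule INF_lower2[OF assms(2)]) (rule assms(4))
  then have "enn2real ?I \<le> c" using assms(3) by (simp add: enn2real_leI)
  then show ?thesis using assms(1) by (simp add: Wp_def powr_powr)
qed

text \<open>The maximal coupling of two probability vectors \<open>\<rho>\<close> and \<open>s\<close>, written as a transition matrix
  from \<open>\<rho>\<close> to \<open>s\<close>: keep as much mass in place as possible and spread the excess of \<open>\<rho>\<close> proportionally
  to the excess of \<open>s\<close>.\<close>
lemma maximal_coupling_matrix:
  fixes \<rho> s :: "'a \<Rightarrow> real"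
  assumes G: "finite G" and \<rho>0: "\<And>g. 0 \<le> \<rho> g" and s0: "\<And>g. 0 \<le> s g"
    and \<rho>1: "(\<Sum>g\<in>G. \<rho> g) = 1" and s1: "(\<Sum>g\<in>G. s g) = 1"
  obtains T :: "'a \<Rightarrow> 'a \<Rightarrow> real" where "\<And>g k. 0 \<le> T g k" "\<And>g k. g \<notin> G \<or> k \<notin> G \<Longrightarrow> T g k = 0"
    "\<And>g. g \<in> G \<Longrightarrow> 0 < \<rho> g \<Longrightarrow> (\<Sum>k\<in>G. T g k) = 1"
    "\<And>k. k \<in> G \<Longrightarrow> (\<Sum>g\<in>G. \<rho> g * T g k) = s k"
    "\<And>g. g \<in> G \<Longrightarrow> \<rho> g * (1 - T g g) \<le> \<bar>s g - \<rho> g\<bar>"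
proof -
  define m where "m g = min (\<rho> g) (s g)" for g
  \<comment> \<open>The total mass to be moved. The excess of \<open>s\<close> and the excess of
    \<open>\<rho>\<close> have the same total because both vectors sum to 1. If
    \<open>E = 0\<close>, division makes \<open>r\<close> zero and all charged atoms keep their
    mass.\<close>
  define E where "E = (\<Sum>g\<in>G. s g - m g)"
  define t where "t g = m g / \<rho> g" for g
  define r where "r k = (s k - m k) / E" for k
  define T where "T g k = (if g \<in> G \<and> k \<in> G then (if k = g then t g else 0) + (1 - t g) * r k else 0)" for g k
  have m: "0 \<le> m g" "m g \<le> \<rho> g" "m g \<le> s g" for g using \<rho>0[of g] s0[of g] by (auto simp: m_def)
  have E0: "0 \<le> E" unfolding E_def using m by (intro sum_nonneg) auto
  have E': "E = (\<Sum>g\<in>G. \<rho> g - m g)" using \<rho>1 s1 by (simp add: E_def sum_subtractf)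
  have t: "0 \<le> t g" "t g \<le> 1" for g using m[of g] \<rho>0[of g] by (auto simp: t_def divide_le_eq_1)
  have \<rho>t: "\<rho> g * t g = m g" for g using m[of g] by (auto simp: t_def)
  have r0: "0 \<le> r k" for k using m E0 by (simp add: r_def)
  have rE: "r k * E = s k - m k" if "k \<in> G" for k
  proof (cases "E = 0")
    case True
    then have "s k - m k = 0"
      using sum_nonneg_eq_0_iff[OF G, of "\<lambda>g. s g - m g"] m that by (simp add: E_def)
    then show ?thesis using True by simp
  qed (simp add: r_def)
  have t1: "t g = 1" if "E = 0" "g \<in> G" "0 < \<rho> g" for g
  proof -
    have "\<rho> g - m g = 0"
      using sum_nonneg_eq_0_iff[OF G, of "\<lambda>g. \<rho> g - m g"] m that by (simp add: E')
    then show ?thesis using that by (simp add: t_def)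
  qed
  have sumr: "(\<Sum>k\<in>G. r k) = 1" if "E \<noteq> 0"
    using that by (simp add: r_def E_def flip: sum_divide_distrib)
  have rows: "(\<Sum>k\<in>G. T g k) = 1" if g: "g \<in> G" "0 < \<rho> g" for g
  proof -
    have "(\<Sum>k\<in>G. T g k) = t g + (1 - t g) * (\<Sum>k\<in>G. r k)"
      using g G by (simp add: T_def sum.distrib sum_distrib_left)
    then show ?thesis using t1[OF _ g] sumr by (cases "E = 0") auto
  qed
  have cols: "(\<Sum>g\<in>G. \<rho> g * T g k) = s k" if k: "k \<in> G" for k
  proof -
    have "(\<Sum>g\<in>G. \<rho> g * T g k) = (\<Sum>g\<in>G. (if g = k then m k else 0) + r k * (\<rho> g - m g))"
      using k by (intro sum.cong) (auto simp: T_def algebra_simps \<rho>t)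
    also have "\<dots> = m k + r k * E"
      using k G by (simp add: sum.distrib E' sum_distrib_left)
    finally show ?thesis using rE[OF k] by simp
  qed
  have diag: "\<rho> g * (1 - T g g) \<le> \<bar>s g - \<rho> g\<bar>" if "g \<in> G" for g
  proof -
    have "\<rho> g * (1 - T g g) \<le> \<rho> g * (1 - t g)"
      using that \<rho>0[of g] t[of g] r0[of g] by (intro mult_left_mono) (auto simp: T_def)
    also have "\<dots> = \<rho> g - m g" using \<rho>t[of g] by (simp add: algebra_simps)
    also have "\<dots> \<le> \<bar>s g - \<rho> g\<bar>" by (auto simp: m_def)
    finally show ?thesis .
  qed
  show thesis
    by (rule that[of T]) (use t r0 rows cols diag in \<open>auto simp: T_def\<close>)
qed

lemma nn_integral_finite_support:
  fixes M :: "'a::euclidean_space measure"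
  assumes M[measurable_cong]: "sets M = sets borel" and G: "finite G" "AE x in M. x \<in> G"
  shows "(\<integral>\<^sup>+x. f x \<partial>M) = (\<Sum>g\<in>G. f g * emeasure M {g})"
proof -
  have "(\<integral>\<^sup>+x. f x \<partial>M) = (\<integral>\<^sup>+x. (\<Sum>g\<in>G. f g * indicator {g} x) \<partial>M)"
  proof (rule nn_integral_cong_AE)
    show "AE x in M. f x = (\<Sum>g\<in>G. f g * indicator {g} x)"
      using G(2) by eventually_elim (use G(1) in \<open>simp add: indicator_def of_bool_def if_distrib cong: if_cong\<close>)
  qed
  also have "\<dots> = (\<Sum>g\<in>G. f g * emeasure M {g})"
    by (subst nn_integral_sum) (auto simp: nn_integral_cmult_indicator M)
  finally show ?thesis .
qed

lemma sum_measure_finite_support: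
  fixes M :: "'a::euclidean_space measure"
  assumes "prob_space M" "sets M = sets borel" "finite G" "AE x in M. x \<in> G"
  shows "(\<Sum>g\<in>G. measure M {g}) = 1"
proof -
  interpret prob_space M by fact
  have "ennreal (\<Sum>g\<in>G. measure M {g}) = ennreal 1"
    using nn_integral_finite_support[OF assms(2-4), of "\<lambda>_. 1"] emeasure_space_1
    by (simp add: emeasure_eq_measure sum_ennreal)
  then show ?thesis by (subst (asm) ennreal_inj) (auto intro: sum_nonneg)
qed

text \<open>The first coordinate is redirected by the matrix \<open>T\<close>, the second is left
  alone. Mass that stays keeps its cost, mass that moves costs at most \<open>B\<close>, and the
  diagonal bound on \<open>T\<close> controls how much moves.\<close>

lemma modified_coupling:
  fixes \<tau> :: "('a::euclidean_space \<times> 'a) measure" and \<sigma> :: "'a measure"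
  assumes \<tau>: "prob_space \<tau>" and \<tau>s[measurable_cong]: "sets \<tau> = sets borel" and \<tau>G: "AE z in \<tau>. fst z \<in> G"
    and \<sigma>: "prob_space \<sigma>" and \<sigma>s[measurable_cong]: "sets \<sigma> = sets borel" and \<sigma>G: "AE g in \<sigma>. g \<in> G"
    and G: "finite G" and B: "0 \<le> B" "AE z in \<tau>. \<forall>g\<in>G. dist g (snd z) powr p \<le> B"
  obtains \<gamma> where "\<gamma> \<in> couplings \<sigma> (distr \<tau> borel snd)"
    "(\<integral>\<^sup>+z. ennreal (dist (fst z) (snd z) powr p) \<partial>\<gamma>)
       \<le> (\<integral>\<^sup>+z. ennreal (dist (fst z) (snd z) powr p) \<partial>\<tau>)
         + ennreal (B * (\<Sum>g\<in>G. \<bar>measure \<sigma> {g} - measure (distr \<tau> borel fst) {g}\<bar>))"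
proof -
  interpret \<tau>: prob_space \<tau> by fact
  interpret \<sigma>: prob_space \<sigma> by fact
  let ?M = "distr \<tau> borel fst"
  interpret M: prob_space ?M by (rule \<tau>.prob_space_distr) measurable
  define \<rho> where "\<rho> g = measure ?M {g}" for g
  define s where "s g = measure \<sigma> {g}" for g
  have MG: "AE x in ?M. x \<in> G"
    using \<tau>G by (subst AE_distr_iff) (use G in \<open>auto intro: borel_closed finite_imp_closed\<close>)
  obtain T where T0: "\<And>g k. 0 \<le> T g k" and Tout: "\<And>g k. g \<notin> G \<or> k \<notin> G \<Longrightarrow> T g k = 0"
    and rows: "\<And>g. g \<in> G \<Longrightarrow> 0 < \<rho> g \<Longrightarrow> (\<Sum>k\<in>G. T g k) = 1"
    and cols: "\<And>k. k \<in> G \<Longrightarrow> (\<Sum>g\<in>G. \<rho> g * T g k) = s k"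
    and diag: "\<And>g. g \<in> G \<Longrightarrow> \<rho> g * (1 - T g g) \<le> \<bar>s g - \<rho> g\<bar>"
    using maximal_coupling_matrix[OF G, of \<rho> s] sum_measure_finite_support[OF \<sigma> \<sigma>s G \<sigma>G]
      sum_measure_finite_support[OF M.prob_space_axioms _ G MG]
    unfolding \<rho>_def s_def by auto
  have fin: "(\<integral>\<^sup>+z. \<phi> (fst z) \<partial>\<tau>) = (\<Sum>g\<in>G. \<phi> g * ennreal (\<rho> g))" if [measurable]: "\<phi> \<in> borel_measurable borel" for \<phi>
    using nn_integral_finite_support[OF _ G MG, of \<phi>] by (simp add: nn_integral_distr M.emeasure_eq_measure \<rho>_def)
  have fin_meas: "\<phi> \<in> borel_measurable borel" if "\<And>g. g \<notin> G \<Longrightarrow> \<phi> g = 0" for \<phi> :: "'a \<Rightarrow> ennreal"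
    by (rule measurable_discrete_difference[where X = G and f = "\<lambda>_. 0"])
       (use that G in \<open>auto intro: countable_finite\<close>)
  \<comment> \<open>The rows of \<open>T\<close> are known to sum to 1 only at charged atoms; almost
    every \<open>z\<close> sits over one.\<close>
  have pos: "AE z in \<tau>. fst z \<in> G \<and> 0 < \<rho> (fst z)"
  proof -
    have "AE x in ?M. \<forall>g\<in>{g\<in>G. \<rho> g = 0}. x \<noteq> g"
    proof (rule AE_finite_allI)
      fix g assume "g \<in> {g \<in> G. \<rho> g = 0}"
      then show "AE x in ?M. x \<noteq> g"
        by (subst AE_iff_measurable[of "{g}"]) (auto simp: \<rho>_def M.emeasure_eq_measure)
    qed (use G in auto)
    then have "AE z in \<tau>. \<forall>g\<in>{g\<in>G. \<rho> g = 0}. fst z \<noteq> g" by (rule AE_distrD[rotated]) measurable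
    with \<tau>G show ?thesis
      by eventually_elim (auto simp: \<rho>_def less_le)
  qed
  \<comment> \<open>Counting measure on \<open>G\<close>, pushed to the Borel sets: the random
    choice of the new first coordinate can then be written as the density \<open>T\<close> on a
    product measure.\<close>
  define \<upsilon> where "\<upsilon> = distr (count_space G) borel (\<lambda>x. x)"
  have \<upsilon>s[measurable_cong]: "sets \<upsilon> = sets borel" by (simp add: \<upsilon>_def)
  interpret \<upsilon>: finite_measure \<upsilon>
    by (rule finite_measureI) (simp add: \<upsilon>_def emeasure_distr G)
  interpret pair_sigma_finite \<upsilon> \<tau> ..
  have n\<upsilon>: "(\<integral>\<^sup>+k. \<phi> k \<partial>\<upsilon>) = (\<Sum>k\<in>G. \<phi> k)" if "\<phi> \<in> borel_measurable borel" for \<phi>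
    unfolding \<upsilon>_def by (subst nn_integral_distr) (use that G in \<open>auto simp: nn_integral_count_space_finite\<close>)
  have T_meas: "case_prod T \<in> borel_measurable borel"
    by (rule measurable_discrete_difference[where X = "G \<times> G" and f = "\<lambda>_. 0"])
       (use Tout G in \<open>auto intro!: countable_finite\<close>)
  have T_meas'[measurable]: "(\<lambda>w :: 'a \<times> 'a \<times> 'a. T (fst (snd w)) (fst w)) \<in> borel_measurable (borel \<Otimes>\<^sub>M borel)"
    using measurable_compose[OF _ T_meas, of "\<lambda>w :: 'a \<times> 'a \<times> 'a. (fst (snd w), fst w)" "borel \<Otimes>\<^sub>M (borel :: ('a \<times> 'a) measure)"]
    by simp
  define \<gamma> where "\<gamma> = distr (density (\<upsilon> \<Otimes>\<^sub>M \<tau>) (\<lambda>w. ennreal (T (fst (snd w)) (fst w)))) borel (\<lambda>w. (fst w, snd (snd w)))"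
  have map_meas[measurable]: "(\<lambda>w. (fst w, snd (snd w))) \<in> borel \<Otimes>\<^sub>M (borel :: ('a \<times> 'a) measure) \<rightarrow>\<^sub>M (borel :: ('a \<times> 'a) measure)"
    by measurable
  have int_\<gamma>: "(\<integral>\<^sup>+z. \<phi> z \<partial>\<gamma>) = (\<integral>\<^sup>+z. (\<Sum>k\<in>G. ennreal (T (fst z) k) * \<phi> (k, snd z)) \<partial>\<tau>)"
    if [measurable]: "\<phi> \<in> borel_measurable borel" for \<phi>
  proof -
    have "(\<integral>\<^sup>+z. \<phi> z \<partial>\<gamma>) = (\<integral>\<^sup>+w. \<phi> (fst w, snd (snd w)) \<partial>density (\<upsilon> \<Otimes>\<^sub>M \<tau>) (\<lambda>w. ennreal (T (fst (snd w)) (fst w))))"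
      unfolding \<gamma>_def by (rule nn_integral_distr) measurable
    also have "\<dots> = (\<integral>\<^sup>+w. ennreal (T (fst (snd w)) (fst w)) * \<phi> (fst w, snd (snd w)) \<partial>(\<upsilon> \<Otimes>\<^sub>M \<tau>))"
      by (rule nn_integral_density) measurable
    also have "\<dots> = (\<integral>\<^sup>+z. \<integral>\<^sup>+k. ennreal (T (fst z) k) * \<phi> (k, snd z) \<partial>\<upsilon> \<partial>\<tau>)"
      by (subst nn_integral_snd[symmetric]) (auto simp: case_prod_beta)
    also have "\<dots> = (\<integral>\<^sup>+z. (\<Sum>k\<in>G. ennreal (T (fst z) k) * \<phi> (k, snd z)) \<partial>\<tau>)"
    proof (intro nn_integral_cong n\<upsilon>)
      fix z :: "'a \<times> 'a"
      have "(\<lambda>k. T (fst z) k) \<in> borel_measurable borel"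
        using measurable_compose[OF _ T_meas, of "\<lambda>k. (fst z, k)" borel] by simp
      then show "(\<lambda>k. ennreal (T (fst z) k) * \<phi> (k, snd z)) \<in> borel_measurable borel" by measurable
    qed
    finally show ?thesis .
  qed
  have row1: "(\<Sum>k\<in>G. ennreal (T g k)) = 1" if "g \<in> G" "0 < \<rho> g" for g
    using rows[OF that] T0 by (simp add: sum_ennreal)
  have \<gamma>s: "sets \<gamma> = sets borel" by (simp add: \<gamma>_def)
  have marg2: "distr \<gamma> borel snd = distr \<tau> borel snd"
  proof (rule measure_eqI)
    fix A assume "A \<in> sets (distr \<gamma> borel snd)"
    then have A[measurable]: "A \<in> sets borel" by simp
    have "emeasure (distr \<gamma> borel snd) A = (\<integral>\<^sup>+z. indicator A (snd z) \<partial>\<gamma>)"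
      using nn_integral_distr[of snd \<gamma> borel "indicator A"] by (simp add: measurable_cong_sets[OF \<gamma>s])
    also have "\<dots> = (\<integral>\<^sup>+z. (\<Sum>k\<in>G. ennreal (T (fst z) k) * indicator A (snd z)) \<partial>\<tau>)"
      by (subst int_\<gamma>) auto
    also have "\<dots> = (\<integral>\<^sup>+z. indicator A (snd z) \<partial>\<tau>)"
    proof (rule nn_integral_cong_AE)
      show "AE z in \<tau>. (\<Sum>k\<in>G. ennreal (T (fst z) k) * indicator A (snd z)) = indicator A (snd z)"
        using pos by eventually_elim (simp add: row1 flip: sum_distrib_right)
    qed
    also have "\<dots> = emeasure (distr \<tau> borel snd) A"
      using nn_integral_distr[of snd \<tau> borel "indicator A"] by simp
    finally show "emeasure (distr \<gamma> borel snd) A = emeasure (distr \<tau> borel snd) A" .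
  qed simp
  have marg1: "distr \<gamma> borel fst = \<sigma>"
  proof (rule measure_eqI)
    fix A assume "A \<in> sets (distr \<gamma> borel fst)"
    then have A[measurable]: "A \<in> sets borel" by simp
    have "emeasure (distr \<gamma> borel fst) A = (\<integral>\<^sup>+z. indicator A (fst z) \<partial>\<gamma>)"
      using nn_integral_distr[of fst \<gamma> borel "indicator A"] by (simp add: measurable_cong_sets[OF \<gamma>s])
    also have "\<dots> = (\<integral>\<^sup>+z. (\<Sum>k\<in>G. ennreal (T (fst z) k) * indicator A k) \<partial>\<tau>)"
      by (subst int_\<gamma>) auto
    also have "\<dots> = (\<Sum>g\<in>G. (\<Sum>k\<in>G. ennreal (T g k) * indicator A k) * ennreal (\<rho> g))"
      by (rule fin[OF fin_meas]) (simp add: Tout)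
    also have "\<dots> = (\<Sum>g\<in>G. \<Sum>k\<in>G. ennreal (\<rho> g * T g k) * indicator A k)"
      unfolding sum_distrib_right using T0 by (intro sum.cong refl) (simp add: ennreal_mult \<rho>_def mult_ac)
    also have "\<dots> = (\<Sum>k\<in>G. \<Sum>g\<in>G. ennreal (\<rho> g * T g k) * indicator A k)" by (rule sum.swap)
    also have "\<dots> = (\<Sum>k\<in>G. indicator A k * emeasure \<sigma> {k})"
    proof (intro sum.cong refl)
      fix k assume k: "k \<in> G"
      have "(\<Sum>g\<in>G. ennreal (\<rho> g * T g k)) = ennreal (s k)"
        using T0 cols[OF k] by (simp add: sum_ennreal \<rho>_def)
      then show "(\<Sum>g\<in>G. ennreal (\<rho> g * T g k) * indicator A k) = indicator A k * emeasure \<sigma> {k}"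
        unfolding sum_distrib_right[symmetric] by (simp add: s_def \<sigma>.emeasure_eq_measure mult.commute)
    qed
    also have "\<dots> = emeasure \<sigma> A"
      using nn_integral_finite_support[OF \<sigma>s G \<sigma>G, of "indicator A"] by (simp add: \<sigma>s)
    finally show "emeasure (distr \<gamma> borel fst) A = emeasure \<sigma> A" .
  qed (simp add: \<sigma>s)
  \<comment> \<open>Bound on the additional cost caused by mass leaving \<open>g\<close>; its sum
    against \<open>\<rho>\<close> is what \<open>diag\<close> estimates.\<close>
  define \<psi> where "\<psi> g = (if g \<in> G then ennreal (B * (1 - T g g)) else 0)" for g
  have \<psi>_meas[measurable]: "\<psi> \<in> borel_measurable borel" by (rule fin_meas) (simp add: \<psi>_def)
  have "(\<integral>\<^sup>+z. ennreal (dist (fst z) (snd z) powr p) \<partial>\<gamma>)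
      = (\<integral>\<^sup>+z. (\<Sum>k\<in>G. ennreal (T (fst z) k) * ennreal (dist k (snd z) powr p)) \<partial>\<tau>)"
    by (subst int_\<gamma>) auto
  also have "\<dots> \<le> (\<integral>\<^sup>+z. ennreal (dist (fst z) (snd z) powr p) + \<psi> (fst z) \<partial>\<tau>)"
  proof (rule nn_integral_mono_AE)
    show "AE z in \<tau>. (\<Sum>k\<in>G. ennreal (T (fst z) k) * ennreal (dist k (snd z) powr p))
        \<le> ennreal (dist (fst z) (snd z) powr p) + \<psi> (fst z)"
      using pos B(2)
    proof eventually_elim
      case (elim z)
      let ?g = "fst z" and ?c = "\<lambda>k. dist k (snd z) powr p"
      have g: "?g \<in> G" "0 < \<rho> ?g" using elim by auto
      have sum_split: "(\<Sum>k\<in>G. T ?g k * \<phi> k) = T ?g ?g * \<phi> ?g + (\<Sum>k\<in>G - {?g}. T ?g k * \<phi> k)" for \<phi>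
        by (rule sum.remove[OF G g(1)])
      have rest: "(\<Sum>k\<in>G - {?g}. T ?g k) = 1 - T ?g ?g"
        using rows[OF g] sum_split[of "\<lambda>_. 1"] by simp
      have T1: "T ?g ?g \<le> 1" using rest sum_nonneg[of "G - {?g}" "T ?g"] T0 by simp
      have "(\<Sum>k\<in>G. T ?g k * ?c k) \<le> 1 * ?c ?g + (\<Sum>k\<in>G - {?g}. T ?g k * B)"
        unfolding sum_split using T0 T1 elim by (intro add_mono mult_right_mono sum_mono mult_left_mono) auto
      also have "\<dots> = ?c ?g + B * (1 - T ?g ?g)"
        unfolding sum_distrib_right[symmetric] rest by (simp add: mult.commute)
      finally have "ennreal (\<Sum>k\<in>G. T ?g k * ?c k) \<le> ennreal (?c ?g + B * (1 - T ?g ?g))"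
        by (rule ennreal_leI)
      then show ?case
        using T0 T1 B(1) g by (simp add: \<psi>_def sum_ennreal flip: ennreal_mult ennreal_plus)
    qed
  qed
  also have "\<dots> = (\<integral>\<^sup>+z. ennreal (dist (fst z) (snd z) powr p) \<partial>\<tau>) + (\<integral>\<^sup>+z. \<psi> (fst z) \<partial>\<tau>)"
    by (rule nn_integral_add) measurable
  also have "(\<integral>\<^sup>+z. \<psi> (fst z) \<partial>\<tau>) = (\<Sum>g\<in>G. \<psi> g * ennreal (\<rho> g))" by (rule fin) measurable
  also have "\<dots> \<le> (\<Sum>g\<in>G. ennreal (B * \<bar>s g - \<rho> g\<bar>))"
  proof (rule sum_mono)
    fix g assume g: "g \<in> G"
    have "\<psi> g * ennreal (\<rho> g) = ennreal (B * (1 - T g g) * \<rho> g)"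
      using g by (simp add: \<psi>_def \<rho>_def ennreal_mult'')
    also have "\<dots> \<le> ennreal (B * \<bar>s g - \<rho> g\<bar>)"
      using mult_left_mono[OF diag[OF g] B(1)] by (intro ennreal_leI) (simp add: mult_ac)
    finally show "\<psi> g * ennreal (\<rho> g) \<le> ennreal (B * \<bar>s g - \<rho> g\<bar>)" .
  qed
  also have "\<dots> = ennreal (B * (\<Sum>g\<in>G. \<bar>s g - \<rho> g\<bar>))"
    using B(1) by (simp add: sum_ennreal sum_distrib_left)
  finally have cost: "(\<integral>\<^sup>+z. ennreal (dist (fst z) (snd z) powr p) \<partial>\<gamma>)
       \<le> (\<integral>\<^sup>+z. ennreal (dist (fst z) (snd z) powr p) \<partial>\<tau>) + ennreal (B * (\<Sum>g\<in>G. \<bar>s g - \<rho> g\<bar>))"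
    by (simp add: add_left_mono)
  show thesis
    by (rule that[of \<gamma>]) (use \<gamma>s marg1 marg2 cost in \<open>auto simp: couplings_def s_def \<rho>_def\<close>)
qed

section \<open>Convergence of cell averages\<close>

text \<open>Inner regularity replaces \<open>A\<close> by a compact \<open>K\<close>, and the
  truncated cones \<open>max 0 (1 - n * infdist x K)\<close> tend to the indicator of
  \<open>K\<close>. Lipschitz rather than continuous functions are wanted because they turn the
  displacement of \<open>x\<close> to its codepoint into an explicit error.\<close>

lemma lipschitz_approximation_indicator:
  fixes M :: "'a::euclidean_space measure" and A :: "'a set"
  assumes M: "prob_space M" "sets M = sets borel" and A: "A \<in> sets M" and e: "0 < e"
  shows "\<exists>g L. L-lipschitz_on UNIV g \<and> integrable M g \<and> (\<integral>x. \<bar>indicat_real A x - g x\<bar> \<partial>M) < e"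
proof -
  interpret prob_space M by fact
  note [measurable_cong] = M(2)
  have [measurable]: "A \<in> sets borel" using A M by simp
  have "\<exists>K\<in>{K. K \<subseteq> A \<and> compact K}. emeasure M A < emeasure M K + ennreal (e / 2)"
  proof (rule SUP_approx_ennreal)
    show "emeasure M A = (SUP K\<in>{K. K \<subseteq> A \<and> compact K}. emeasure M K)"
      by (rule inner_regular) (use A M in \<open>auto simp: emeasure_eq_measure\<close>)
  qed (use e in auto)
  then obtain K where K: "K \<subseteq> A" "compact K" and KA: "emeasure M A < emeasure M K + ennreal (e / 2)" by auto
  have [measurable]: "K \<in> sets borel" using K(2) by (simp add: borel_compact)
  have "ennreal (measure M A) < ennreal (measure M K + e / 2)"
    using KA e by (simp add: emeasure_eq_measure)
  then have diff: "measure M A - measure M K < e / 2" by (simp add: ennreal_less_iff)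
  have AK: "(\<integral>x. \<bar>indicat_real A x - indicat_real K x\<bar> \<partial>M) < e / 2"
  proof -
    have "(\<integral>x. \<bar>indicat_real A x - indicat_real K x\<bar> \<partial>M) = (\<integral>x. indicat_real A x - indicat_real K x \<partial>M)"
      using K(1) by (intro Bochner_Integration.integral_cong) (auto split: split_indicator)
    also have "\<dots> = measure M A - measure M K"
      using sets_eq_imp_space_eq[OF M(2)] by (subst Bochner_Integration.integral_diff) (auto simp: emeasure_eq_measure M)
    finally show ?thesis using diff by simp
  qed
  show ?thesis
  \<comment> \<open>The distance to the empty set is 0 by convention, so the cones over an empty
    \<open>K\<close> would be 1 instead of 0.\<close>
  proof (cases "K = {}")
    case True
    then show ?thesis using AK e by (intro exI[of _ "\<lambda>_. 0"] exI[of _ 0]) (auto simp: lipschitz_on_def)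
  next
    case False
    define g where "g n x = max 0 (1 - real n * infdist x K)" for n :: nat and x
    have [measurable]: "g n \<in> borel_measurable borel" for n
      unfolding g_def by (intro borel_measurable_continuous_onI continuous_intros)
    have g01: "0 \<le> g n x" "g n x \<le> 1" for n x by (auto simp: g_def infdist_nonneg)
    have gi: "integrable M (g n)" for n
      using g01 by (intro integrable_const_bound[where B = 1]) auto
    have "(\<lambda>n. \<integral>x. \<bar>indicat_real K x - g n x\<bar> \<partial>M) \<longlonglongrightarrow> (\<integral>x. 0 \<partial>M)"
    proof (rule integral_dominated_convergence[where w = "\<lambda>_. 1"])
      show "AE x in M. (\<lambda>n. \<bar>indicat_real K x - g n x\<bar>) \<longlonglongrightarrow> 0"
      proof (rule AE_I2)
        fix x
        show "(\<lambda>n. \<bar>indicat_real K x - g n x\<bar>) \<longlonglongrightarrow> 0"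
        proof (cases "x \<in> K")
          case True
          then show ?thesis by (simp add: g_def)
        next
          case False
          then have pos: "0 < infdist x K"
            using K(2) \<open>K \<noteq> {}\<close> by (intro infdist_pos_not_in_closed compact_imp_closed)
          have "eventually (\<lambda>n. 1 / infdist x K \<le> real n) sequentially"
            using filterlim_real_sequentially by (simp add: filterlim_at_top)
          then have "eventually (\<lambda>n. \<bar>indicat_real K x - g n x\<bar> = 0) sequentially"
            by eventually_elim (use False pos in \<open>auto simp: g_def field_simps\<close>)
          then show ?thesis by (rule tendsto_eventually)
        qed
      qed
      show "AE x in M. norm \<bar>indicat_real K x - g n x\<bar> \<le> 1" for n
      proof (rule AE_I2)
        fix x show "norm \<bar>indicat_real K x - g n x\<bar> \<le> 1"
          using g01[of n x] by (auto split: split_indicator)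
      qed
    qed auto
    then have "eventually (\<lambda>n. (\<integral>x. \<bar>indicat_real K x - g n x\<bar> \<partial>M) < e / 2) sequentially"
      using e by (intro order_tendstoD(2)) auto
    then obtain n where n: "(\<integral>x. \<bar>indicat_real K x - g n x\<bar> \<partial>M) < e / 2"
      by (auto simp: eventually_sequentially)
    have lip: "(real n)-lipschitz_on UNIV (g n)"
    proof (rule lipschitz_onI)
      fix x y :: 'a
      have "dist (g n x) (g n y) \<le> real n * \<bar>infdist x K - infdist y K\<bar>"
      proof -
        have "\<bar>g n x - g n y\<bar> \<le> \<bar>real n * infdist x K - real n * infdist y K\<bar>"
          unfolding g_def by (auto simp: max_def)
        also have "\<dots> = real n * \<bar>infdist x K - infdist y K\<bar>"
          by (simp add: abs_mult flip: right_diff_distrib)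
        finally show ?thesis by (simp add: dist_real_def)
      qed
      also have "\<dots> \<le> real n * dist x y" by (intro mult_left_mono infdist_triangle_abs) auto
      finally show "dist (g n x) (g n y) \<le> real n * dist x y" .
    qed auto
    have ii: "integrable M (indicat_real K)" "integrable M (indicat_real A)"
      by (auto simp: emeasure_eq_measure M)
    have "(\<integral>x. \<bar>indicat_real A x - g n x\<bar> \<partial>M)
        \<le> (\<integral>x. \<bar>indicat_real A x - indicat_real K x\<bar> + \<bar>indicat_real K x - g n x\<bar> \<partial>M)"
      using gi ii by (intro integral_mono) auto
    also have "\<dots> = (\<integral>x. \<bar>indicat_real A x - indicat_real K x\<bar> \<partial>M) + (\<integral>x. \<bar>indicat_real K x - g n x\<bar> \<partial>M)"
      using gi ii by (intro Bochner_Integration.integral_add) auto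
    also have "\<dots> < e" using n AK by simp
    finally show ?thesis using lip gi by blast
  qed
qed

lemma lipschitz_approximation:
  fixes M :: "'a::euclidean_space measure" and f :: "'a \<Rightarrow> real"
  assumes M: "prob_space M" "sets M = sets borel" and f: "integrable M f" and e: "0 < e"
  shows "\<exists>g L. L-lipschitz_on UNIV g \<and> integrable M g \<and> (\<integral>x. \<bar>f x - g x\<bar> \<partial>M) < e"
proof -
  interpret prob_space M by fact
  show ?thesis using f e
  proof (induction arbitrary: e rule: integrable_induct)
    case (base A c)
    \<comment> \<open>The denominator \<open>|c| + 1\<close> covers \<open>c = 0\<close> and makes
      the final inequality strict.\<close>
    obtain g L where g: "L-lipschitz_on UNIV g" "integrable M g"
      "(\<integral>x. \<bar>indicat_real A x - g x\<bar> \<partial>M) < e / (\<bar>c\<bar> + 1)"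
      using lipschitz_approximation_indicator[OF M base(1), of "e / (\<bar>c\<bar> + 1)"] base by auto
    have "(\<integral>x. \<bar>indicator A x *\<^sub>R c - c * g x\<bar> \<partial>M) = (\<integral>x. \<bar>c\<bar> * \<bar>indicat_real A x - g x\<bar> \<partial>M)"
      by (simp add: mult.commute flip: abs_mult right_diff_distrib)
    also have "\<dots> = \<bar>c\<bar> * (\<integral>x. \<bar>indicat_real A x - g x\<bar> \<partial>M)" by simp
    also have "\<dots> \<le> \<bar>c\<bar> * (e / (\<bar>c\<bar> + 1))" using g(3) by (intro mult_left_mono) auto
    also have "\<dots> < e" using base by (simp add: field_simps)
    finally have "(\<integral>x. \<bar>indicator A x *\<^sub>R c - c * g x\<bar> \<partial>M) < e" .
    moreover have "(\<bar>c\<bar> * L)-lipschitz_on UNIV (\<lambda>x. c * g x)"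
      using lipschitz_on_cmult_real[OF g(1), of c] by simp
    ultimately show ?case using g(2) by (intro exI[of _ "\<lambda>x. c * g x"] exI[of _ "\<bar>c\<bar> * L"]) auto
  next
    case (add f1 f2)
    obtain g1 L1 where 1: "L1-lipschitz_on UNIV g1" "integrable M g1" "(\<integral>x. \<bar>f1 x - g1 x\<bar> \<partial>M) < e / 2"
      using add.IH(1)[of "e / 2"] add.prems by auto
    obtain g2 L2 where 2: "L2-lipschitz_on UNIV g2" "integrable M g2" "(\<integral>x. \<bar>f2 x - g2 x\<bar> \<partial>M) < e / 2"
      using add.IH(2)[of "e / 2"] add.prems by auto
    have "(\<integral>x. \<bar>(f1 x + f2 x) - (g1 x + g2 x)\<bar> \<partial>M) \<le> (\<integral>x. \<bar>f1 x - g1 x\<bar> + \<bar>f2 x - g2 x\<bar> \<partial>M)"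
      using add.hyps 1 2 by (intro integral_mono) auto
    also have "\<dots> = (\<integral>x. \<bar>f1 x - g1 x\<bar> \<partial>M) + (\<integral>x. \<bar>f2 x - g2 x\<bar> \<partial>M)"
      using add.hyps 1 2 by (intro Bochner_Integration.integral_add) auto
    also have "\<dots> < e" using 1(3) 2(3) by simp
    finally show ?case using lipschitz_on_add[OF 1(1) 2(1)] 1(2) 2(2)
      by (intro exI[of _ "\<lambda>x. g1 x + g2 x"] exI[of _ "L1 + L2"]) auto
  next
    case (lim f s)
    \<comment> \<open>The approximants satisfy \<open>|s i x| \<le> 2 * |f x|\<close>, whence the
      majorant \<open>3 * |f x|\<close>.\<close>
    have "(\<lambda>i. \<integral>x. \<bar>f x - s i x\<bar> \<partial>M) \<longlonglongrightarrow> (\<integral>x. 0 \<partial>M)"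
    proof (rule integral_dominated_convergence[where w = "\<lambda>x. 3 * \<bar>f x\<bar>"])
      show "AE x in M. (\<lambda>i. \<bar>f x - s i x\<bar>) \<longlonglongrightarrow> 0"
      proof (rule AE_I2)
        fix x assume "x \<in> space M"
        then have "(\<lambda>i. \<bar>f x - s i x\<bar>) \<longlonglongrightarrow> \<bar>f x - f x\<bar>" by (intro tendsto_intros lim.hyps)
        then show "(\<lambda>i. \<bar>f x - s i x\<bar>) \<longlonglongrightarrow> 0" by simp
      qed
      show "AE x in M. norm \<bar>f x - s i x\<bar> \<le> 3 * \<bar>f x\<bar>" for i
      proof (rule AE_I2)
        fix x assume "x \<in> space M"
        then have "\<bar>s i x\<bar> \<le> 2 * \<bar>f x\<bar>" using lim.hyps(3)[of x i] by simp
        then show "norm \<bar>f x - s i x\<bar> \<le> 3 * \<bar>f x\<bar>" by simp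
      qed
    qed (use lim.hyps in auto)
    then have "eventually (\<lambda>i. (\<integral>x. \<bar>f x - s i x\<bar> \<partial>M) < e / 2) sequentially"
      using lim.prems by (intro order_tendstoD(2)) auto
    then obtain i where i: "(\<integral>x. \<bar>f x - s i x\<bar> \<partial>M) < e / 2" by (auto simp: eventually_sequentially)
    obtain g L where g: "L-lipschitz_on UNIV g" "integrable M g" "(\<integral>x. \<bar>s i x - g x\<bar> \<partial>M) < e / 2"
      using lim.IH[of "e / 2" i] lim.prems by auto
    have "(\<integral>x. \<bar>f x - g x\<bar> \<partial>M) \<le> (\<integral>x. \<bar>f x - s i x\<bar> + \<bar>s i x - g x\<bar> \<partial>M)"
      using lim.hyps g by (intro integral_mono) auto
    also have "\<dots> = (\<integral>x. \<bar>f x - s i x\<bar> \<partial>M) + (\<integral>x. \<bar>s i x - g x\<bar> \<partial>M)"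
      using lim.hyps g by (intro Bochner_Integration.integral_add) auto
    also have "\<dots> < e" using i g(3) by simp
    finally show ?case using g by blast
  qed
qed

context optimal_quantizer
begin

text \<open>Conditional expectation of \<open>f\<close> given the cell, with value 0 on null cells
  through division by zero.\<close>

definition cell_average :: "('a \<Rightarrow> real) \<Rightarrow> 'a \<Rightarrow> real" where
  "cell_average f a = (\<integral>x. indicat_real {x. pr x = a} x * f x \<partial>\<mu>) / cell_mass a"

lemma cell_average_pr:
  "cell_average f (pr x) = (\<Sum>a\<in>\<Gamma>. indicat_real {x. pr x = a} x * cell_average f a)"
proof -
  have "(\<Sum>a\<in>\<Gamma>. indicat_real {x. pr x = a} x * cell_average f a) = (\<Sum>a\<in>\<Gamma>. if a = pr x then cell_average f (pr x) else 0)"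
    by (intro sum.cong) auto
  then show ?thesis using finite_codebook pr_in by simp
qed

lemma measurable_cell_average [measurable]: "(\<lambda>x. cell_average f (pr x)) \<in> borel_measurable borel"
  unfolding cell_average_pr by measurable

lemma integrable_cell_average: "integrable \<mu> (\<lambda>x. cell_average f (pr x))"
proof (rule integrable_bounded_on_cball)
  show "norm (cell_average f (pr x)) \<le> (\<Sum>a\<in>\<Gamma>. norm (cell_average f a))" for x
    using finite_codebook pr_in by (intro member_le_sum) auto
qed measurable

text \<open>Up to the factor 2, the average is the best \<open>L1\<close> approximation among
  functions of the cell: its deviation from \<open>h a\<close>, weighted by the mass, is at most the
  \<open>L1\<close> error of \<open>h a\<close> on that cell.\<close>

lemma cell_average_L1:
  assumes f: "integrable \<mu> f"
  shows "(\<integral>x. \<bar>cell_average f (pr x) - f x\<bar> \<partial>\<mu>) \<le> 2 * (\<integral>x. \<bar>f x - h (pr x)\<bar> \<partial>\<mu>)"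
proof -
  let ?I = "\<lambda>a. indicat_real {x. pr x = a}"
  have [measurable]: "{x. pr x = a} \<in> sets \<mu>" for a by (simp add: sets_law)
  have Ii: "integrable \<mu> (\<lambda>x. ?I a x * c)" for a c
    by (auto simp: emeasure_eq_measure)
  have If: "integrable \<mu> (\<lambda>x. ?I a x * f x)" for a
    using integrable_mult_indicator[OF _ f, of "{x. pr x = a}"] by simp
  have If': "integrable \<mu> (\<lambda>x. ?I a x * (f x - c))" for a c
    using If Ii by (simp add: right_diff_distrib)
  have Ia: "integrable \<mu> (\<lambda>x. ?I a x * \<bar>f x - c\<bar>)" for a c
    using integrable_abs[OF If'[of a c]] by (simp add: abs_mult)
  have decomp: "(\<integral>x. \<phi> (pr x) x \<partial>\<mu>) = (\<Sum>a\<in>\<Gamma>. \<integral>x. ?I a x * \<phi> a x \<partial>\<mu>)"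
    if "\<And>a. integrable \<mu> (\<lambda>x. ?I a x * \<phi> a x)" for \<phi> :: "'a \<Rightarrow> 'a \<Rightarrow> real"
  proof -
    have "(\<Sum>a\<in>\<Gamma>. \<integral>x. ?I a x * \<phi> a x \<partial>\<mu>) = (\<integral>x. (\<Sum>a\<in>\<Gamma>. ?I a x * \<phi> a x) \<partial>\<mu>)"
      by (rule Bochner_Integration.integral_sum[symmetric]) (rule that)
    also have "(\<lambda>x. \<Sum>a\<in>\<Gamma>. ?I a x * \<phi> a x) = (\<lambda>x. \<phi> (pr x) x)"
    proof
      fix x
      have "(\<Sum>a\<in>\<Gamma>. ?I a x * \<phi> a x) = (\<Sum>a\<in>\<Gamma>. if a = pr x then \<phi> (pr x) x else 0)"
        by (intro sum.cong) auto
      then show "(\<Sum>a\<in>\<Gamma>. ?I a x * \<phi> a x) = \<phi> (pr x) x" using finite_codebook pr_in by simp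
    qed
    finally show ?thesis ..
  qed
  have cell: "(\<integral>x. ?I a x * \<bar>f x - cell_average f a\<bar> \<partial>\<mu>) \<le> 2 * (\<integral>x. ?I a x * \<bar>f x - h a\<bar> \<partial>\<mu>)" for a
  proof -
    let ?c = "cell_average f a"
    have avg: "cell_mass a * ?c = (\<integral>x. ?I a x * f x \<partial>\<mu>)"
    proof (cases "cell_mass a = 0")
      case True
      then have "AE x in \<mu>. pr x \<noteq> a"
        by (subst AE_iff_measurable[of "{x. pr x = a}"]) (auto simp: cell_mass_def emeasure_eq_measure)
      then have "AE x in \<mu>. ?I a x * f x = 0" by eventually_elim simp
      then have "(\<integral>x. ?I a x * f x \<partial>\<mu>) = 0" by (rule integral_eq_zero_AE)
      then show ?thesis using True by simp
    qed (simp add: cell_average_def)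
    have "(\<integral>x. ?I a x * \<bar>f x - ?c\<bar> \<partial>\<mu>) \<le> (\<integral>x. ?I a x * \<bar>?c - h a\<bar> + ?I a x * \<bar>f x - h a\<bar> \<partial>\<mu>)"
      using Ia Ii by (intro integral_mono Bochner_Integration.integrable_add) (auto split: split_indicator)
    also have "\<dots> = cell_mass a * \<bar>?c - h a\<bar> + (\<integral>x. ?I a x * \<bar>f x - h a\<bar> \<partial>\<mu>)"
      using Ia Ii by (subst Bochner_Integration.integral_add) (auto simp: cell_mass_def)
    also have "cell_mass a * \<bar>?c - h a\<bar> = \<bar>\<integral>x. ?I a x * (f x - h a) \<partial>\<mu>\<bar>"
    proof -
      have "cell_mass a * \<bar>?c - h a\<bar> = \<bar>cell_mass a * ?c - cell_mass a * h a\<bar>"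
        by (simp add: abs_mult cell_mass_def flip: right_diff_distrib)
      also have "cell_mass a * ?c - cell_mass a * h a = (\<integral>x. ?I a x * f x - ?I a x * h a \<partial>\<mu>)"
        unfolding avg using If Ii[of a "h a"]
        by (subst Bochner_Integration.integral_diff) (auto simp: cell_mass_def)
      finally show ?thesis by (simp add: right_diff_distrib)
    qed
    also have "\<dots> \<le> (\<integral>x. \<bar>?I a x * (f x - h a)\<bar> \<partial>\<mu>)" by (rule integral_abs_bound)
    also have "\<dots> = (\<integral>x. ?I a x * \<bar>f x - h a\<bar> \<partial>\<mu>)" by (simp add: abs_mult)
    finally show ?thesis by simp
  qed
  have "(\<integral>x. \<bar>cell_average f (pr x) - f x\<bar> \<partial>\<mu>) = (\<integral>x. \<bar>f x - cell_average f (pr x)\<bar> \<partial>\<mu>)"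
    by (simp add: abs_minus_commute)
  also have "\<dots> = (\<Sum>a\<in>\<Gamma>. \<integral>x. ?I a x * \<bar>f x - cell_average f a\<bar> \<partial>\<mu>)"
    by (rule decomp[of "\<lambda>a x. \<bar>f x - cell_average f a\<bar>"]) (rule Ia)
  also have "\<dots> \<le> (\<Sum>a\<in>\<Gamma>. 2 * (\<integral>x. ?I a x * \<bar>f x - h a\<bar> \<partial>\<mu>))" by (rule sum_mono) (rule cell)
  also have "\<dots> = 2 * (\<integral>x. \<bar>f x - h (pr x)\<bar> \<partial>\<mu>)"
    unfolding sum_distrib_left[symmetric] by (subst decomp[of "\<lambda>a x. \<bar>f x - h a\<bar>"]) (auto intro: Ia)
  finally show ?thesis .
qed

text \<open>The competitor in \<open>cell_average_L1\<close> is \<open>g\<close> itself, evaluated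
  at the codepoint. With \<open>g\<close> fixed, the second term vanishes as the quantization
  improves, and the first is as small as the choice of \<open>g\<close> makes it.\<close>

lemma cell_average_L1_lipschitz:
  assumes f: "integrable \<mu> f" and g: "L-lipschitz_on UNIV g" "integrable \<mu> g"
  shows "(\<integral>x. \<bar>cell_average f (pr x) - f x\<bar> \<partial>\<mu>) \<le> 2 * (\<integral>x. \<bar>f x - g x\<bar> \<partial>\<mu>) + 2 * L * (\<integral>x. infdist x \<Gamma> \<partial>\<mu>)"
proof -
  have [measurable]: "g \<in> borel_measurable borel"
    by (intro borel_measurable_continuous_onI lipschitz_on_continuous_on[OF g(1)])
  have [measurable]: "f \<in> borel_measurable \<mu>" using f by simp
  have id: "integrable \<mu> (\<lambda>x. infdist x \<Gamma>)"
    using integrable_infdist_power[OF codebook_nonempty, of 1] by simp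
  have pt: "\<bar>f x - g (pr x)\<bar> \<le> \<bar>f x - g x\<bar> + L * infdist x \<Gamma>" for x
    using lipschitz_onD[OF g(1), of x "pr x"] by (simp add: infdist_pr dist_real_def)
  have int: "integrable \<mu> (\<lambda>x. \<bar>f x - g x\<bar> + L * infdist x \<Gamma>)" using f g id by auto
  have int2: "integrable \<mu> (\<lambda>x. \<bar>f x - g (pr x)\<bar>)"
    by (rule Bochner_Integration.integrable_bound[OF int]) (use pt in \<open>auto intro!: AE_I2 order_trans[OF pt]\<close>)
  have "(\<integral>x. \<bar>cell_average f (pr x) - f x\<bar> \<partial>\<mu>) \<le> 2 * (\<integral>x. \<bar>f x - g (pr x)\<bar> \<partial>\<mu>)"
    by (rule cell_average_L1[OF f])
  also have "\<dots> \<le> 2 * (\<integral>x. \<bar>f x - g x\<bar> + L * infdist x \<Gamma> \<partial>\<mu>)"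
    using int int2 pt by (intro mult_left_mono integral_mono) auto
  also have "\<dots> = 2 * (\<integral>x. \<bar>f x - g x\<bar> \<partial>\<mu>) + 2 * L * (\<integral>x. infdist x \<Gamma> \<partial>\<mu>)"
    using f g id by simp
  finally show ?thesis .
qed

end

section \<open>The quantized martingale coupling\<close>

lemma measure_eqI_nn_integral:
  assumes "sets M = sets borel" "sets N = sets borel"
    and "\<And>A. A \<in> sets borel \<Longrightarrow> (\<integral>\<^sup>+x. indicator A x \<partial>M) = (\<integral>\<^sup>+x. indicator A x \<partial>N)"
  shows "M = N"
  by (rule measure_eqI) (use assms in simp_all)

lemma prob_space_pair_unifU:
  assumes "prob_space M"
  shows "prob_space (M \<Otimes>\<^sub>M unifU)"
proof -
  interpret M: prob_space M by fact
  interpret U: prob_space unifU by (rule prob_space_unifU)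
  interpret pair_prob_space M unifU ..
  show ?thesis by (rule P.prob_space_axioms)
qed

text \<open>With \<open>s = a^2 + b^2\<close> the quotients \<open>a^2 / s\<close> and
  \<open>b^2 / s\<close> lie in \<open>[0, 1]\<close> and add up to 1; raising them to the power
  \<open>q / 2 \<le> 1\<close> can only increase them.\<close>

lemma sqrt_sum_squares_powr_le:
  fixes a b q :: real
  assumes "0 \<le> a" "0 \<le> b" "0 < q" "q \<le> 2"
  shows "sqrt (a\<^sup>2 + b\<^sup>2) powr q \<le> a powr q + b powr q"
proof (cases "a\<^sup>2 + b\<^sup>2 = 0")
  case False
  define s where "s = a\<^sup>2 + b\<^sup>2"
  have s: "0 < s" using False by (simp add: s_def less_le)
  have *: "c\<^sup>2 / s * sqrt s powr q \<le> c powr q" if c: "0 \<le> c" "c\<^sup>2 \<le> s" for c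
  proof (cases "c = 0")
    case False
    have "c\<^sup>2 / s \<le> (c\<^sup>2 / s) powr (q / 2)"
      using powr_mono'[of "q / 2" 1 "c\<^sup>2 / s"] c s assms by (simp add: divide_le_eq)
    also have "\<dots> = c powr q / sqrt s powr q"
      using c s False by (simp add: powr_divide powr_half_sqrt[symmetric] powr_powr flip: powr_numeral)
    finally show ?thesis using s by (simp add: field_simps)
  qed (use assms in auto)
  have "sqrt s powr q = a\<^sup>2 / s * sqrt s powr q + b\<^sup>2 / s * sqrt s powr q"
    using s by (simp add: s_def flip: distrib_right add_divide_distrib)
  also have "\<dots> \<le> a powr q + b powr q" using assms by (intro add_mono *) (auto simp: s_def)
  finally show ?thesis by (simp add: s_def)
qed (use assms in auto)

text \<open>Midpoint convexity of the power \<open>q / 2 \<ge> 1\<close> at \<open>a^2\<close> and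
  \<open>b^2\<close>. For \<open>q = p\<close> this is the factor in the bound for
  \<open>p > 2\<close>.\<close>

lemma sqrt_sum_squares_powr_le':
  fixes a b q :: real
  assumes "0 \<le> a" "0 \<le> b" "2 \<le> q"
  shows "sqrt (a\<^sup>2 + b\<^sup>2) powr q \<le> 2 powr ((q - 2) / 2) * (a powr q + b powr q)"
proof (cases "a = 0 \<or> b = 0")
  \<comment> \<open>Convexity is applied on the open half-line, so zero arguments are treated
    apart.\<close>
  case True
  have "1 \<le> 2 powr ((q - 2) / 2)" using assms by (simp add: ge_one_powr_ge_zero)
  then have "c \<le> 2 powr ((q - 2) / 2) * c" if "0 \<le> c" for c :: real
    using mult_right_mono[of 1 "2 powr ((q - 2) / 2)" c] that by simp
  from this[of "a powr q"] this[of "b powr q"] show ?thesis using True assms by (elim disjE) simp_all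
next
  case False
  define A B \<theta> where "A = a\<^sup>2" and "B = b\<^sup>2" and "\<theta> = q / 2"
  have pos: "0 < A" "0 < B" "1 \<le> \<theta>" using False assms by (auto simp: A_def B_def \<theta>_def)
  have "((1 - 1/2) *\<^sub>R A + (1/2) *\<^sub>R B) powr \<theta> \<le> (1 - 1/2) * A powr \<theta> + 1/2 * B powr \<theta>"
    using powr_convex[OF pos(3)] pos by (intro convex_onD[where A = "{0<..}"]) auto
  then have "((A + B) / 2) powr \<theta> \<le> (A powr \<theta> + B powr \<theta>) / 2" by (simp add: add_divide_distrib)
  then have "(A + B) powr \<theta> \<le> 2 powr \<theta> * ((A powr \<theta> + B powr \<theta>) / 2)"
    using pos by (simp add: powr_divide field_simps)
  also have "\<dots> = 2 powr (\<theta> - 1) * (A powr \<theta> + B powr \<theta>)" by (simp add: powr_diff)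
  also have "A powr \<theta> = a powr q" using False assms by (simp add: A_def \<theta>_def powr_powr flip: powr_numeral)
  also have "B powr \<theta> = b powr q" using False assms by (simp add: B_def \<theta>_def powr_powr flip: powr_numeral)
  also have "(A + B) powr \<theta> = sqrt (a\<^sup>2 + b\<^sup>2) powr q"
    by (simp add: A_def B_def \<theta>_def powr_half_sqrt[symmetric] powr_powr)
  finally show ?thesis by (simp add: \<theta>_def diff_divide_distrib)
qed

locale martingale_setting = bounded_law +
  fixes \<nu> :: "'a measure" and \<pi> :: "('a \<times> 'a) measure" and \<kappa> :: "'a \<Rightarrow> 'a measure"
  assumes prob_\<nu>: "prob_space \<nu>" and sets_\<nu> [measurable_cong]: "sets \<nu> = sets borel"
    and AE_\<nu>: "AE y in \<nu>. norm y \<le> R"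
    and kernel: "prob_kernel \<kappa>" and \<pi>_eq: "\<pi> = disint \<mu> \<kappa>"
    and marg1: "distr \<pi> borel fst = \<mu>" and marg2: "distr \<pi> borel snd = \<nu>"
    and mart: "AE x in \<mu>. integrable (\<kappa> x) (\<lambda>y. y) \<and> (\<integral>y. y \<partial>\<kappa> x) = x"
begin

lemma sets_\<pi> [measurable_cong]: "sets \<pi> = sets borel"
  unfolding \<pi>_eq by (rule sets_disint[OF sets_law])

lemma prob_\<pi>: "prob_space \<pi>"
proof (rule prob_space_distrD[of fst])
  show "fst \<in> \<pi> \<rightarrow>\<^sub>M borel" by measurable
  show "prob_space (distr \<pi> borel fst)" unfolding marg1 by (rule prob_space_axioms)
qed

lemma AE_snd_\<pi>: "AE y in \<nu>. P y \<Longrightarrow> AE z in \<pi>. P (snd z)"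
  using AE_distrD[of snd \<pi> borel P] unfolding marg2 by simp

lemma AE_kernel:
  assumes "Measurable.pred borel P" "AE y in \<nu>. P y"
  shows "AE x in \<mu>. AE y in \<kappa> x. P y"
proof -
  have "AE z in disint \<mu> \<kappa>. P (snd z)" using AE_snd_\<pi>[OF assms(2)] unfolding \<pi>_eq .
  then show ?thesis
    using AE_disint[OF kernel sets_law, of "\<lambda>z. P (snd z)"] assms(1) by simp
qed

end

text \<open>Collects what makes the splitting mean-preserving almost surely. Optimality of the dual
  grid enters in \<open>dual_setting_intro\<close>, which identifies
  \<open>mean_cost p powr (1 / p)\<close> with \<open>dpK\<close>.\<close>

locale dual_setting = martingale_setting +
  fixes p :: real and \<Gamma>d :: "'a set" and S :: "'a \<times> real \<Rightarrow> 'a"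
  assumes p1: "1 \<le> p" and finite_\<Gamma>d: "finite \<Gamma>d"
    and AE_hull: "AE y in \<nu>. y \<in> convex hull \<Gamma>d" and splitting: "splitting_op \<Gamma>d S"
begin

lemma S_meas [measurable]: "S \<in> borel_measurable (borel \<Otimes>\<^sub>M borel)"
  and S_in: "y \<in> convex hull \<Gamma>d \<Longrightarrow> u \<in> {0..1} \<Longrightarrow> S (y, u) \<in> \<Gamma>d"
  and S_mean: "y \<in> convex hull \<Gamma>d \<Longrightarrow> (\<integral>u. S (y, u) \<partial>unifU) = y"
  using splitting by (auto simp: splitting_op_def)

lemma hull_sets [measurable]: "convex hull \<Gamma>d \<in> sets borel"
  using finite_\<Gamma>d by (intro borel_closed compact_imp_closed compact_convex_hull finite_imp_compact)

lemma \<Gamma>d_sets [measurable]: "\<Gamma>d \<in> sets borel"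
  using finite_\<Gamma>d by (intro borel_closed finite_imp_closed)

definition bound :: real where "bound = (\<Sum>g\<in>\<Gamma>d. norm g)"

lemma bound: "g \<in> \<Gamma>d \<Longrightarrow> norm g \<le> bound" and bound_nonneg: "0 \<le> bound"
  unfolding bound_def using finite_\<Gamma>d by (auto intro!: member_le_sum sum_nonneg)

lemma AE_S_in:
  assumes M: "prob_space M" "sets M = sets borel" and ae: "AE y in M. y \<in> convex hull \<Gamma>d \<and> norm y \<le> R"
  shows "AE w in M \<Otimes>\<^sub>M unifU. S w \<in> \<Gamma>d \<and> norm (fst w) \<le> R"
proof -
  interpret M: prob_space M by fact
  interpret U: prob_space unifU by (rule prob_space_unifU)
  interpret pair_sigma_finite M unifU ..
  note [measurable_cong] = M(2)
  show ?thesis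
  proof (rule AE_pair_measure)
    show "AE y in M. AE u in unifU. S (y, u) \<in> \<Gamma>d \<and> norm (fst (y, u)) \<le> R"
      using ae
    proof eventually_elim
      case (elim y)
      show ?case using AE_unifU by eventually_elim (use elim S_in in auto)
    qed
  qed measurable
qed

lemma AE_\<nu>_good: "AE y in \<nu>. y \<in> convex hull \<Gamma>d \<and> norm y \<le> R"
  using AE_hull AE_\<nu> by eventually_elim simp

lemma nn_integral_\<pi>_unifU:
  assumes [measurable]: "f \<in> borel_measurable (borel \<Otimes>\<^sub>M borel)"
  shows "(\<integral>\<^sup>+w. f (snd (fst w), snd w) \<partial>(\<pi> \<Otimes>\<^sub>M unifU)) = (\<integral>\<^sup>+w. f w \<partial>(\<nu> \<Otimes>\<^sub>M unifU))"
proof -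
  interpret U: prob_space unifU by (rule prob_space_unifU)
  have "(\<integral>\<^sup>+w. f (snd (fst w), snd w) \<partial>(\<pi> \<Otimes>\<^sub>M unifU)) = (\<integral>\<^sup>+z. \<integral>\<^sup>+u. f (snd z, u) \<partial>unifU \<partial>\<pi>)"
    by (subst U.nn_integral_fst[symmetric]) auto
  also have "\<dots> = (\<integral>\<^sup>+y. \<integral>\<^sup>+u. f (y, u) \<partial>unifU \<partial>distr \<pi> borel snd)"
    by (rule nn_integral_distr[symmetric]) measurable
  also have "\<dots> = (\<integral>\<^sup>+w. f w \<partial>(\<nu> \<Otimes>\<^sub>M unifU))"
    unfolding marg2 by (rule U.nn_integral_fst) measurable
  finally show ?thesis .
qed

text \<open>Only the law of \<open>(Y, U)\<close> is involved, so the null set found under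
  \<open>\<nu>\<close> is carried over as a vanishing integral of its indicator.\<close>

lemma AE_\<pi>_unifU: "AE w in \<pi> \<Otimes>\<^sub>M unifU. S (snd (fst w), snd w) \<in> \<Gamma>d \<and> norm (snd (fst w)) \<le> R"
proof -
  have ind: "(\<integral>\<^sup>+w. indicator {w. \<not> (S w \<in> \<Gamma>d \<and> norm (fst w) \<le> R)} (snd (fst w), snd w) \<partial>(\<pi> \<Otimes>\<^sub>M unifU)) = 0"
    using AE_S_in[OF prob_\<nu> sets_\<nu> AE_\<nu>_good]
  proof (subst nn_integral_\<pi>_unifU)
    show "(\<integral>\<^sup>+w. indicator {w. \<not> (S w \<in> \<Gamma>d \<and> norm (fst w) \<le> R)} w \<partial>(\<nu> \<Otimes>\<^sub>M unifU)) = 0"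
      by (subst nn_integral_0_iff_AE, measurable)
         (use AE_S_in[OF prob_\<nu> sets_\<nu> AE_\<nu>_good] in eventually_elim, simp)
  qed measurable
  then have "AE w in \<pi> \<Otimes>\<^sub>M unifU.
      indicator {w. \<not> (S w \<in> \<Gamma>d \<and> norm (fst w) \<le> R)} (snd (fst w), snd w) = (0 :: ennreal)"
    by (subst (asm) nn_integral_0_iff_AE) measurable
  then show ?thesis by eventually_elim (auto split: split_indicator_asm)
qed

lemma qker_kernel: "qker \<Gamma>d S \<in> borel \<rightarrow>\<^sub>M subprob_algebra borel"
proof -
  have "(\<lambda>y. distr unifU borel (\<lambda>u. S (y, u))) \<in> borel \<rightarrow>\<^sub>M subprob_algebra borel"
    by (rule measurable_distr2[where M = borel])
       (use prob_space_imp_subprob_space[OF prob_space_unifU] sets_unifU in \<open>auto simp: space_subprob_algebra\<close>)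
  moreover have "return borel \<in> borel \<rightarrow>\<^sub>M subprob_algebra borel" by (rule return_measurable)
  ultimately show ?thesis
    unfolding qker_def[abs_def] by (intro measurable_If) auto
qed

definition mean_cost :: "real \<Rightarrow> real" where
  "mean_cost q = (\<integral>w. norm (fst w - S w) powr q \<partial>(\<nu> \<Otimes>\<^sub>M unifU))"

lemma mean_cost_nonneg: "0 \<le> mean_cost q"
  by (simp add: mean_cost_def)

lemma norm_diff_le: "g \<in> \<Gamma>d \<Longrightarrow> norm y \<le> R \<Longrightarrow> norm (y - g) \<le> R + bound"
  using norm_triangle_ineq4[of y g] bound[of g] by simp

lemma integrable_cost:
  assumes "0 \<le> q"
  shows "integrable (\<nu> \<Otimes>\<^sub>M unifU) (\<lambda>w. norm (fst w - S w) powr q)"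
proof -
  interpret O: prob_space "\<nu> \<Otimes>\<^sub>M unifU" by (rule prob_space_pair_unifU[OF prob_\<nu>])
  show ?thesis
  proof (rule O.integrable_const_bound[where B = "(R + bound) powr q"])
    show "AE w in \<nu> \<Otimes>\<^sub>M unifU. norm (norm (fst w - S w) powr q) \<le> (R + bound) powr q"
      using AE_S_in[OF prob_\<nu> sets_\<nu> AE_\<nu>_good]
      by eventually_elim (use assms norm_diff_le in \<open>auto intro!: powr_mono2\<close>)
  qed measurable
qed

lemma nn_integral_cost:
  assumes "0 \<le> q"
  shows "(\<integral>\<^sup>+w. ennreal (norm (fst w - S w) powr q) \<partial>(\<nu> \<Otimes>\<^sub>M unifU)) = ennreal (mean_cost q)"
  unfolding mean_cost_def by (rule nn_integral_eq_integral[OF integrable_cost[OF assms]]) auto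

text \<open>The grid is optimal for order \<open>p\<close>, not for order 2; this compares its
  quadratic cost with its cost of order \<open>p\<close> in the bound on
  \<open>Wp 2\<close>.\<close>

lemma mean_cost_lyapunov:
  assumes "0 < s" "s \<le> t"
  shows "mean_cost s \<le> mean_cost t powr (s / t)"
proof -
  interpret O: prob_space "\<nu> \<Otimes>\<^sub>M unifU" by (rule prob_space_pair_unifU[OF prob_\<nu>])
  show ?thesis unfolding mean_cost_def
    using assms by (intro O.lyapunov_inequality integrable_cost) auto
qed

end

locale quantized_setting = dual_setting + optimal_quantizer
begin

text \<open>Replaces the iterated kernels by one probability space carrying
  \<open>((X, Y), U)\<close>. The Dirac branch of \<open>qker\<close> is met only off the hull, on a
  null set of \<open>\<nu>\<close>.\<close>

lemma nn_integral_pibar: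
  assumes [measurable]: "f \<in> borel_measurable borel"
  shows "(\<integral>\<^sup>+z. f z \<partial>pibar \<pi> pr \<Gamma>d S) = (\<integral>\<^sup>+w. f (pr (fst (fst w)), S (snd (fst w), snd w)) \<partial>(\<pi> \<Otimes>\<^sub>M unifU))"
proof -
  interpret U: prob_space unifU by (rule prob_space_unifU)
  have qs: "sets (qker \<Gamma>d S y) = sets borel" for y by (simp add: qker_def)
  have ker: "(\<lambda>z. distr (qker \<Gamma>d S (snd z)) borel (\<lambda>y'. (pr (fst z), y'))) \<in> \<pi> \<rightarrow>\<^sub>M subprob_algebra borel"
  proof (rule measurable_distr2)
    show "(\<lambda>z. qker \<Gamma>d S (snd z)) \<in> \<pi> \<rightarrow>\<^sub>M subprob_algebra borel"
      by (rule measurable_compose[OF _ qker_kernel]) measurable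
  qed (simp add: borel_prod[symmetric] case_prod_beta')
  have "(\<integral>\<^sup>+z. f z \<partial>pibar \<pi> pr \<Gamma>d S) = (\<integral>\<^sup>+z. \<integral>\<^sup>+z'. f z' \<partial>distr (qker \<Gamma>d S (snd z)) borel (\<lambda>y'. (pr (fst z), y')) \<partial>\<pi>)"
    unfolding pibar_def by (rule nn_integral_bind[OF _ ker]) measurable
  also have "\<dots> = (\<integral>\<^sup>+z. \<integral>\<^sup>+y'. f (pr (fst z), y') \<partial>qker \<Gamma>d S (snd z) \<partial>\<pi>)"
    by (intro nn_integral_cong nn_integral_distr) (auto simp: measurable_cong_sets[OF qs])
  also have "\<dots> = (\<integral>\<^sup>+z. \<integral>\<^sup>+u. f (pr (fst z), S (snd z, u)) \<partial>unifU \<partial>\<pi>)"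
  proof (rule nn_integral_cong_AE)
    show "AE z in \<pi>. (\<integral>\<^sup>+y'. f (pr (fst z), y') \<partial>qker \<Gamma>d S (snd z)) = (\<integral>\<^sup>+u. f (pr (fst z), S (snd z, u)) \<partial>unifU)"
      using AE_snd_\<pi>[OF AE_hull]
      by eventually_elim (simp add: qker_def nn_integral_distr)
  qed
  also have "\<dots> = (\<integral>\<^sup>+w. f (pr (fst (fst w)), S (snd (fst w), snd w)) \<partial>(\<pi> \<Otimes>\<^sub>M unifU))"
    by (subst U.nn_integral_fst[symmetric]) auto
  finally show ?thesis .
qed

lemma sets_pibar [measurable_cong]: "sets (pibar \<pi> pr \<Gamma>d S) = sets borel"
  unfolding pibar_def
  by (rule sets_bind) (use sets_eq_imp_space_eq[OF sets_\<pi>] in auto)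

abbreviation law_map :: "('a \<times> 'a) \<times> real \<Rightarrow> 'a \<times> 'a" where
  "law_map w \<equiv> (pr (fst (fst w)), S (snd (fst w), snd w))"

lemma pibar_eq_distr: "pibar \<pi> pr \<Gamma>d S = distr (\<pi> \<Otimes>\<^sub>M unifU) borel law_map"
proof (rule measure_eqI_nn_integral)
  fix A :: "('a \<times> 'a) set" assume [measurable]: "A \<in> sets borel"
  show "(\<integral>\<^sup>+z. indicator A z \<partial>pibar \<pi> pr \<Gamma>d S) = (\<integral>\<^sup>+z. indicator A z \<partial>distr (\<pi> \<Otimes>\<^sub>M unifU) borel law_map)"
    by (subst nn_integral_pibar, measurable, subst nn_integral_distr) measurable
qed (simp_all add: sets_pibar)

lemma prob_pibar: "prob_space (pibar \<pi> pr \<Gamma>d S)"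
proof -
  show ?thesis unfolding pibar_eq_distr
    by (rule prob_space.prob_space_distr[OF prob_space_pair_unifU[OF prob_\<pi>]]) measurable
qed

lemma pibar_fst: "distr (pibar \<pi> pr \<Gamma>d S) borel fst = distr \<mu> borel pr"
proof (rule measure_eqI_nn_integral)
  interpret U: prob_space unifU by (rule prob_space_unifU)
  fix A :: "'a set" assume [measurable]: "A \<in> sets borel"
  have "(\<integral>\<^sup>+x. indicator A x \<partial>distr (pibar \<pi> pr \<Gamma>d S) borel fst) = (\<integral>\<^sup>+w. indicator A (pr (fst (fst w))) \<partial>(\<pi> \<Otimes>\<^sub>M unifU))"
    using measurable_compose[OF measurable_fst_borel, of "indicator A" borel]
    by (subst nn_integral_distr, measurable, subst nn_integral_pibar) simp_all
  also have "\<dots> = (\<integral>\<^sup>+z. indicator A (pr (fst z)) \<partial>\<pi>)"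
    by (subst U.nn_integral_fst[symmetric]) (auto simp: U.emeasure_space_1)
  also have "\<dots> = (\<integral>\<^sup>+x. indicator A (pr x) \<partial>distr \<pi> borel fst)"
    by (rule nn_integral_distr[symmetric]) measurable
  also have "\<dots> = (\<integral>\<^sup>+x. indicator A x \<partial>distr \<mu> borel pr)"
    unfolding marg1 by (rule nn_integral_distr[symmetric]) measurable
  finally show "(\<integral>\<^sup>+x. indicator A x \<partial>distr (pibar \<pi> pr \<Gamma>d S) borel fst) = (\<integral>\<^sup>+x. indicator A x \<partial>distr \<mu> borel pr)" .
qed auto

lemma pibar_snd: "distr (pibar \<pi> pr \<Gamma>d S) borel snd = nu_check \<nu> S"
proof (rule measure_eqI_nn_integral)
  fix A :: "'a set" assume [measurable]: "A \<in> sets borel"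
  have "(\<integral>\<^sup>+x. indicator A x \<partial>distr (pibar \<pi> pr \<Gamma>d S) borel snd) = (\<integral>\<^sup>+w. indicator A (S (snd (fst w), snd w)) \<partial>(\<pi> \<Otimes>\<^sub>M unifU))"
    using measurable_compose[OF measurable_snd_borel, of "indicator A" borel]
    by (subst nn_integral_distr, measurable, subst nn_integral_pibar) simp_all
  also have "\<dots> = (\<integral>\<^sup>+w. indicator A (S w) \<partial>(\<nu> \<Otimes>\<^sub>M unifU))"
    by (rule nn_integral_\<pi>_unifU) measurable
  also have "\<dots> = (\<integral>\<^sup>+x. indicator A x \<partial>nu_check \<nu> S)"
    unfolding nu_check_def by (rule nn_integral_distr[symmetric]) measurable
  finally show "(\<integral>\<^sup>+x. indicator A x \<partial>distr (pibar \<pi> pr \<Gamma>d S) borel snd) = (\<integral>\<^sup>+x. indicator A x \<partial>nu_check \<nu> S)" .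
qed (auto simp: nu_check_def)

lemma AE_pibar: "AE z in pibar \<pi> pr \<Gamma>d S. fst z \<in> \<Gamma> \<and> snd z \<in> \<Gamma>d"
proof -
  have [measurable]: "\<Gamma> \<in> sets borel" using finite_codebook by (intro borel_closed finite_imp_closed)
  have "AE w in \<pi> \<Otimes>\<^sub>M unifU. fst (law_map w) \<in> \<Gamma> \<and> snd (law_map w) \<in> \<Gamma>d"
    using AE_\<pi>_unifU by eventually_elim (simp add: pr_in)
  then show ?thesis unfolding pibar_eq_distr
    by (subst AE_distr_iff) auto
qed

sublocale fibre: finite_first_marginal "pibar \<pi> pr \<Gamma>d S" \<Gamma>
proof (intro finite_first_marginal.intro finite_first_marginal_axioms.intro)
  show "AE z in pibar \<pi> pr \<Gamma>d S. fst z \<in> \<Gamma>" using AE_pibar by eventually_elim simp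
qed (auto simp: sets_pibar finite_codebook prob_pibar)

lemma emeasure_pibar_fibre: "emeasure (pibar \<pi> pr \<Gamma>d S) ({a} \<times> UNIV) = ennreal (cell_mass a)"
proof -
  have "emeasure (pibar \<pi> pr \<Gamma>d S) ({a} \<times> UNIV) = emeasure (distr (pibar \<pi> pr \<Gamma>d S) borel fst) {a}"
    by (subst emeasure_distr) (auto simp: sets_eq_imp_space_eq[OF sets_pibar] intro!: arg_cong2[where f = emeasure])
  also have "\<dots> = emeasure \<mu> {x. pr x = a}"
    unfolding pibar_fst by (subst emeasure_distr) (auto intro!: arg_cong2[where f = emeasure])
  finally show ?thesis by (simp add: emeasure_eq_measure cell_mass_def)
qed

lemma AE_cell_kernel:
  assumes "cell_mass a \<noteq> 0"
  shows "AE y in cell_kernel (pibar \<pi> pr \<Gamma>d S) a. y \<in> \<Gamma>d"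
proof -
  have "0 < cell_mass a" using assms by (simp add: cell_mass_def less_le)
  then have ne: "emeasure (pibar \<pi> pr \<Gamma>d S) ({a} \<times> UNIV) \<noteq> 0" by (simp add: emeasure_pibar_fibre)
  have "AE z in uniform_measure (pibar \<pi> pr \<Gamma>d S) ({a} \<times> UNIV). snd z \<in> \<Gamma>d"
  proof (rule AE_uniform_measureI)
    show "AE z in pibar \<pi> pr \<Gamma>d S. z \<in> {a} \<times> UNIV \<longrightarrow> snd z \<in> \<Gamma>d"
      using AE_pibar by eventually_elim simp
  qed (simp add: sets_pibar)
  then show ?thesis using ne unfolding cell_kernel_def by (simp add: AE_distr_iff)
qed

text \<open>Two conditional expectations in turn: integrating over \<open>u\<close> gives
  \<open>Y\<close>, because splitting preserves means, and then \<open>\<pi>\<close> gives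
  \<open>X\<close>, because the event depends on \<open>X\<close> alone.\<close>

lemma integral_pibar_cell:
  "(\<integral>z. indicat_real ({a} \<times> UNIV) z *\<^sub>R snd z \<partial>pibar \<pi> pr \<Gamma>d S) = (\<integral>x. indicat_real {x. pr x = a} x *\<^sub>R x \<partial>\<mu>)"
proof -
  interpret P: prob_space \<pi> by (rule prob_\<pi>)
  interpret U: prob_space unifU by (rule prob_space_unifU)
  interpret pair_sigma_finite \<pi> unifU ..
  let ?I = "indicat_real {x. pr x = a}"
  have Imeas[measurable]: "?I \<in> borel_measurable borel" by measurable
  have int: "integrable (\<pi> \<Otimes>\<^sub>M unifU) (\<lambda>w. ?I (fst (fst w)) *\<^sub>R S (snd (fst w), snd w))"
  proof (rule finite_measure.integrable_const_bound[OF prob_space.axioms(1)[OF prob_space_pair_unifU[OF prob_\<pi>]], where B = bound])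
    show "AE w in \<pi> \<Otimes>\<^sub>M unifU. norm (?I (fst (fst w)) *\<^sub>R S (snd (fst w), snd w)) \<le> bound"
      using AE_\<pi>_unifU by eventually_elim (auto simp: bound bound_nonneg split: split_indicator)
  qed measurable
  have "(\<integral>z. indicat_real ({a} \<times> UNIV) z *\<^sub>R snd z \<partial>pibar \<pi> pr \<Gamma>d S)
      = (\<integral>w. ?I (fst (fst w)) *\<^sub>R S (snd (fst w), snd w) \<partial>(\<pi> \<Otimes>\<^sub>M unifU))"
    unfolding pibar_eq_distr
    by (subst integral_distr) (auto intro!: Bochner_Integration.integral_cong split: split_indicator)
  also have "\<dots> = (\<integral>z. \<integral>u. ?I (fst z) *\<^sub>R S (snd z, u) \<partial>unifU \<partial>\<pi>)"
    by (subst integral_fst'[OF int, symmetric]) simp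
  also have "\<dots> = (\<integral>z. ?I (fst z) *\<^sub>R snd z \<partial>\<pi>)"
  proof (rule integral_cong_AE)
    show "AE z in \<pi>. (\<integral>u. ?I (fst z) *\<^sub>R S (snd z, u) \<partial>unifU) = ?I (fst z) *\<^sub>R snd z"
      using AE_snd_\<pi>[OF AE_hull] by eventually_elim (simp add: S_mean)
  qed measurable
  also have "\<dots> = (\<integral>x. ?I x *\<^sub>R x \<partial>\<mu>)"
    unfolding \<pi>_eq
    by (rule integral_disint_martingale[OF sets_law prob_space_axioms kernel mart, where R = R])
       (use prob_\<pi>[unfolded \<pi>_eq] AE_snd_\<pi>[OF AE_\<nu>, unfolded \<pi>_eq] AE_norm_le R_pos in auto)
  finally show ?thesis .
qed

text \<open>Given the cell, the split point has the same mean as \<open>X\<close>, and this is the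
  codepoint by the centroid property. For a codebook without that property the projected coupling
  would fail to be a martingale.\<close>

lemma mean_cell_kernel:
  assumes a: "a \<in> \<Gamma>" "cell_mass a \<noteq> 0"
  shows "integrable (cell_kernel (pibar \<pi> pr \<Gamma>d S) a) (\<lambda>y. y)"
    and "(\<integral>y. y \<partial>cell_kernel (pibar \<pi> pr \<Gamma>d S) a) = a"
proof -
  interpret C: prob_space "cell_kernel (pibar \<pi> pr \<Gamma>d S) a" by (rule fibre.prob_space_cell_kernel)
  have m: "0 < cell_mass a" using a by (simp add: cell_mass_def less_le)
  have [measurable_cong]: "sets (cell_kernel (pibar \<pi> pr \<Gamma>d S) a) = sets borel" by (rule fibre.sets_cell_kernel)
  show "integrable (cell_kernel (pibar \<pi> pr \<Gamma>d S) a) (\<lambda>y. y)"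
  proof (rule C.integrable_const_bound[where B = bound])
    show "AE y in cell_kernel (pibar \<pi> pr \<Gamma>d S) a. norm y \<le> bound"
      using AE_cell_kernel[OF a(2)] by eventually_elim (rule bound)
  qed measurable
  have "measure (pibar \<pi> pr \<Gamma>d S) ({a} \<times> UNIV) = cell_mass a"
    using m by (simp add: measure_def emeasure_pibar_fibre)
  then show "(\<integral>y. y \<partial>cell_kernel (pibar \<pi> pr \<Gamma>d S) a) = a"
    using m by (subst fibre.integral_cell_kernel) (auto simp: emeasure_pibar_fibre integral_pibar_cell barycentre[OF a(1)])
qed

text \<open>Null cells are finitely many and can be discarded together. Over them
  \<open>cell_kernel\<close> is a default Dirac mass whose mean need not be the codepoint.\<close>

lemma AE_cell_mass: "AE x in \<mu>. cell_mass (pr x) \<noteq> 0"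
proof -
  have "AE x in \<mu>. \<forall>a\<in>{a\<in>\<Gamma>. cell_mass a = 0}. pr x \<noteq> a"
  proof (rule AE_finite_allI)
    fix a assume "a \<in> {a \<in> \<Gamma>. cell_mass a = 0}"
    then show "AE x in \<mu>. pr x \<noteq> a"
      by (subst AE_iff_measurable[of "{x. pr x = a}"]) (auto simp: sets_law cell_mass_def emeasure_eq_measure)
  qed (use finite_codebook in auto)
  then show ?thesis by eventually_elim (use pr_in in auto)
qed

lemma pibar_martingale: "pibar \<pi> pr \<Gamma>d S \<in> martingale_couplings (distr \<mu> borel pr) (nu_check \<nu> S)"
proof -
  let ?K = "cell_kernel (pibar \<pi> pr \<Gamma>d S)"
  have "AE a in distr \<mu> borel pr. integrable (?K a) (\<lambda>y. y) \<and> (\<integral>y. y \<partial>?K a) = a"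
  proof -
    have "AE a in distr \<mu> borel pr. a \<in> {a \<in> \<Gamma>. cell_mass a \<noteq> 0}"
      using AE_cell_mass pr_in finite_codebook
      by (subst AE_distr_iff) (auto intro!: borel_closed finite_imp_closed)
    then show ?thesis by eventually_elim (use mean_cell_kernel in auto)
  qed
  then show ?thesis
    using fibre.prob_kernel_cell_kernel fibre.disint_cell_kernel pibar_fst pibar_snd sets_pibar
    unfolding martingale_couplings_def couplings_def by (auto intro!: exI[of _ ?K])
qed

text \<open>The exponent \<open>q\<close> is separate from \<open>p\<close> because
  \<open>Wp 2\<close> is also bounded for grids optimal at order \<open>p\<close>. The constant
  \<open>c\<close> will be 1 for \<open>q \<le> 2\<close> and \<open>2 powr ((q - 2) / 2)\<close>
  above.\<close>

lemma Wp_pibar_le: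
  assumes q: "0 < q" and c: "0 \<le> c"
    and pt: "\<And>a b. 0 \<le> a \<Longrightarrow> 0 \<le> b \<Longrightarrow> sqrt (a\<^sup>2 + b\<^sup>2) powr q \<le> c * (a powr q + b powr q)"
  shows "Wp q (pibar \<pi> pr \<Gamma>d S) \<pi> powr q \<le> c * (\<integral>x. infdist x \<Gamma> powr q \<partial>\<mu>) + c * mean_cost q"
proof -
  interpret U: prob_space unifU by (rule prob_space_unifU)
  let ?\<Omega> = "\<pi> \<Otimes>\<^sub>M unifU"
  let ?\<gamma> = "distr ?\<Omega> borel (\<lambda>w. (law_map w, fst w))"
  have "distr ?\<gamma> borel snd = \<pi>"
  proof -
    have "distr ?\<gamma> borel snd = distr ?\<Omega> borel fst"
      by (subst distr_distr) (auto simp: comp_def)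
    also have "\<dots> = distr ?\<Omega> \<pi> fst" by (rule distr_cong) (auto simp: sets_\<pi>)
    finally show ?thesis by (simp add: U.distr_pair_fst)
  qed
  moreover have "distr ?\<gamma> borel fst = pibar \<pi> pr \<Gamma>d S"
    unfolding pibar_eq_distr by (subst distr_distr) (auto simp: comp_def)
  ultimately have \<gamma>: "?\<gamma> \<in> couplings (pibar \<pi> pr \<Gamma>d S) \<pi>" by (simp add: couplings_def)
  have dp: "infdist x \<Gamma> powr q = norm (x - pr x) powr q" for x by (simp add: infdist_pr dist_norm)
  have "(\<integral>\<^sup>+z. ennreal (dist (fst z) (snd z) powr q) \<partial>?\<gamma>) = (\<integral>\<^sup>+w. ennreal (dist (law_map w) (fst w) powr q) \<partial>?\<Omega>)"
    by (subst nn_integral_distr) auto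
  also have "\<dots> \<le> (\<integral>\<^sup>+w. ennreal c * (ennreal (infdist (fst (fst w)) \<Gamma> powr q) + ennreal (norm (snd (fst w) - S (snd (fst w), snd w)) powr q)) \<partial>?\<Omega>)"
  proof (rule nn_integral_mono)
    fix w :: "('a \<times> 'a) \<times> real"
    have "dist (law_map w) (fst w) = sqrt ((infdist (fst (fst w)) \<Gamma>)\<^sup>2 + (norm (snd (fst w) - S (snd (fst w), snd w)))\<^sup>2)"
      by (simp add: dist_prod_def infdist_pr dist_norm norm_minus_commute)
    then have "dist (law_map w) (fst w) powr q \<le> c * (infdist (fst (fst w)) \<Gamma> powr q + norm (snd (fst w) - S (snd (fst w), snd w)) powr q)"
      by (simp only:) (rule pt, simp_all add: infdist_nonneg)
    then show "ennreal (dist (law_map w) (fst w) powr q) \<le> ennreal c * (ennreal (infdist (fst (fst w)) \<Gamma> powr q) + ennreal (norm (snd (fst w) - S (snd (fst w), snd w)) powr q))"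
      using c by (simp add: ennreal_leI flip: ennreal_mult ennreal_plus)
  qed
  also have "\<dots> = ennreal c * ((\<integral>\<^sup>+w. ennreal (infdist (fst (fst w)) \<Gamma> powr q) \<partial>?\<Omega>)
      + (\<integral>\<^sup>+w. ennreal (norm (snd (fst w) - S (snd (fst w), snd w)) powr q) \<partial>?\<Omega>))"
    by (subst nn_integral_cmult, simp, subst nn_integral_add) auto
  also have "(\<integral>\<^sup>+w. ennreal (norm (snd (fst w) - S (snd (fst w), snd w)) powr q) \<partial>?\<Omega>) = ennreal (mean_cost q)"
    using nn_integral_\<pi>_unifU[of "\<lambda>w. ennreal (norm (fst w - S w) powr q)"] nn_integral_cost[of q] q by simp
  also have "(\<integral>\<^sup>+w. ennreal (infdist (fst (fst w)) \<Gamma> powr q) \<partial>?\<Omega>) = (\<integral>\<^sup>+z. ennreal (infdist (fst z) \<Gamma> powr q) \<partial>\<pi>)"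
    by (subst U.nn_integral_fst[symmetric]) (auto simp: U.emeasure_space_1)
  also have "\<dots> = (\<integral>\<^sup>+x. ennreal (infdist x \<Gamma> powr q) \<partial>distr \<pi> borel fst)"
    by (rule nn_integral_distr[symmetric]) measurable
  also have "\<dots> = ennreal (\<integral>x. infdist x \<Gamma> powr q \<partial>\<mu>)"
    unfolding marg1 by (rule nn_integral_eq_integral) (use integrable_infdist_powr[OF codebook_nonempty, of q] q in auto)
  also have "ennreal c * (ennreal (\<integral>x. infdist x \<Gamma> powr q \<partial>\<mu>) + ennreal (mean_cost q))
      = ennreal (c * (\<integral>x. infdist x \<Gamma> powr q \<partial>\<mu>) + c * mean_cost q)"
    using c mean_cost_nonneg[of q] by (simp add: distrib_left flip: ennreal_mult ennreal_plus)
  finally show ?thesis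
    using c mean_cost_nonneg[of q] by (intro Wp_powr_le[OF q \<gamma>] add_nonneg_nonneg mult_nonneg_nonneg) auto
qed

lemma moment_le_e2N:
  assumes "0 < q" "q \<le> 2"
  shows "(\<integral>x. infdist x \<Gamma> powr q \<partial>\<mu>) \<le> e2N \<mu> N powr q"
proof -
  have "(\<integral>x. infdist x \<Gamma> powr q \<partial>\<mu>) \<le> (\<integral>x. infdist x \<Gamma> powr 2 \<partial>\<mu>) powr (q / 2)"
    using assms codebook_nonempty by (intro lyapunov_inequality integrable_infdist_powr infdist_nonneg) auto
  also have "(\<integral>x. infdist x \<Gamma> powr 2 \<partial>\<mu>) = distortion \<Gamma>"
    unfolding distortion_def by (simp add: infdist_nonneg)
  also have "distortion \<Gamma> powr (q / 2) = e2N \<mu> N powr q"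
    using distortion_nonneg[of \<Gamma>] by (simp add: e2N_eq powr_half_sqrt[symmetric] powr_powr)
  finally show ?thesis .
qed

end

section \<open>The adapted Wasserstein distance\<close>

context dual_setting
begin

text \<open>Conditional law of \<open>(S (Y, U), Y)\<close> given \<open>X = x\<close>: a coupling
  of the split version of \<open>\<kappa> x\<close>, carried by the grid for almost every
  \<open>x\<close>, with \<open>\<kappa> x\<close> itself.\<close>

definition split_law :: "'a \<Rightarrow> ('a \<times> 'a) measure" where
  "split_law x = distr (\<kappa> x \<Otimes>\<^sub>M unifU) borel (\<lambda>w. (S w, fst w))"

lemma split_law_kernel: "split_law \<in> borel \<rightarrow>\<^sub>M subprob_algebra borel"
proof -
  have "(\<lambda>x. \<kappa> x \<Otimes>\<^sub>M unifU) \<in> borel \<rightarrow>\<^sub>M subprob_algebra (borel \<Otimes>\<^sub>M borel)"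
    by (rule measurable_pair_measure[OF prob_kernel_measurable[OF kernel]])
       (use prob_space_imp_subprob_space[OF prob_space_unifU] sets_unifU in \<open>auto simp: space_subprob_algebra\<close>)
  then show ?thesis
    unfolding split_law_def[abs_def]
    by (rule measurable_compose) (rule measurable_distr, measurable)
qed

lemma sets_kernel_borel [measurable_cong]: "sets (\<kappa> x) = sets borel"
  by (rule sets_kernel[OF kernel])

lemma prob_split_law: "prob_space (split_law x)"
  unfolding split_law_def
  by (rule prob_space.prob_space_distr[OF prob_space_pair_unifU[OF prob_space_kernel[OF kernel]]]) measurable

lemma sets_split_law [measurable_cong]: "sets (split_law x) = sets borel"
  by (simp add: split_law_def)

lemma split_law_snd: "distr (split_law x) borel snd = \<kappa> x"
proof -
  interpret U: prob_space unifU by (rule prob_space_unifU)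
  have "distr (split_law x) borel snd = distr (\<kappa> x \<Otimes>\<^sub>M unifU) borel fst"
    unfolding split_law_def by (subst distr_distr) (auto simp: comp_def)
  also have "\<dots> = distr (\<kappa> x \<Otimes>\<^sub>M unifU) (\<kappa> x) fst"
    by (rule distr_cong) (auto simp: sets_kernel[OF kernel])
  finally show ?thesis by (simp add: U.distr_pair_fst)
qed

text \<open>One real function of \<open>x\<close> per grid point; comparing split kernels at
  different points thereby becomes an \<open>L1\<close> question.\<close>

definition split_weight :: "'a \<Rightarrow> 'a \<Rightarrow> real" where
  "split_weight g x = measure (distr (split_law x) borel fst) {g}"

lemma emeasure_split_law: "emeasure (split_law x) ({g} \<times> UNIV) = ennreal (split_weight g x)"
proof -
  interpret D: prob_space "distr (split_law x) borel fst"
    by (rule prob_space.prob_space_distr[OF prob_split_law]) measurable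
  have "emeasure (split_law x) ({g} \<times> UNIV) = emeasure (distr (split_law x) borel fst) {g}"
    by (subst emeasure_distr) (auto simp: sets_eq_imp_space_eq[OF sets_split_law] intro!: arg_cong2[where f = emeasure])
  then show ?thesis by (simp add: split_weight_def D.emeasure_eq_measure)
qed

lemma split_weight_nonneg: "0 \<le> split_weight g x"
  by (simp add: split_weight_def)

lemma split_weight_measurable [measurable]: "split_weight g \<in> borel_measurable borel"
proof -
  have "{g} \<times> (UNIV :: 'a set) \<in> sets borel"
    by (intro borel_closed closed_Times closed_singleton closed_UNIV)
  from measurable_compose[OF split_law_kernel measurable_emeasure_subprob_algebra[OF this]]
  have "(\<lambda>x. enn2real (emeasure (split_law x) ({g} \<times> UNIV))) \<in> borel_measurable borel"
    by measurable
  then show ?thesis by (simp add: emeasure_split_law split_weight_nonneg)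
qed

lemma integrable_split_weight: "integrable \<mu> (split_weight g)"
proof (rule integrable_bounded_on_cball[where B = 1])
  fix x
  interpret D: prob_space "distr (split_law x) borel fst"
    by (rule prob_space.prob_space_distr[OF prob_split_law]) measurable
  show "norm (split_weight g x) \<le> 1" by (simp add: split_weight_def)
qed measurable

lemma nn_integral_split_law:
  assumes [measurable]: "\<phi> \<in> borel_measurable borel" "f \<in> borel_measurable borel"
  shows "(\<integral>\<^sup>+x. \<phi> x * (\<integral>\<^sup>+z. f z \<partial>split_law x) \<partial>\<mu>)
    = (\<integral>\<^sup>+w. \<phi> (fst (fst w)) * f (S (snd (fst w), snd w), snd (fst w)) \<partial>(\<pi> \<Otimes>\<^sub>M unifU))"
proof -
  interpret U: prob_space unifU by (rule prob_space_unifU)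
  have pp[measurable]: "(\<lambda>z. \<integral>\<^sup>+u. f (S (snd z, u), snd z) \<partial>unifU) \<in> borel_measurable (borel :: ('a \<times> 'a) measure)"
    by measurable
  have "(\<integral>\<^sup>+w. \<phi> (fst (fst w)) * f (S (snd (fst w), snd w), snd (fst w)) \<partial>(\<pi> \<Otimes>\<^sub>M unifU))
      = (\<integral>\<^sup>+z. \<integral>\<^sup>+u. \<phi> (fst z) * f (S (snd z, u), snd z) \<partial>unifU \<partial>\<pi>)"
    by (subst U.nn_integral_fst[symmetric]) auto
  also have "\<dots> = (\<integral>\<^sup>+z. \<phi> (fst z) * (\<integral>\<^sup>+u. f (S (snd z, u), snd z) \<partial>unifU) \<partial>disint \<mu> \<kappa>)"
    unfolding \<pi>_eq by (intro nn_integral_cong nn_integral_cmult) measurable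
  also have "\<dots> = (\<integral>\<^sup>+x. \<integral>\<^sup>+y. \<phi> x * (\<integral>\<^sup>+u. f (S (y, u), y) \<partial>unifU) \<partial>\<kappa> x \<partial>\<mu>)"
    by (subst nn_integral_disint[OF kernel sets_law]) auto
  also have "\<dots> = (\<integral>\<^sup>+x. \<phi> x * (\<integral>\<^sup>+z. f z \<partial>split_law x) \<partial>\<mu>)"
  proof (rule nn_integral_cong)
    fix x
    have "(\<integral>\<^sup>+y. \<phi> x * (\<integral>\<^sup>+u. f (S (y, u), y) \<partial>unifU) \<partial>\<kappa> x) = \<phi> x * (\<integral>\<^sup>+y. \<integral>\<^sup>+u. f (S (y, u), y) \<partial>unifU \<partial>\<kappa> x)"
      by (rule nn_integral_cmult) measurable
    also have "(\<integral>\<^sup>+y. \<integral>\<^sup>+u. f (S (y, u), y) \<partial>unifU \<partial>\<kappa> x) = (\<integral>\<^sup>+w. f (S w, fst w) \<partial>(\<kappa> x \<Otimes>\<^sub>M unifU))"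
      by (subst U.nn_integral_fst[symmetric]) auto
    also have "\<dots> = (\<integral>\<^sup>+z. f z \<partial>split_law x)"
      unfolding split_law_def by (rule nn_integral_distr[symmetric]) measurable
    finally show "(\<integral>\<^sup>+y. \<phi> x * (\<integral>\<^sup>+u. f (S (y, u), y) \<partial>unifU) \<partial>\<kappa> x) = \<phi> x * (\<integral>\<^sup>+z. f z \<partial>split_law x)" .
  qed
  finally show ?thesis ..
qed

definition split_cost :: "'a \<Rightarrow> ennreal" where
  "split_cost x = (\<integral>\<^sup>+z. ennreal (dist (fst z) (snd z) powr p) \<partial>split_law x)"

lemma split_cost_measurable [measurable]: "split_cost \<in> borel_measurable borel"
  unfolding split_cost_def[abs_def]
  by (rule measurable_compose[OF split_law_kernel nn_integral_measurable_subprob_algebra]) measurable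

lemma nn_integral_split_cost: "(\<integral>\<^sup>+x. split_cost x \<partial>\<mu>) = ennreal (mean_cost p)"
proof -
  have "(\<integral>\<^sup>+x. split_cost x \<partial>\<mu>)
      = (\<integral>\<^sup>+w. ennreal (dist (S (snd (fst w), snd w)) (snd (fst w)) powr p) \<partial>(\<pi> \<Otimes>\<^sub>M unifU))"
    using nn_integral_split_law[of "\<lambda>_. 1" "\<lambda>z. ennreal (dist (fst z) (snd z) powr p)"]
    by (simp add: split_cost_def)
  also have "\<dots> = (\<integral>\<^sup>+w. ennreal (norm (fst w - S w) powr p) \<partial>(\<nu> \<Otimes>\<^sub>M unifU))"
    using nn_integral_\<pi>_unifU[of "\<lambda>w. ennreal (norm (fst w - S w) powr p)"]
    by (simp add: dist_norm norm_minus_commute)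
  finally show ?thesis using nn_integral_cost[of p] p1 by simp
qed

text \<open>A cost rather than a length: it dominates the \<open>p\<close>-th power of the distance
  between a grid point and a point of the ball.\<close>

abbreviation radius :: real where "radius \<equiv> (R + bound) powr p"

text \<open>\<open>split_law x\<close> transports the split kernel to \<open>\<kappa> x\<close> at
  cost \<open>split_cost x\<close>; \<open>modified_coupling\<close> then exchanges its first
  marginal for \<open>\<sigma>\<close>, charging \<open>radius\<close> for moved mass.\<close>

lemma Wp_kernel_le:
  assumes good: "AE y in \<kappa> x. y \<in> convex hull \<Gamma>d \<and> norm y \<le> R"
    and \<sigma>: "prob_space \<sigma>" "sets \<sigma> = sets borel" "AE g in \<sigma>. g \<in> \<Gamma>d"
  shows "ennreal (Wp p \<sigma> (\<kappa> x) powr p)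
    \<le> split_cost x + ennreal (radius * (\<Sum>g\<in>\<Gamma>d. \<bar>measure \<sigma> {g} - split_weight g x\<bar>))"
proof -
  have ae: "AE z in split_law x. fst z \<in> \<Gamma>d \<and> norm (snd z) \<le> R"
    unfolding split_law_def
    using AE_S_in[OF prob_space_kernel[OF kernel] sets_kernel[OF kernel] good]
    by (subst AE_distr_iff) auto
  have AEd: "AE z in split_law x. \<forall>g\<in>\<Gamma>d. dist g (snd z) powr p \<le> radius"
    using ae
    by eventually_elim (use p1 norm_diff_le in \<open>auto intro!: powr_mono2 simp: dist_norm norm_minus_commute\<close>)
  have AEf: "AE z in split_law x. fst z \<in> \<Gamma>d" using ae by eventually_elim simp
  obtain \<gamma> where \<gamma>: "\<gamma> \<in> couplings \<sigma> (distr (split_law x) borel snd)"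
    and cost: "(\<integral>\<^sup>+z. ennreal (dist (fst z) (snd z) powr p) \<partial>\<gamma>)
       \<le> (\<integral>\<^sup>+z. ennreal (dist (fst z) (snd z) powr p) \<partial>split_law x)
         + ennreal (radius * (\<Sum>g\<in>\<Gamma>d. \<bar>measure \<sigma> {g} - measure (distr (split_law x) borel fst) {g}\<bar>))"
    using modified_coupling[OF prob_split_law sets_split_law AEf \<sigma> finite_\<Gamma>d _ AEd] by auto
  interpret T: prob_space "split_law x" by (rule prob_split_law)
  \<comment> \<open>Finiteness, so that passing through \<open>enn2real\<close> below loses
    nothing.\<close>
  have fin: "split_cost x \<le> ennreal radius"
  proof -
    have "split_cost x \<le> (\<integral>\<^sup>+z. ennreal radius \<partial>split_law x)"
      unfolding split_cost_def
    proof (rule nn_integral_mono_AE)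
      show "AE z in split_law x. ennreal (dist (fst z) (snd z) powr p) \<le> ennreal radius"
        using AEd AEf by eventually_elim (auto intro!: ennreal_leI)
    qed
    then show ?thesis by (simp add: T.emeasure_space_1)
  qed
  define c where "c = enn2real (split_cost x) + radius * (\<Sum>g\<in>\<Gamma>d. \<bar>measure \<sigma> {g} - split_weight g x\<bar>)"
  have sc: "ennreal (enn2real (split_cost x)) = split_cost x"
    using order.strict_trans1[OF fin ennreal_less_top] by simp
  have c0: "0 \<le> radius * (\<Sum>g\<in>\<Gamma>d. \<bar>measure \<sigma> {g} - split_weight g x\<bar>)"
    by (intro mult_nonneg_nonneg sum_nonneg) auto
  have eq: "ennreal c = split_cost x + ennreal (radius * (\<Sum>g\<in>\<Gamma>d. \<bar>measure \<sigma> {g} - split_weight g x\<bar>))"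
    unfolding c_def using c0 by (simp add: sc)
  have "Wp p \<sigma> (\<kappa> x) powr p \<le> c"
  proof (rule Wp_powr_le)
    show "\<gamma> \<in> couplings \<sigma> (\<kappa> x)" using \<gamma> by (simp only: split_law_snd)
    show "(\<integral>\<^sup>+z. ennreal (dist (fst z) (snd z) powr p) \<partial>\<gamma>) \<le> ennreal c"
      unfolding eq using cost by (simp only: split_cost_def split_weight_def)
  qed (use p1 c0 in \<open>auto simp: c_def\<close>)
  then show ?thesis unfolding eq[symmetric] by (rule ennreal_leI)
qed

end

context quantized_setting
begin

text \<open>Total probability: conditioning on the cell averages the conditional probabilities given
  \<open>X = x\<close>. Through this identity the distance between the kernels at
  \<open>pr x\<close> and at \<open>x\<close> is governed by the \<open>L1\<close> error of
  \<open>cell_average\<close>.\<close>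

lemma measure_cell_kernel:
  assumes a: "cell_mass a \<noteq> 0"
  shows "measure (cell_kernel (pibar \<pi> pr \<Gamma>d S) a) {g} = cell_average (split_weight g) a"
proof -
  have m: "0 < cell_mass a" using a by (simp add: cell_mass_def less_le)
  let ?J = "\<integral>x. indicat_real {x. pr x = a} x * split_weight g x \<partial>\<mu>"
  have J0: "0 \<le> ?J" using split_weight_nonneg by simp
  have [measurable]: "{g} \<times> (UNIV :: 'a set) \<in> sets borel" "{a} \<times> (UNIV :: 'a set) \<in> sets borel"
    by (auto intro!: borel_closed closed_Times)
  have "(\<integral>\<^sup>+z. indicator {g} (snd z) * indicator ({a} \<times> UNIV) z \<partial>pibar \<pi> pr \<Gamma>d S)
     = (\<integral>\<^sup>+w. indicator {x. pr x = a} (fst (fst w)) * indicator ({g} \<times> UNIV) (S (snd (fst w), snd w), snd (fst w)) \<partial>(\<pi> \<Otimes>\<^sub>M unifU))"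
    by (subst nn_integral_pibar) (auto intro!: nn_integral_cong split: split_indicator)
  also have "\<dots> = (\<integral>\<^sup>+x. indicator {x. pr x = a} x * (\<integral>\<^sup>+z. indicator ({g} \<times> UNIV) z \<partial>split_law x) \<partial>\<mu>)"
    by (rule nn_integral_split_law[symmetric]) measurable
  also have "\<dots> = (\<integral>\<^sup>+x. ennreal (indicat_real {x. pr x = a} x * split_weight g x) \<partial>\<mu>)"
    by (intro nn_integral_cong)
       (auto simp: emeasure_split_law sets_split_law split: split_indicator)
  also have "\<dots> = ennreal ?J"
    using split_weight_nonneg integrable_mult_indicator[OF _ integrable_split_weight, of "{x. pr x = a}" g]
    by (intro nn_integral_eq_integral) (auto simp: sets_law)
  finally have num: "(\<integral>\<^sup>+z. indicator {g} (snd z) * indicator ({a} \<times> UNIV) z \<partial>pibar \<pi> pr \<Gamma>d S) = ennreal ?J" .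
  have "emeasure (cell_kernel (pibar \<pi> pr \<Gamma>d S) a) {g} = (\<integral>\<^sup>+y. indicator {g} y \<partial>cell_kernel (pibar \<pi> pr \<Gamma>d S) a)"
    by (simp add: fibre.sets_cell_kernel)
  also have "\<dots> = ennreal ?J / ennreal (cell_mass a)"
    using m by (subst fibre.nn_integral_cell_kernel) (auto simp: emeasure_pibar_fibre num)
  also have "\<dots> = ennreal (?J / cell_mass a)" using m J0 by (simp add: divide_ennreal)
  finally show ?thesis
    using m J0 by (simp add: measure_def cell_average_def)
qed

lemma AWp_pibar_le:
  "AWp p (pibar \<pi> pr \<Gamma>d S) \<pi> \<le>
    ((\<integral>x. infdist x \<Gamma> powr p \<partial>\<mu>) + mean_cost p
      + radius * (\<Sum>g\<in>\<Gamma>d. \<integral>x. \<bar>cell_average (split_weight g) (pr x) - split_weight g x\<bar> \<partial>\<mu>)) powr (1 / p)"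
    (is "_ \<le> ?c powr _")
proof -
  let ?K = "cell_kernel (pibar \<pi> pr \<Gamma>d S)"
  let ?D = "\<lambda>g x. \<bar>cell_average (split_weight g) (pr x) - split_weight g x\<bar>"
  define m where "m = distr \<mu> borel (\<lambda>x. (pr x, x))"
  have sets_m[measurable_cong]: "sets m = sets borel" by (simp add: m_def)
  have K_meas[measurable]: "(\<lambda>a. measure (?K a) {g}) \<in> borel_measurable borel" for g
    by (rule measurable_compose[OF prob_kernel_measurable[OF fibre.prob_kernel_cell_kernel] measurable_measure_subprob_algebra]) simp
  have m1: "distr m borel fst = distr \<mu> borel pr" and m2: "distr m borel snd = \<mu>"
    unfolding m_def by (subst distr_distr; simp add: comp_def distr_id2 sets_law)+
  have c0: "0 \<le> ?c"
    using mean_cost_nonneg[of p] by (intro add_nonneg_nonneg mult_nonneg_nonneg sum_nonneg) auto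
  \<comment> \<open>A measurable majorant: the integrand itself contains an infimum over couplings,
    so its integral is only bounded from above, through \<open>H\<close>.\<close>
  define H where "H z = ennreal (dist (fst z) (snd z) powr p) + (split_cost (snd z)
      + ennreal (radius * (\<Sum>g\<in>\<Gamma>d. \<bar>measure (?K (fst z)) {g} - split_weight g (snd z)\<bar>)))" for z
  have H_meas[measurable]: "H \<in> borel_measurable borel" unfolding H_def[abs_def] by measurable
  have "(\<integral>\<^sup>+z. ennreal (dist (fst z) (snd z) powr p + Wp p (?K (fst z)) (\<kappa> (snd z)) powr p) \<partial>m) \<le> (\<integral>\<^sup>+z. H z \<partial>m)"
  proof (rule nn_integral_mono_AE)
    have "AE a in distr m borel fst. a \<in> {a \<in> \<Gamma>. cell_mass a \<noteq> 0}"
      unfolding m1 using AE_cell_mass pr_in finite_codebook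
      by (subst AE_distr_iff) (auto intro!: borel_closed finite_imp_closed)
    from AE_distrD[OF _ this] have ae1: "AE z in m. cell_mass (fst z) \<noteq> 0" by simp
    have "AE x in distr m borel snd. AE y in \<kappa> x. y \<in> convex hull \<Gamma>d \<and> norm y \<le> R"
      unfolding m2 by (rule AE_kernel[OF _ AE_\<nu>_good]) measurable
    from AE_distrD[OF _ this] have ae2: "AE z in m. AE y in \<kappa> (snd z). y \<in> convex hull \<Gamma>d \<and> norm y \<le> R" by simp
    show "AE z in m. ennreal (dist (fst z) (snd z) powr p + Wp p (?K (fst z)) (\<kappa> (snd z)) powr p) \<le> H z"
      using ae1 ae2
    proof eventually_elim
      case (elim z)
      show ?case
        using Wp_kernel_le[OF elim(2) fibre.prob_space_cell_kernel fibre.sets_cell_kernel AE_cell_kernel[OF elim(1)]]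
        by (simp add: H_def add_left_mono)
    qed
  qed
  also have "\<dots> = (\<integral>\<^sup>+x. H (pr x, x) \<partial>\<mu>)"
    unfolding m_def by (rule nn_integral_distr) measurable
  also have "\<dots> = (\<integral>\<^sup>+x. ennreal (infdist x \<Gamma> powr p) + (split_cost x + ennreal (radius * (\<Sum>g\<in>\<Gamma>d. ?D g x))) \<partial>\<mu>)"
  proof (rule nn_integral_cong_AE)
    show "AE x in \<mu>. H (pr x, x) = ennreal (infdist x \<Gamma> powr p) + (split_cost x + ennreal (radius * (\<Sum>g\<in>\<Gamma>d. ?D g x)))"
      using AE_cell_mass by eventually_elim (simp add: H_def measure_cell_kernel infdist_pr dist_commute)
  qed
  also have "\<dots> = (\<integral>\<^sup>+x. ennreal (infdist x \<Gamma> powr p) \<partial>\<mu>) + ((\<integral>\<^sup>+x. split_cost x \<partial>\<mu>)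
      + (\<integral>\<^sup>+x. ennreal (radius * (\<Sum>g\<in>\<Gamma>d. ?D g x)) \<partial>\<mu>))"
    by (subst nn_integral_add, simp, simp, subst nn_integral_add) auto
  also have "(\<integral>\<^sup>+x. ennreal (infdist x \<Gamma> powr p) \<partial>\<mu>) = ennreal (\<integral>x. infdist x \<Gamma> powr p \<partial>\<mu>)"
    by (rule nn_integral_eq_integral) (use integrable_infdist_powr[OF codebook_nonempty, of p] p1 in auto)
  also have "(\<integral>\<^sup>+x. split_cost x \<partial>\<mu>) = ennreal (mean_cost p)" by (rule nn_integral_split_cost)
  also have "(\<integral>\<^sup>+x. ennreal (radius * (\<Sum>g\<in>\<Gamma>d. ?D g x)) \<partial>\<mu>) = ennreal (radius * (\<Sum>g\<in>\<Gamma>d. \<integral>x. ?D g x \<partial>\<mu>))"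
  proof -
    have int: "integrable \<mu> (?D g)" for g
      using integrable_cell_average integrable_split_weight by auto
    show ?thesis
      using int by (subst nn_integral_eq_integral) (auto intro!: mult_nonneg_nonneg sum_nonneg)
  qed
  also have "ennreal (\<integral>x. infdist x \<Gamma> powr p \<partial>\<mu>) + (ennreal (mean_cost p) + ennreal (radius * (\<Sum>g\<in>\<Gamma>d. \<integral>x. ?D g x \<partial>\<mu>)))
      = ennreal ?c"
    using mean_cost_nonneg[of p] by (simp add: sum_nonneg add.assoc flip: ennreal_plus)
  finally have cost: "(\<integral>\<^sup>+z. ennreal (dist (fst z) (snd z) powr p + Wp p (?K (fst z)) (\<kappa> (snd z)) powr p) \<partial>m) \<le> ennreal ?c" .
  let ?T = "{(m, \<kappa>, \<kappa>'). m \<in> couplings (distr (pibar \<pi> pr \<Gamma>d S) borel fst) (distr \<pi> borel fst) \<and>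
        prob_kernel \<kappa> \<and> pibar \<pi> pr \<Gamma>d S = disint (distr (pibar \<pi> pr \<Gamma>d S) borel fst) \<kappa> \<and>
        prob_kernel \<kappa>' \<and> \<pi> = disint (distr \<pi> borel fst) \<kappa>'}"
  have "(m, ?K, \<kappa>) \<in> ?T"
    unfolding mem_Collect_eq case_prod_conv
  proof (intro conjI)
    show "m \<in> couplings (distr (pibar \<pi> pr \<Gamma>d S) borel fst) (distr \<pi> borel fst)"
      unfolding couplings_def pibar_fst marg1 using m1 m2 sets_m by simp
    show "\<pi> = disint (distr \<pi> borel fst) \<kappa>" unfolding marg1 by (rule \<pi>_eq)
  qed (rule fibre.prob_kernel_cell_kernel fibre.disint_cell_kernel kernel)+
  then have "(INF t\<in>?T. (case t of (m, \<kappa>, \<kappa>') \<Rightarrow>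
        \<integral>\<^sup>+z. ennreal (dist (fst z) (snd z) powr p + Wp p (\<kappa> (fst z)) (\<kappa>' (snd z)) powr p) \<partial>m)) \<le> ennreal ?c"
    by (rule INF_lower2) (unfold case_prod_conv, rule cost)
  then show ?thesis
    unfolding AWp_def using c0 p1 by (intro powr_mono2 enn2real_leI) auto
qed

end

text \<open>Gathers the dependence on the codebook in the first moment of the quantization distance.
  As distances are at most \<open>2 * R\<close>, the moment of order \<open>p\<close> is dominated
  by the first, so large \<open>p\<close> is no obstacle.\<close>

lemma (in quantized_setting) AWp_pibar_le_lipschitz:
  assumes h: "\<And>g. g \<in> \<Gamma>d \<Longrightarrow> (L g)-lipschitz_on UNIV (h g)" "\<And>g. g \<in> \<Gamma>d \<Longrightarrow> integrable \<mu> (h g)"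
  shows "AWp p (pibar \<pi> pr \<Gamma>d S) \<pi> \<le>
    (mean_cost p + radius * (\<Sum>g\<in>\<Gamma>d. 2 * (\<integral>x. \<bar>split_weight g x - h g x\<bar> \<partial>\<mu>))
      + ((2 * R) powr (p - 1) + radius * (\<Sum>g\<in>\<Gamma>d. 2 * L g)) * (\<integral>x. infdist x \<Gamma> \<partial>\<mu>)) powr (1 / p)"
    (is "_ \<le> ?rhs powr _")
proof -
  let ?e = "\<integral>x. infdist x \<Gamma> \<partial>\<mu>"
  have id: "integrable \<mu> (\<lambda>x. infdist x \<Gamma>)"
    using integrable_infdist_power[OF codebook_nonempty, of 1] by simp
  have "(\<integral>x. infdist x \<Gamma> powr p \<partial>\<mu>) \<le> (\<integral>x. (2 * R) powr (p - 1) * infdist x \<Gamma> \<partial>\<mu>)"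
  proof (rule integral_mono_AE)
    show "AE x in \<mu>. infdist x \<Gamma> powr p \<le> (2 * R) powr (p - 1) * infdist x \<Gamma>"
      using AE_infdist_le
    proof eventually_elim
      case (elim x)
      have "infdist x \<Gamma> powr p = infdist x \<Gamma> powr (p - 1) * infdist x \<Gamma>"
        using powr_add[of "infdist x \<Gamma>" "p - 1" 1] by (simp add: infdist_nonneg)
      also have "\<dots> \<le> (2 * R) powr (p - 1) * infdist x \<Gamma>"
        using elim p1 by (intro mult_right_mono powr_mono2) (auto simp: infdist_nonneg)
      finally show ?case .
    qed
  qed (use id integrable_infdist_powr[OF codebook_nonempty, of p] p1 in auto)
  then have 1: "(\<integral>x. infdist x \<Gamma> powr p \<partial>\<mu>) \<le> (2 * R) powr (p - 1) * ?e" by simp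
  have "(\<Sum>g\<in>\<Gamma>d. \<integral>x. \<bar>cell_average (split_weight g) (pr x) - split_weight g x\<bar> \<partial>\<mu>)
      \<le> (\<Sum>g\<in>\<Gamma>d. 2 * (\<integral>x. \<bar>split_weight g x - h g x\<bar> \<partial>\<mu>) + 2 * L g * ?e)"
    by (intro sum_mono cell_average_L1_lipschitz integrable_split_weight h)
  also have "\<dots> = (\<Sum>g\<in>\<Gamma>d. 2 * (\<integral>x. \<bar>split_weight g x - h g x\<bar> \<partial>\<mu>)) + (\<Sum>g\<in>\<Gamma>d. 2 * L g) * ?e"
    by (simp add: sum.distrib sum_distrib_right)
  finally have 2: "radius * (\<Sum>g\<in>\<Gamma>d. \<integral>x. \<bar>cell_average (split_weight g) (pr x) - split_weight g x\<bar> \<partial>\<mu>)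
      \<le> radius * ((\<Sum>g\<in>\<Gamma>d. 2 * (\<integral>x. \<bar>split_weight g x - h g x\<bar> \<partial>\<mu>)) + (\<Sum>g\<in>\<Gamma>d. 2 * L g) * ?e)"
    by (intro mult_left_mono) auto
  let ?lhs = "(\<integral>x. infdist x \<Gamma> powr p \<partial>\<mu>) + mean_cost p
      + radius * (\<Sum>g\<in>\<Gamma>d. \<integral>x. \<bar>cell_average (split_weight g) (pr x) - split_weight g x\<bar> \<partial>\<mu>)"
  have "?lhs \<le> ?rhs" using 1 2 by (simp add: algebra_simps)
  moreover have "0 \<le> ?lhs"
    using mean_cost_nonneg[of p] by (intro add_nonneg_nonneg mult_nonneg_nonneg sum_nonneg) auto
  ultimately show ?thesis
    using p1 by (intro order_trans[OF AWp_pibar_le] powr_mono2) auto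
qed

lemma (in dual_setting) limsup_AWp_le:
  assumes quant: "\<And>N. 1 \<le> N \<Longrightarrow> quad_opt_quantizer \<mu> N (\<Gamma> N)" "\<And>N. 1 \<le> N \<Longrightarrow> borel_nn_proj (\<Gamma> N) (pr N)"
  shows "limsup (\<lambda>N. ereal (AWp p (pibar \<pi> (pr N) \<Gamma>d S) \<pi>)) \<le> ereal (mean_cost p powr (1 / p))"
proof -
  obtain C where C: "0 \<le> C"
    "\<And>N \<Gamma> pr s. \<lbrakk>1 \<le> N; quad_opt_quantizer \<mu> N \<Gamma>; borel_nn_proj \<Gamma> pr; 0 < s; s \<le> real DIM('a) + 2\<rbrakk> \<Longrightarrow>
      (\<integral>x. infdist x \<Gamma> powr s \<partial>\<mu>) \<le> (C * real N powr (- 1 / DIM('a))) powr s"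
    using distortion_mismatch by blast
  have eps: "limsup (\<lambda>N. ereal (AWp p (pibar \<pi> (pr N) \<Gamma>d S) \<pi>)) \<le> ereal ((mean_cost p + \<epsilon>) powr (1 / p))"
    if \<epsilon>: "0 < \<epsilon>" for \<epsilon>
  proof -
    \<comment> \<open>Chosen so that \<open>radius\<close> times the sum of all approximation
      errors, each counted twice, is at most \<open>\<epsilon>\<close>. The added ones keep the
      denominator positive without case distinctions.\<close>
    define \<eta> where "\<eta> = \<epsilon> / (2 * (radius + 1) * (real (card \<Gamma>d) + 1))"
    have \<eta>: "0 < \<eta>" using \<epsilon> by (simp add: \<eta>_def add_nonneg_pos)
    \<comment> \<open>The approximants are fixed before \<open>N\<close>: the weights depend on
      \<open>\<kappa>\<close> and the splitting, not on the codebook. Hence \<open>M\<close> below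
      stays constant in the limit.\<close>
    have "\<forall>g. \<exists>h L. L-lipschitz_on UNIV h \<and> integrable \<mu> h \<and> (\<integral>x. \<bar>split_weight g x - h x\<bar> \<partial>\<mu>) < \<eta>"
      using lipschitz_approximation[OF prob_space_axioms sets_law integrable_split_weight \<eta>] by blast
    then obtain h L where h: "\<And>g. (L g)-lipschitz_on UNIV (h g)" "\<And>g. integrable \<mu> (h g)"
      "\<And>g. (\<integral>x. \<bar>split_weight g x - h g x\<bar> \<partial>\<mu>) < \<eta>"
      by metis
    define M where "M = (2 * R) powr (p - 1) + radius * (\<Sum>g\<in>\<Gamma>d. 2 * L g)"
    have M0: "0 \<le> M"
      using lipschitz_on_nonneg[OF h(1)] unfolding M_def
      by (intro add_nonneg_nonneg mult_nonneg_nonneg sum_nonneg) auto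
    have small: "radius * (\<Sum>g\<in>\<Gamma>d. 2 * (\<integral>x. \<bar>split_weight g x - h g x\<bar> \<partial>\<mu>)) \<le> \<epsilon>"
    proof -
      have "(\<Sum>g\<in>\<Gamma>d. 2 * (\<integral>x. \<bar>split_weight g x - h g x\<bar> \<partial>\<mu>)) \<le> (\<Sum>g\<in>\<Gamma>d. 2 * \<eta>)"
        using h(3) by (intro sum_mono mult_left_mono less_imp_le) auto
      also have "\<dots> \<le> 2 * \<eta> * (real (card \<Gamma>d) + 1)" using \<eta> by (simp add: algebra_simps)
      also have "\<dots> = \<epsilon> / (radius + 1)"
      proof -
        have *: "2 * (\<epsilon> / (2 * r * k)) * k = \<epsilon> / r" if "k \<noteq> 0" for r k :: real using that by simp
        show ?thesis unfolding \<eta>_def by (rule *) linarith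
      qed
      finally have "radius * (\<Sum>g\<in>\<Gamma>d. 2 * (\<integral>x. \<bar>split_weight g x - h g x\<bar> \<partial>\<mu>)) \<le> radius * (\<epsilon> / (radius + 1))"
        by (intro mult_left_mono) auto
      also have "\<dots> = \<epsilon> * (radius / (radius + 1))" by simp
      also have "\<dots> \<le> \<epsilon> * 1" using \<epsilon> by (intro mult_left_mono) (auto simp: divide_le_eq_1 add_nonneg_pos)
      also have "\<epsilon> * 1 = \<epsilon>" by simp
      finally show ?thesis .
    qed
    define r where "r N = C * real N powr (- 1 / DIM('a))" for N :: nat
    have bound_N: "AWp p (pibar \<pi> (pr N) \<Gamma>d S) \<pi> \<le> (mean_cost p + \<epsilon> + M * r N) powr (1 / p)" if N: "1 \<le> N" for N
    proof -
      interpret Q: quantized_setting \<mu> R \<nu> \<pi> \<kappa> p \<Gamma>d S N "\<Gamma> N" "pr N"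
        by unfold_locales (use N quant in auto)
      \<comment> \<open>Order 1 always lies in the range of \<open>distortion_mismatch\<close>, so
        no upper restriction on \<open>p\<close> arises.\<close>
      have "(\<integral>x. infdist x (\<Gamma> N) powr 1 \<partial>\<mu>) \<le> r N powr 1"
        unfolding r_def using C(2)[OF N quant(1)[OF N] quant(2)[OF N], of 1] by simp
      then have e: "(\<integral>x. infdist x (\<Gamma> N) \<partial>\<mu>) \<le> r N"
        using C(1) by (simp add: infdist_nonneg r_def)
      have e0: "0 \<le> (\<integral>x. infdist x (\<Gamma> N) \<partial>\<mu>)" by (simp add: infdist_nonneg)
      have "AWp p (pibar \<pi> (pr N) \<Gamma>d S) \<pi> \<le>
        (mean_cost p + radius * (\<Sum>g\<in>\<Gamma>d. 2 * (\<integral>x. \<bar>split_weight g x - h g x\<bar> \<partial>\<mu>)) + M * (\<integral>x. infdist x (\<Gamma> N) \<partial>\<mu>)) powr (1 / p)"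
        unfolding M_def by (rule Q.AWp_pibar_le_lipschitz) (use h in auto)
      also have "\<dots> \<le> (mean_cost p + \<epsilon> + M * r N) powr (1 / p)"
        using small e M0 p1 mean_cost_nonneg[of p] e0
        by (intro powr_mono2 add_mono mult_left_mono) (auto intro!: add_nonneg_nonneg mult_nonneg_nonneg sum_nonneg)
      finally show ?thesis .
    qed
    have "filterlim (\<lambda>N. real N powr (- 1 / DIM('a))) (nhds 0) sequentially"
      by (rule tendsto_neg_powr[OF _ filterlim_real_sequentially]) simp
    then have "r \<longlonglongrightarrow> C * 0" unfolding r_def[abs_def] by (rule tendsto_mult_left)
    then have "(\<lambda>N. mean_cost p + \<epsilon> + M * r N) \<longlonglongrightarrow> mean_cost p + \<epsilon> + M * 0"
      by (intro tendsto_intros) simp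
    then have "(\<lambda>N. (mean_cost p + \<epsilon> + M * r N) powr (1 / p)) \<longlonglongrightarrow> (mean_cost p + \<epsilon> + M * 0) powr (1 / p)"
      using \<epsilon> mean_cost_nonneg[of p] by (intro tendsto_powr tendsto_const) auto
    then have lim: "limsup (\<lambda>N. ereal ((mean_cost p + \<epsilon> + M * r N) powr (1 / p))) = ereal ((mean_cost p + \<epsilon>) powr (1 / p))"
      by (intro lim_imp_Limsup) auto
    have "limsup (\<lambda>N. ereal (AWp p (pibar \<pi> (pr N) \<Gamma>d S) \<pi>)) \<le> limsup (\<lambda>N. ereal ((mean_cost p + \<epsilon> + M * r N) powr (1 / p)))"
      by (intro Limsup_mono eventually_sequentiallyI[of 1]) (simp add: bound_N)
    then show ?thesis unfolding lim .
  qed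
  \<comment> \<open>The bound is used for \<open>\<epsilon> = 1 / (k + 1)\<close>, and
    \<open>k\<close> tends to infinity.\<close>
  have "(\<lambda>k. mean_cost p + inverse (real (Suc k))) \<longlonglongrightarrow> mean_cost p + 0"
    by (intro tendsto_add tendsto_const LIMSEQ_inverse_real_of_nat)
  then have "(\<lambda>k. (mean_cost p + inverse (real (Suc k))) powr (1 / p)) \<longlonglongrightarrow> (mean_cost p + 0) powr (1 / p)"
    using p1 mean_cost_nonneg[of p] by (intro tendsto_powr' tendsto_const) auto
  then have "(\<lambda>k. ereal ((mean_cost p + inverse (real (Suc k))) powr (1 / p))) \<longlonglongrightarrow> ereal (mean_cost p powr (1 / p))"
    by simp
  then show ?thesis
    by (rule LIMSEQ_le_const) (use eps in auto)
qed

section \<open>Confinement of the smaller law to the ball, and conclusion\<close>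

lemma convex_on_norm_excess: "convex_on UNIV (\<lambda>x::'a::real_normed_vector. max 0 (norm x - R))"
proof (rule convex_onI)
  fix t :: real and x y :: 'a assume t: "0 < t" "t < 1"
  have "norm ((1 - t) *\<^sub>R x + t *\<^sub>R y) \<le> (1 - t) * norm x + t * norm y"
    using t norm_triangle_ineq[of "(1 - t) *\<^sub>R x" "t *\<^sub>R y"] by simp
  then have "norm ((1 - t) *\<^sub>R x + t *\<^sub>R y) - R \<le> (1 - t) * (norm x - R) + t * (norm y - R)"
    by (simp add: algebra_simps)
  also have "\<dots> \<le> (1 - t) * max 0 (norm x - R) + t * max 0 (norm y - R)"
    using t by (intro add_mono mult_left_mono) auto
  finally show "max 0 (norm ((1 - t) *\<^sub>R x + t *\<^sub>R y) - R) \<le> (1 - t) * max 0 (norm x - R) + t * max 0 (norm y - R)"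
    using t by simp
qed simp

text \<open>The excess of the norm over \<open>R\<close> is a nonnegative convex test function that
  vanishes exactly on the ball. Its integral against \<open>\<nu>\<close> is 0, hence also the one
  against \<open>\<mu>\<close>.\<close>

lemma cvx_le_AE_norm_le:
  fixes \<mu> \<nu> :: "'a::euclidean_space measure"
  assumes cvx: "cvx_le \<mu> \<nu>" and \<nu>: "sets \<nu> = sets borel" "AE y in \<nu>. norm y \<le> R"
  shows "AE x in \<mu>. norm x \<le> R"
proof -
  let ?\<phi> = "\<lambda>x::'a. max 0 (norm x - R)"
  note [measurable_cong] = \<nu>(1)
  have zero: "AE y in \<nu>. ?\<phi> y = 0" using \<nu>(2) by eventually_elim simp
  have "integrable \<nu> ?\<phi> = integrable \<nu> (\<lambda>_. 0 :: real)"
    by (rule integrable_cong_AE) (use zero in auto)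
  then have "integrable \<mu> ?\<phi>" "(\<integral>x. ?\<phi> x \<partial>\<mu>) \<le> (\<integral>x. ?\<phi> x \<partial>\<nu>)"
    using cvx convex_on_norm_excess[of R] unfolding cvx_le_def by auto
  moreover have "(\<integral>x. ?\<phi> x \<partial>\<nu>) = 0" by (rule integral_eq_zero_AE[OF zero])
  ultimately have "(\<integral>x. ?\<phi> x \<partial>\<mu>) = 0" by (intro antisym) auto
  then have "AE x in \<mu>. ?\<phi> x = 0"
    using \<open>integrable \<mu> ?\<phi>\<close> by (subst (asm) integral_nonneg_eq_0_iff_AE) auto
  then show ?thesis by eventually_elim simp
qed

text \<open>The hull contains the support, which has full measure. The cost integral is finite by
  boundedness, so \<open>enn2real\<close> in \<open>dual_opt_quant\<close> returns its true
  value.\<close>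

lemma (in martingale_setting) dual_setting_intro:
  assumes p: "1 \<le> p" and dual: "dual_opt_quant p K \<nu> \<Gamma>d S"
  shows "dual_setting \<mu> R \<nu> \<pi> \<kappa> p \<Gamma>d S"
    and "dpK p K \<nu> = dual_setting.mean_cost \<nu> S p powr (1 / p)"
proof -
  show D: "dual_setting \<mu> R \<nu> \<pi> \<kappa> p \<Gamma>d S"
  proof
    show "AE y in \<nu>. y \<in> convex hull \<Gamma>d"
      using AE_support_meas[OF sets_\<nu>] by eventually_elim (use dual in \<open>auto simp: dual_opt_quant_def\<close>)
  qed (use p dual in \<open>auto simp: dual_opt_quant_def\<close>)
  interpret dual_setting \<mu> R \<nu> \<pi> \<kappa> p \<Gamma>d S by (rule D)
  show "dpK p K \<nu> = mean_cost p powr (1 / p)"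
    using dual p nn_integral_cost[of p] mean_cost_nonneg[of p] by (simp add: dual_opt_quant_def)
qed

theorem theorem3:
  fixes \<mu> \<nu> :: "'a::euclidean_space measure" and p :: real and \<pi> :: "('a \<times> 'a) measure"
  assumes p: "p \<ge> 1"
    and \<mu>: "borel_prob \<mu>" and \<nu>: "borel_prob \<nu>"
    and cvx: "cvx_le \<mu> \<nu>"
    and cpt: "compact (support_meas \<nu>)"
    and \<pi>: "\<pi> \<in> martingale_couplings \<mu> \<nu>"
  shows
    "(\<forall>N \<Gamma> pr K \<Gamma>d S. N \<ge> 1 \<and> quad_opt_quantizer \<mu> N \<Gamma> \<and> borel_nn_proj \<Gamma> pr \<and>
        K \<ge> DIM('a) + 1 \<and> dual_opt_quant p K \<nu> \<Gamma>d S \<longrightarrow>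
        pibar \<pi> pr \<Gamma>d S \<in> martingale_couplings (distr \<mu> borel pr) (nu_check \<nu> S) \<and>
        (p \<le> 2 \<longrightarrow> Wp p (pibar \<pi> pr \<Gamma>d S) \<pi> powr p \<le> e2N \<mu> N powr p + dpK p K \<nu> powr p) \<and>
        (p \<ge> 2 \<longrightarrow> Wp 2 (pibar \<pi> pr \<Gamma>d S) \<pi> ^ 2 \<le> e2N \<mu> N ^ 2 + dpK p K \<nu> ^ 2))
     \<and> (2 < p \<and> p < 2 + real DIM('a) \<longrightarrow>
        (\<exists>C::real. \<forall>N \<Gamma> pr K \<Gamma>d S. N \<ge> 1 \<and> quad_opt_quantizer \<mu> N \<Gamma> \<and> borel_nn_proj \<Gamma> pr \<and>
          K \<ge> DIM('a) + 1 \<and> dual_opt_quant p K \<nu> \<Gamma>d S \<longrightarrow>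
          Wp p (pibar \<pi> pr \<Gamma>d S) \<pi> powr p
            \<le> C * real N powr (- p / real DIM('a)) + 2 powr ((p - 2) / 2) * dpK p K \<nu> powr p))
     \<and> (\<forall>(\<Gamma>::nat \<Rightarrow> 'a set) (pr::nat \<Rightarrow> 'a \<Rightarrow> 'a) K \<Gamma>d S.
        (\<forall>N\<ge>1. quad_opt_quantizer \<mu> N (\<Gamma> N) \<and> borel_nn_proj (\<Gamma> N) (pr N)) \<and>
        K \<ge> DIM('a) + 1 \<and> dual_opt_quant p K \<nu> \<Gamma>d S \<longrightarrow>
        limsup (\<lambda>N. ereal (AWp p (pibar \<pi> (pr N) \<Gamma>d S) \<pi>)) \<le> ereal (dpK p K \<nu>))"
proof -
  have prob_\<mu>: "prob_space \<mu>" and sets_\<mu>: "sets \<mu> = sets borel" and prob_\<nu>: "prob_space \<nu>" and sets_\<nu>: "sets \<nu> = sets borel"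
    using \<mu> \<nu> by (auto simp: borel_prob_def)
  obtain R where R: "0 < R" "\<And>y. y \<in> support_meas \<nu> \<Longrightarrow> norm y \<le> R"
    using compact_imp_bounded[OF cpt] by (auto simp: bounded_pos)
  have AE_\<nu>: "AE y in \<nu>. norm y \<le> R"
    using AE_support_meas[OF sets_\<nu>] by eventually_elim (rule R)
  obtain \<kappa> where \<kappa>: "prob_kernel \<kappa>" "\<pi> = disint \<mu> \<kappa>"
    "AE x in \<mu>. integrable (\<kappa> x) (\<lambda>y. y) \<and> (\<integral>y. y \<partial>\<kappa> x) = x"
    and marg: "distr \<pi> borel fst = \<mu>" "distr \<pi> borel snd = \<nu>"
    using \<pi> by (auto simp: martingale_couplings_def couplings_def)
  interpret M: martingale_setting \<mu> R \<nu> \<pi> \<kappa>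
    by (intro martingale_setting.intro martingale_setting_axioms.intro bounded_law.intro bounded_law_axioms.intro
        prob_\<mu> sets_\<mu> R(1) cvx_le_AE_norm_le[OF cvx sets_\<nu> AE_\<nu>] prob_\<nu> sets_\<nu> AE_\<nu> \<kappa> marg)
  have quantized: "quantized_setting \<mu> R \<nu> \<pi> \<kappa> p \<Gamma>d S N \<Gamma> pr"
    if "1 \<le> N" "quad_opt_quantizer \<mu> N \<Gamma>" "borel_nn_proj \<Gamma> pr" "dual_opt_quant p K \<nu> \<Gamma>d S" for N \<Gamma> pr K \<Gamma>d S
    using that M.dual_setting_intro(1)[OF p, of K \<Gamma>d S] M.bounded_law_axioms
    by (intro quantized_setting.intro optimal_quantizer.intro optimal_quantizer_axioms.intro)
  show ?thesis
  proof (intro conjI allI impI; (elim conjE)?)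
    fix N \<Gamma> pr K \<Gamma>d S
    assume A: "1 \<le> N" "quad_opt_quantizer \<mu> N \<Gamma>" "borel_nn_proj \<Gamma> pr" "dual_opt_quant p K \<nu> \<Gamma>d S"
    interpret Q: quantized_setting \<mu> R \<nu> \<pi> \<kappa> p \<Gamma>d S N \<Gamma> pr by (rule quantized[OF A])
    have d: "dpK p K \<nu> = Q.mean_cost p powr (1 / p)" by (rule M.dual_setting_intro(2)[OF p A(4)])
    show "pibar \<pi> pr \<Gamma>d S \<in> martingale_couplings (distr \<mu> borel pr) (nu_check \<nu> S)"
      by (rule Q.pibar_martingale)
    show "Wp p (pibar \<pi> pr \<Gamma>d S) \<pi> powr p \<le> e2N \<mu> N powr p + dpK p K \<nu> powr p" if "p \<le> 2"
      using Q.Wp_pibar_le[of p 1] sqrt_sum_squares_powr_le[of _ _ p] Q.moment_le_e2N[of p] Q.mean_cost_nonneg[of p] p that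
      by (simp add: d powr_powr)
    show "(Wp 2 (pibar \<pi> pr \<Gamma>d S) \<pi>)\<^sup>2 \<le> (e2N \<mu> N)\<^sup>2 + (dpK p K \<nu>)\<^sup>2" if "2 \<le> p"
    proof -
      have nonneg: "0 \<le> Wp 2 (pibar \<pi> pr \<Gamma>d S) \<pi>" "0 \<le> e2N \<mu> N" "0 \<le> dpK p K \<nu>"
        by (simp_all add: Wp_def e2N_def d)
      have "Wp 2 (pibar \<pi> pr \<Gamma>d S) \<pi> powr 2 \<le> (\<integral>x. infdist x \<Gamma> powr 2 \<partial>\<mu>) + Q.mean_cost 2"
        using Q.Wp_pibar_le[of 2 1] sqrt_sum_squares_powr_le[of _ _ 2] by simp
      also have "\<dots> \<le> e2N \<mu> N powr 2 + Q.mean_cost p powr (2 / p)"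
        using that by (intro add_mono Q.moment_le_e2N Q.mean_cost_lyapunov) auto
      also have "Q.mean_cost p powr (2 / p) = dpK p K \<nu> powr 2"
        by (simp add: d powr_powr)
      finally show ?thesis using nonneg by simp
    qed
  next
    assume p2: "2 < p" "p < 2 + real DIM('a)"
    obtain C where C: "0 \<le> C"
      "\<And>N \<Gamma> pr s. \<lbrakk>1 \<le> N; quad_opt_quantizer \<mu> N \<Gamma>; borel_nn_proj \<Gamma> pr; 0 < s; s \<le> real DIM('a) + 2\<rbrakk> \<Longrightarrow>
        (\<integral>x. infdist x \<Gamma> powr s \<partial>\<mu>) \<le> (C * real N powr (- 1 / DIM('a))) powr s"
      using M.distortion_mismatch by blast
    let ?c = "2 powr ((p - 2) / 2)"
    show "\<exists>C::real. \<forall>N \<Gamma> pr K \<Gamma>d S. N \<ge> 1 \<and> quad_opt_quantizer \<mu> N \<Gamma> \<and> borel_nn_proj \<Gamma> pr \<and>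
          K \<ge> DIM('a) + 1 \<and> dual_opt_quant p K \<nu> \<Gamma>d S \<longrightarrow>
          Wp p (pibar \<pi> pr \<Gamma>d S) \<pi> powr p
            \<le> C * real N powr (- p / real DIM('a)) + 2 powr ((p - 2) / 2) * dpK p K \<nu> powr p"
    \<comment> \<open>\<open>C\<close> is obtained from \<open>\<mu>\<close> before any codebook or
      grid is chosen, so the witness is free of \<open>N\<close> and \<open>K\<close>. The factor
      \<open>?c\<close> appears in it because it multiplies both error terms.\<close>
    proof (intro exI[of _ "?c * C powr p"] allI impI, elim conjE)
      fix N \<Gamma> pr K \<Gamma>d S
      assume A: "1 \<le> N" "quad_opt_quantizer \<mu> N \<Gamma>" "borel_nn_proj \<Gamma> pr" "dual_opt_quant p K \<nu> \<Gamma>d S"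
      interpret Q: quantized_setting \<mu> R \<nu> \<pi> \<kappa> p \<Gamma>d S N \<Gamma> pr by (rule quantized[OF A])
      have d: "dpK p K \<nu> = Q.mean_cost p powr (1 / p)" by (rule M.dual_setting_intro(2)[OF p A(4)])
      have "Wp p (pibar \<pi> pr \<Gamma>d S) \<pi> powr p \<le> ?c * (\<integral>x. infdist x \<Gamma> powr p \<partial>\<mu>) + ?c * Q.mean_cost p"
        using p2 by (intro Q.Wp_pibar_le sqrt_sum_squares_powr_le') auto
      \<comment> \<open>The codebook is optimal for order 2 only, so its moment of order
        \<open>p > 2\<close> is bounded by the rate instead of \<open>e2N\<close>;
        \<open>p < 2 + d\<close> keeps the order within the range of
        \<open>distortion_mismatch\<close>.\<close>
      also have "(\<integral>x. infdist x \<Gamma> powr p \<partial>\<mu>) \<le> (C * real N powr (- 1 / DIM('a))) powr p"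
        using p2 by (intro C(2)[OF A(1-3)]) auto
      also have "(C * real N powr (- 1 / DIM('a))) powr p = C powr p * real N powr (- p / real DIM('a))"
        using C(1) by (simp add: powr_mult powr_powr)
      also have "Q.mean_cost p = dpK p K \<nu> powr p"
        using p Q.mean_cost_nonneg[of p] by (simp add: d powr_powr)
      finally show "Wp p (pibar \<pi> pr \<Gamma>d S) \<pi> powr p
            \<le> ?c * C powr p * real N powr (- p / real DIM('a)) + ?c * dpK p K \<nu> powr p"
        by (simp add: mult.assoc)
    qed
  next
    fix \<Gamma> :: "nat \<Rightarrow> 'a set" and pr :: "nat \<Rightarrow> 'a \<Rightarrow> 'a" and K \<Gamma>d S
    assume quant: "\<forall>N\<ge>1. quad_opt_quantizer \<mu> N (\<Gamma> N) \<and> borel_nn_proj (\<Gamma> N) (pr N)"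
      and dual: "dual_opt_quant p K \<nu> \<Gamma>d S"
    interpret D: dual_setting \<mu> R \<nu> \<pi> \<kappa> p \<Gamma>d S by (rule M.dual_setting_intro(1)[OF p dual])
    show "limsup (\<lambda>N. ereal (AWp p (pibar \<pi> (pr N) \<Gamma>d S) \<pi>)) \<le> ereal (dpK p K \<nu>)"
      unfolding M.dual_setting_intro(2)[OF p dual] by (rule D.limsup_AWp_le) (use quant in auto)
  qed
qed

end
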